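(* Let $\mathfrak{X}=\{X_1,\dots,X_n\}$ be a frame of linearly independent smooth vector fields on $\mathbb{R}^n$, with induced Riemannian metric $g$, distance $d$, metric balls $B_r(x)$ and injectivity radius $i(x)>0$. Let $\Omega\subset\mathbb{R}^n$ be a domain and $f\colon\Omega\times\mathbb{R}\times\mathbb{R}^n\to\mathbb{R}$ a continuous function satisfying $$|f(x,p,\xi)|\le C_2|\xi|_g^{\beta}+C_3\quad\text{for all }(x,p,\xi)\in\Omega\times\mathbb{R}\times\mathbb{R}^n,$$ where $0\le\beta<4$ and $C_2,C_3$ are nonnegative constants. Let $u$ be a viscosity solution of the inhomogeneous $\infty$-Laplace equation $$\Delta_{\mathfrak{X},\infty}u(x)=f(x,u(x),D_{\mathfrak{X}}u(x))\quad\text{in }\Omega.$$ Then $u$ is locally Hölder continuous with exponent $\alpha$ for every $0<\alpha<\min\{1,\frac{4-\beta}{3}\}$. More precisely, fix such an $\alpha$. For $x_0\in\Omega$ such that $B_{2\,i(x_0)}(x_0)\subset\Omega$ and $x,y\in B_{i(x_0)/4}(x_0)$ we have $$|u(x)-u(y)|\le L_1\,d(x,y)^{\alpha},$$ where (for the fixed $\alpha$) $L_1$ depends only on $\|u\|_{L^\infty(B_{i(x_0)}(x_0))}$, the constants $C_2$ and $C_3$, the exponent $\beta$, the injectivity radius $i(x_0)$, and a constant $C(\overline{B_{2\,i(x_0)}(x_0)},g)$ depending only on the metric $g$ and the compact set $\overline{B_{2\,i(x_0)}(x_0)}$.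
   Context: Frame and metric: $X_i(x)=\sum_{j=1}^n a_{ij}(x)\,\partial/\partial x_j$ with smooth $a_{ij}$ and $\mathbb{A}(x)=(a_{ij}(x))$ satisfying $\det\mathbb{A}(x)\neq 0$ for all $x\in\mathbb{R}^n$. The Riemannian metric $g$ on $\mathbb{R}^n$ is the one for which $\{X_1(x),\dots,X_n(x)\}$ is orthonormal at every $x$, i.e. its matrix in Euclidean coordinates is $(\mathbb{A}^t(x)\mathbb{A}(x))^{-1}$. $d(x,y)$ is the Riemannian distance of $g$, $B_r(x)$ is the $d$-ball of center $x$ and radius $r$, and $i(x)>0$ is the injectivity radius of $g$ at $x$. A vector $\xi=\sum_i\xi_iX_i(x)$ has norm $|\xi|_g=(\sum_i\xi_i^2)^{1/2}$. Operators: for smooth $\phi$, $D_{\mathfrak{X}}\phi=\sum_{i=1}^n (X_i\phi)X_i$ is the gradient relative to the frame, $D^2_{\mathfrak{X}}\phi$ is the $n\times n$ matrix with entries $X_i(X_j\phi)$, and $(D^2_{\mathfrak{X}}\phi)^*=\frac12\big(D^2_{\mathfrak{X}}\phi+(D^2_{\mathfrak{X}}\phi)^t\big)$. The $\infty$-Laplacian relative to the frame is $$\Delta_{\mathfrak{X},\infty}\phi=\langle (D^2_{\mathfrak{X}}\phi)^*D_{\mathfrak{X}}\phi,D_{\mathfrak{X}}\phi\rangle_g=\sum_{i,j=1}^n X_iX_j\phi\;X_i\phi\;X_j\phi.$$ Viscosity solutions: an upper semicontinuous $u$ is a viscosity subsolution of $\Delta_{\mathfrak{X},\infty}u=f(x,u,D_{\mathfrak{X}}u)$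 in $\Omega$ if whenever $\phi\in C^2(\Omega)$ touches $u$ from above at $x_0\in\Omega$ (that is, $\phi(x_0)=u(x_0)$ and $\phi\ge u$ in a neighborhood of $x_0$), one has $\Delta_{\mathfrak{X},\infty}\phi(x_0)\ge f(x_0,\phi(x_0),D_{\mathfrak{X}}\phi(x_0))$. A lower semicontinuous $u$ is a viscosity supersolution if whenever $\phi\in C^2(\Omega)$ touches $u$ from below at $x_0\in\Omega$ (that is, $\phi(x_0)=u(x_0)$ and $\phi\le u$ in a neighborhood of $x_0$), one has $\Delta_{\mathfrak{X},\infty}\phi(x_0)\le f(x_0,\phi(x_0),D_{\mathfrak{X}}\phi(x_0))$. A viscosity solution is both a viscosity subsolution and a viscosity supersolution. *)

theory Defs
  imports "HOL-Analysis.Analysis" "HOL-Probability.Essential_Supremum"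
begin

section \<open>Functions of class \<open>C\<^sup>k\<close>\<close>

definition partial :: "'n::finite \<Rightarrow> (real^'n \<Rightarrow> real) \<Rightarrow> real^'n \<Rightarrow> real"
  where "partial j \<phi> x = frechet_derivative \<phi> (at x) (axis j 1)"

text \<open>Intended for open sets \<open>S\<close>.\<close>

fun Ck_on :: "nat \<Rightarrow> (real^'n::finite) set \<Rightarrow> (real^'n \<Rightarrow> real) \<Rightarrow> bool"
  where
    "Ck_on 0 S \<phi> \<longleftrightarrow> continuous_on S \<phi>"
  | "Ck_on (Suc k) S \<phi> \<longleftrightarrow> (\<forall>x\<in>S. \<phi> differentiable (at x)) \<and> (\<forall>j. Ck_on k S (partial j \<phi>))"

definition smooth_on :: "(real^'n::finite) set \<Rightarrow> (real^'n \<Rightarrow> real) \<Rightarrow> bool"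
  where "smooth_on S \<phi> \<longleftrightarrow> (\<forall>k. Ck_on k S \<phi>)"

definition smooth_map_on :: "(real^'n::finite) set \<Rightarrow> (real^'n \<Rightarrow> real^'m::finite) \<Rightarrow> bool"
  where "smooth_map_on S F \<longleftrightarrow> (\<forall>i. smooth_on S (\<lambda>x. F x $ i))"

definition diffeo_onto_image :: "(real^'n::finite) set \<Rightarrow> (real^'n \<Rightarrow> real^'n) \<Rightarrow> bool"
  where "diffeo_onto_image S F \<longleftrightarrow>
    inj_on F S \<and> open (F ` S) \<and> smooth_map_on S F \<and> smooth_map_on (F ` S) (the_inv_into S F)"

section \<open>Frames and Riemannian metrics\<close>

text \<open>
  A frame is given by its coefficient matrix \<open>A\<close>: the vector \<open>X\<^sub>i(x)\<close> is the row \<open>A x $ i\<close>.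
  A metric is given by its matrix \<open>G x\<close> in Euclidean coordinates.
\<close>

definition smooth_frame :: "(real^'n::finite \<Rightarrow> real^'n^'n) \<Rightarrow> bool"
  where "smooth_frame A \<longleftrightarrow>
    (\<forall>i j. smooth_on UNIV (\<lambda>x. A x $ i $ j)) \<and> (\<forall>x. det (A x) \<noteq> 0)"

definition frame_metric :: "(real^'n::finite \<Rightarrow> real^'n^'n) \<Rightarrow> real^'n \<Rightarrow> real^'n^'n"
  where "frame_metric A x = matrix_inv (transpose (A x) ** A x)"

definition metric_inner :: "(real^'n::finite \<Rightarrow> real^'n^'n) \<Rightarrow> real^'n \<Rightarrow> real^'n \<Rightarrow> real^'n \<Rightarrow> real"
  where "metric_inner G x v w = v \<bullet> (G x *v w)"

definition metric_norm :: "(real^'n::finite \<Rightarrow> real^'n^'n) \<Rightarrow> real^'n \<Rightarrow> real^'n \<Rightarrow> real"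
  where "metric_norm G x v = sqrt (metric_inner G x v v)"

lemma frame_metric_orthonormal:
  assumes "smooth_frame A"
  shows "metric_inner (frame_metric A) x (A x $ i) (A x $ j) = (if i = j then 1 else 0)"
proof -
  have inv: "invertible (A x)"
    using assms by (simp add: smooth_frame_def invertible_det_nz)
  obtain B where AB: "A x ** B = mat 1" and BA: "B ** A x = mat 1"
    using inv by (auto simp: invertible_def)
  let ?T = "transpose (A x)" and ?N = "frame_metric A x"
  have "?T ** transpose B = mat 1" and tBA: "transpose B ** ?T = mat 1"
    by (metis AB BA matrix_transpose_mul transpose_mat)+
  then have "invertible ?T"
    by (auto simp: invertible_def)
  then have "invertible (?T ** A x)"
    using inv by (rule invertible_mult)
  then have "?T ** A x ** ?N = mat 1"
    unfolding invertible_def frame_metric_def matrix_inv_def by (rule someI2_ex) simp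
  then have "A x ** ?N = transpose B"
    by (metis tBA matrix_mul_assoc matrix_mul_lid matrix_mul_rid)
  then have eq: "A x ** ?N ** ?T = mat 1"
    by (simp add: tBA)
  have "metric_inner (frame_metric A) x (A x $ i) (A x $ j) =
      (A x ** (frame_metric A x ** transpose (A x))) $ i $ j"
    by (simp add: metric_inner_def inner_vec_def matrix_matrix_mult_def matrix_vector_mult_def
        transpose_def)
  then show ?thesis
    using eq by (simp add: matrix_mul_assoc mat_def)
qed

text \<open>
  The integrability condition is essential: \<^const>\<open>valid_path\<close> allows unbounded derivatives near
  the break points, and \<^const>\<open>integral\<close> is \<open>0\<close> for non-integrable functions.
\<close>

definition riem_dist :: "(real^'n::finite \<Rightarrow> real^'n^'n) \<Rightarrow> real^'n \<Rightarrow> real^'n \<Rightarrow> real"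
  where "riem_dist G x y = Inf {integral {0..1} (\<lambda>t. metric_norm G (c t) (vector_derivative c (at t))) | c.
    valid_path c \<and> pathstart c = x \<and> pathfinish c = y \<and>
    (\<lambda>t. metric_norm G (c t) (vector_derivative c (at t))) integrable_on {0..1}}"

text \<open>The radius is extended real because injectivity radii may be infinite.\<close>

definition riem_ball :: "(real^'n::finite \<Rightarrow> real^'n^'n) \<Rightarrow> ereal \<Rightarrow> real^'n \<Rightarrow> (real^'n) set"
  where "riem_ball G r x = {y. ereal (riem_dist G x y) < r}"

section \<open>Exponential map and injectivity radius\<close>

definition christoffel :: "(real^'n::finite \<Rightarrow> real^'n^'n) \<Rightarrow> 'n \<Rightarrow> 'n \<Rightarrow> 'n \<Rightarrow> real^'n \<Rightarrow> real"
  where "christoffel G k i j x =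
    (\<Sum>l\<in>UNIV. matrix_inv (G x) $ k $ l *
      (partial i (\<lambda>y. G y $ j $ l) x + partial j (\<lambda>y. G y $ i $ l) x
        - partial l (\<lambda>y. G y $ i $ j) x)) / 2"

text \<open>
  \<open>exp_graph G x v y\<close>: the geodesic \<open>c\<close> with \<open>c(0) = x\<close> and velocity \<open>c'(0) = v\<close> exists up to
  time \<open>1\<close> and \<open>c(1) = y\<close>.  The metric is not assumed to be complete, so such a geodesic
  need not exist.
\<close>

definition exp_graph :: "(real^'n::finite \<Rightarrow> real^'n^'n) \<Rightarrow> real^'n \<Rightarrow> real^'n \<Rightarrow> real^'n \<Rightarrow> bool"
  where "exp_graph G x v y \<longleftrightarrow> (\<exists>c c'.
    (\<forall>t\<in>{0..1}. (c has_vector_derivative c' t) (at t within {0..1}) \<and>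
      (c' has_vector_derivative
        (\<chi> k. - (\<Sum>i\<in>UNIV. \<Sum>j\<in>UNIV. christoffel G k i j (c t) * c' t $ i * c' t $ j)))
        (at t within {0..1})) \<and>
    c 0 = x \<and> c' 0 = v \<and> c 1 = y)"

definition riem_exp :: "(real^'n::finite \<Rightarrow> real^'n^'n) \<Rightarrow> real^'n \<Rightarrow> real^'n \<Rightarrow> real^'n"
  where "riem_exp G x v = (THE y. exp_graph G x v y)"

definition inj_radius :: "(real^'n::finite \<Rightarrow> real^'n^'n) \<Rightarrow> real^'n \<Rightarrow> ereal"
  where "inj_radius G x = Sup {ereal r | r. 0 \<le> r \<and>
    (\<forall>v. metric_norm G x v < r \<longrightarrow> (\<exists>y. exp_graph G x v y)) \<and>
    diffeo_onto_image {v. metric_norm G x v < r} (riem_exp G x)}"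

section \<open>The \<open>\<infinity>\<close>-Laplacian relative to a frame\<close>

definition frame_deriv :: "(real^'n::finite \<Rightarrow> real^'n^'n) \<Rightarrow> 'n \<Rightarrow> (real^'n \<Rightarrow> real) \<Rightarrow> real^'n \<Rightarrow> real"
  where "frame_deriv A i \<phi> x = (\<Sum>j\<in>UNIV. A x $ i $ j * partial j \<phi> x)"

text \<open>
  The gradient is represented by its coordinates with respect to the frame \<open>X\<^sub>1(x), \<dots>, X\<^sub>n(x)\<close>.
  In these coordinates \<open>\<langle>\<cdot>,\<cdot>\<rangle>\<^sub>g\<close> and \<open>|\<cdot>|\<^sub>g\<close> are the Euclidean inner product and norm of \<open>real^'n\<close>.
\<close>

definition frame_grad :: "(real^'n::finite \<Rightarrow> real^'n^'n) \<Rightarrow> (real^'n \<Rightarrow> real) \<Rightarrow> real^'n \<Rightarrow> real^'n"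
  where "frame_grad A \<phi> x = (\<chi> i. frame_deriv A i \<phi> x)"

definition frame_hessian :: "(real^'n::finite \<Rightarrow> real^'n^'n) \<Rightarrow> (real^'n \<Rightarrow> real) \<Rightarrow> real^'n \<Rightarrow> real^'n^'n"
  where "frame_hessian A \<phi> x = (\<chi> i j. frame_deriv A i (frame_deriv A j \<phi>) x)"

definition frame_hessian_sym :: "(real^'n::finite \<Rightarrow> real^'n^'n) \<Rightarrow> (real^'n \<Rightarrow> real) \<Rightarrow> real^'n \<Rightarrow> real^'n^'n"
  where "frame_hessian_sym A \<phi> x =
    (1/2) *\<^sub>R (frame_hessian A \<phi> x + transpose (frame_hessian A \<phi> x))"

definition inf_laplacian :: "(real^'n::finite \<Rightarrow> real^'n^'n) \<Rightarrow> (real^'n \<Rightarrow> real) \<Rightarrow> real^'n \<Rightarrow> real"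
  where "inf_laplacian A \<phi> x = (frame_hessian_sym A \<phi> x *v frame_grad A \<phi> x) \<bullet> frame_grad A \<phi> x"

lemma inf_laplacian_eq_sum:
  "inf_laplacian A \<phi> x =
    (\<Sum>i\<in>UNIV. \<Sum>j\<in>UNIV.
      frame_deriv A i (frame_deriv A j \<phi>) x * frame_deriv A i \<phi> x * frame_deriv A j \<phi> x)"
proof -
  let ?H = "\<lambda>i j. frame_deriv A i (frame_deriv A j \<phi>) x"
  let ?D = "\<lambda>i. frame_deriv A i \<phi> x"
  have "inf_laplacian A \<phi> x = (\<Sum>i\<in>UNIV. \<Sum>j\<in>UNIV. (?H i j + ?H j i) / 2 * ?D j * ?D i)"
    by (simp add: inf_laplacian_def frame_hessian_sym_def frame_hessian_def frame_grad_def
        inner_vec_def matrix_vector_mult_def transpose_def sum_distrib_right)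
  also have "\<dots> = (\<Sum>i\<in>UNIV. \<Sum>j\<in>UNIV. ?H i j * ?D i * ?D j) / 2
      + (\<Sum>i\<in>UNIV. \<Sum>j\<in>UNIV. ?H j i * ?D j * ?D i) / 2"
    by (simp add: sum_divide_distrib flip: sum.distrib) (simp add: algebra_simps add_divide_distrib)
  also have "(\<Sum>i\<in>UNIV. \<Sum>j\<in>UNIV. ?H j i * ?D j * ?D i) = (\<Sum>i\<in>UNIV. \<Sum>j\<in>UNIV. ?H i j * ?D i * ?D j)"
    by (rule sum.swap)
  finally show ?thesis by simp
qed

section \<open>Viscosity solutions\<close>

definition usc_on :: "'a::topological_space set \<Rightarrow> ('a \<Rightarrow> real) \<Rightarrow> bool"
  where "usc_on S u \<longleftrightarrow> (\<forall>x\<in>S. \<forall>c. u x < c \<longrightarrow> (\<forall>\<^sub>F y in at x within S. u y < c))"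

definition lsc_on :: "'a::topological_space set \<Rightarrow> ('a \<Rightarrow> real) \<Rightarrow> bool"
  where "lsc_on S u \<longleftrightarrow> (\<forall>x\<in>S. \<forall>c. c < u x \<longrightarrow> (\<forall>\<^sub>F y in at x within S. c < u y))"

definition viscosity_subsolution ::
  "(real^'n::finite \<Rightarrow> real^'n^'n) \<Rightarrow> (real^'n) set \<Rightarrow> (real^'n \<Rightarrow> real \<Rightarrow> real^'n \<Rightarrow> real) \<Rightarrow>
    (real^'n \<Rightarrow> real) \<Rightarrow> bool"
  where "viscosity_subsolution A \<Omega> f u \<longleftrightarrow> usc_on \<Omega> u \<and>
    (\<forall>x0\<in>\<Omega>. \<forall>\<phi>. Ck_on 2 \<Omega> \<phi> \<and> \<phi> x0 = u x0 \<and> (\<forall>\<^sub>F y in nhds x0. u y \<le> \<phi> y) \<longrightarrow>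
      inf_laplacian A \<phi> x0 \<ge> f x0 (\<phi> x0) (frame_grad A \<phi> x0))"

definition viscosity_supersolution ::
  "(real^'n::finite \<Rightarrow> real^'n^'n) \<Rightarrow> (real^'n) set \<Rightarrow> (real^'n \<Rightarrow> real \<Rightarrow> real^'n \<Rightarrow> real) \<Rightarrow>
    (real^'n \<Rightarrow> real) \<Rightarrow> bool"
  where "viscosity_supersolution A \<Omega> f u \<longleftrightarrow> lsc_on \<Omega> u \<and>
    (\<forall>x0\<in>\<Omega>. \<forall>\<phi>. Ck_on 2 \<Omega> \<phi> \<and> \<phi> x0 = u x0 \<and> (\<forall>\<^sub>F y in nhds x0. \<phi> y \<le> u y) \<longrightarrow>
      inf_laplacian A \<phi> x0 \<le> f x0 (\<phi> x0) (frame_grad A \<phi> x0))"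

definition viscosity_solution ::
  "(real^'n::finite \<Rightarrow> real^'n^'n) \<Rightarrow> (real^'n) set \<Rightarrow> (real^'n \<Rightarrow> real \<Rightarrow> real^'n \<Rightarrow> real) \<Rightarrow>
    (real^'n \<Rightarrow> real) \<Rightarrow> bool"
  where "viscosity_solution A \<Omega> f u \<longleftrightarrow>
    viscosity_subsolution A \<Omega> f u \<and> viscosity_supersolution A \<Omega> f u"

section \<open>Growth condition, norms and local Hoelder continuity\<close>

text \<open>Unlike \<open>powr\<close>, this satisfies \<open>0\<^sup>0 = 1\<close>.\<close>

definition rpow :: "real \<Rightarrow> real \<Rightarrow> real"
  where "rpow t b = (if b = 0 then 1 else t powr b)"

definition growth_bound ::
  "(real^'n::finite) set \<Rightarrow> (real^'n \<Rightarrow> real \<Rightarrow> real^'n \<Rightarrow> real) \<Rightarrow> real \<Rightarrow> real \<Rightarrow> real \<Rightarrow> bool"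
  where "growth_bound \<Omega> f \<beta> C2 C3 \<longleftrightarrow>
    (\<forall>x\<in>\<Omega>. \<forall>p \<xi>. \<bar>f x p \<xi>\<bar> \<le> C2 * rpow (norm \<xi>) \<beta> + C3)"

definition Linf_norm :: "(real^'n::finite) set \<Rightarrow> (real^'n \<Rightarrow> real) \<Rightarrow> ereal"
  where "Linf_norm S u = esssup (restrict_space lebesgue S) (\<lambda>x. ereal \<bar>u x\<bar>)"

definition locally_holder_on ::
  "(real^'n::finite \<Rightarrow> real^'n^'n) \<Rightarrow> (real^'n) set \<Rightarrow> real \<Rightarrow> (real^'n \<Rightarrow> real) \<Rightarrow> bool"
  where "locally_holder_on G \<Omega> \<alpha> u \<longleftrightarrow>
    (\<forall>z\<in>\<Omega>. \<exists>U K. open U \<and> z \<in> U \<and> U \<subseteq> \<Omega> \<and>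
      (\<forall>x\<in>U. \<forall>y\<in>U. \<bar>u x - u y\<bar> \<le> K * riem_dist G x y powr \<alpha>))"

end

theory Submission
  imports Defs
begin

text \<open>
  The distance \<open>d\<close> from \<open>y\<close> satisfies \<open>\<bar>\<nabla>d\<bar> = 1\<close>, so \<open>\<phi>(d)\<close> has \<open>\<infinity>\<close>-Laplacian \<open>\<phi>''(d) \<phi>'(d)\<^sup>2\<close>. For
  \<open>\<phi> t = L t\<^sup>\<alpha>\<close> with \<open>\<alpha> < 1\<close> this is negative of order \<open>L\<^sup>3 t\<close> to the power \<open>3\<alpha> - 4\<close>, which near
  \<open>t = 0\<close> dominates the growth bound for \<open>f\<close>, as \<open>\<beta> < 4\<close>. Hence \<open>u - \<phi>(d)\<close> has no interior
  maximum exceeding \<open>u(y)\<close>, and \<open>u(x) - u(y) \<le> L d(x, y)\<^sup>\<alpha>\<close>; the lower bound follows by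
  applying this to \<open>- u\<close>.

  No smoothness of \<open>d\<close> is needed. At a maximum point \<open>p\<close> choose \<open>z\<close> almost on a shortest path
  from \<open>y\<close> to \<open>p\<close>, at small distance \<open>r\<close> from \<open>p\<close>. Then \<open>d(y, x) \<le> d(y, p) - r + d(z, x)\<close> up to
  \<open>o(r\<^sup>2)\<close>, and in second-order normal coordinates at \<open>p\<close> the last term is a Euclidean distance
  up to \<open>o(r\<^sup>2)\<close>. A quadratic penalty with coefficient \<open>o(1)\<close> absorbs these errors.

  The maximum exists because closed balls of radius less than the injectivity radius are compact,
  by the Gauss lemma. The resulting \<open>L\<close> does not depend on the geometry beyond \<open>i(x\<^sub>0)\<close>, so the
  constant \<open>C\<close> of the theorem can be taken to be \<open>0\<close>.
\<close>

section \<open>Calculus of \<open>C\<^sup>k\<close> functions\<close>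

text \<open>The cone with nearby centre \<open>z\<close> has second derivatives of order 1/r
  orthogonally to its gradient. They enter only through the part of the gradient (after
  multiplication by the Gram matrix) that is not radial; that part is O(r), so its square divided by
  \<open>r\<close> tends to 0. The reason for second-order coordinates lies elsewhere. If the Gram
  matrix is merely the identity at \<open>p\<close>, distances at scale \<open>r\<close> are wrong
  by order r^2, so the penalty coefficient must be of order 1; its Hessian, and the first
  derivatives of the Gram matrix that occur in the \<infinity>-Laplacian, would then survive in the
  limit. With vanishing first derivatives both are of order \<epsilon>.

  The barrier is not obtained by fixing a radius and enlarging \<open>L\<close>. The product m = L
  t0^\<alpha> is fixed first, large enough to exceed the oscillation of \<open>u\<close>, and then
  t0 tends to 0. This keeps the boundary values under control while the \<infinity>-Laplacian of the
  barrier outgrows the bound for \<open>f\<close>.\<close>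

lemma partial_eq: "(f has_derivative f') (at x) \<Longrightarrow> partial j f x = f' (axis j 1)"
  by (metis frechet_derivative_at partial_def)

lemma partial_const [simp]: "partial j (\<lambda>x. c) x = 0"
  by (rule partial_eq[THEN trans]) (auto intro!: derivative_eq_intros)

lemma partial_component: "partial j (\<lambda>x. x $ i) x = (if i = j then 1 else 0)"
  by (rule partial_eq[THEN trans, OF bounded_linear.has_derivative[OF bounded_linear_vec_nth has_derivative_ident]])
     (auto simp: axis_def)

lemma partial_add:
  assumes "f differentiable (at x)" "g differentiable (at x)"
  shows "partial j (\<lambda>x. f x + g x) x = partial j f x + partial j g x"
  by (rule partial_eq[THEN trans, OF has_derivative_add[OF assms[unfolded frechet_derivative_works]]])
     (simp add: partial_def)

lemma partial_mult:
  assumes "f differentiable (at x)" "g differentiable (at x)"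
  shows "partial j (\<lambda>x. f x * g x) x = f x * partial j g x + g x * partial j f x"
  by (rule partial_eq[THEN trans, OF has_derivative_mult[OF assms[unfolded frechet_derivative_works]]])
     (simp add: partial_def mult.commute)

lemma partial_compose:
  assumes "f differentiable (at x)" "(h has_real_derivative h') (at (f x))"
  shows "partial j (\<lambda>x. h (f x)) x = h' * partial j f x"
  using partial_eq[OF has_derivative_compose[OF assms(1)[unfolded frechet_derivative_works] assms(2)[unfolded has_field_derivative_def]], of j]
  by (simp add: partial_def)

lemma frechet_derivative_eq_sum_partial:
  assumes "f differentiable (at x)"
  shows "frechet_derivative f (at x) v = (\<Sum>j\<in>UNIV. v $ j * partial j f x)"
proof -
  let ?D = "frechet_derivative f (at x)"
  have L: "linear ?D" using assms frechet_derivative_works has_derivative_linear by blast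
  have "?D v = ?D (\<Sum>j\<in>UNIV. v $ j *\<^sub>R axis j 1)"
    by (simp add: basis_expansion scalar_mult_eq_scaleR[symmetric])
  also have "\<dots> = (\<Sum>j\<in>UNIV. v $ j * partial j f x)"
    by (simp add: linear_sum[OF L] linear_scale[OF L] partial_def)
  finally show ?thesis .
qed

lemma has_derivative_partial:
  assumes "f differentiable (at x)"
  shows "(f has_derivative (\<lambda>v. \<Sum>j\<in>UNIV. v $ j * partial j f x)) (at x)"
  using assms frechet_derivative_works[of f "at x"]
  by (simp add: frechet_derivative_eq_sum_partial[OF assms, abs_def])

lemma Ck_on_SucD: "Ck_on (Suc k) S f \<Longrightarrow> Ck_on k S f"
proof (induction k arbitrary: f)
  case 0
  then show ?case
    by (metis Ck_on.simps differentiable_at_withinI differentiable_imp_continuous_on differentiable_on_def)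
qed auto

lemma Ck_on_le: "Ck_on k S f \<Longrightarrow> j \<le> k \<Longrightarrow> Ck_on j S f"
  by (induction "k - j" arbitrary: j) (auto, metis Ck_on_SucD Suc_diff_Suc diff_diff_cancel diff_le_self Suc_leI diff_Suc_1 le_neq_implies_less zero_less_Suc zero_less_diff)

lemma Ck_on_subset: "Ck_on k S f \<Longrightarrow> T \<subseteq> S \<Longrightarrow> Ck_on k T f"
  by (induction k arbitrary: f) (auto intro: continuous_on_subset)

lemma Ck_on_const [simp]: "Ck_on k UNIV (\<lambda>x. c)"
proof (induction k arbitrary: c)
  case (Suc k)
  then show ?case by (simp add: partial_const[abs_def])
qed simp

lemma Ck_on_component [simp]: "Ck_on k UNIV (\<lambda>x::real^'n::finite. x $ i)"
proof (cases k)
  case (Suc m)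
  have "(\<lambda>x. x $ i) differentiable at x" for x :: "real^'n::finite"
    using bounded_linear_vec_nth bounded_linear_imp_differentiable by blast
  then show ?thesis by (simp add: Suc partial_component[abs_def])
qed (auto intro!: continuous_intros)

lemma Ck_on_add:
  "Ck_on k UNIV f \<Longrightarrow> Ck_on k UNIV g \<Longrightarrow> Ck_on k UNIV (\<lambda>x. f x + g x)"
proof (induction k arbitrary: f g)
  case (Suc k)
  then have "partial j (\<lambda>x. f x + g x) = (\<lambda>x. partial j f x + partial j g x)" for j
    by (auto intro!: partial_add)
  with Suc show ?case by auto
qed (auto intro: continuous_intros)

lemma Ck_on_mult:
  "Ck_on k UNIV f \<Longrightarrow> Ck_on k UNIV g \<Longrightarrow> Ck_on k UNIV (\<lambda>x. f x * g x)"
proof (induction k arbitrary: f g)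
  case (Suc k)
  then have "partial j (\<lambda>x. f x * g x) = (\<lambda>x. f x * partial j g x + g x * partial j f x)" for j
    by (auto intro!: partial_mult)
  moreover have "Ck_on k UNIV f" "Ck_on k UNIV g"
    using Suc.prems Ck_on_SucD by blast+
  ultimately show ?case using Suc by (auto intro!: Ck_on_add)
qed (auto intro: continuous_intros)

lemma Ck_on_inverse:
  "Ck_on k UNIV f \<Longrightarrow> (\<And>x. f x \<noteq> 0) \<Longrightarrow> Ck_on k UNIV (\<lambda>x. inverse (f x))"
proof (induction k)
  case (Suc k)
  have "partial j (\<lambda>x. inverse (f x)) x = - (inverse (f x) * inverse (f x)) * partial j f x" for j x
    by (rule partial_compose) (use Suc.prems in \<open>auto intro!: derivative_eq_intros\<close>)
  then have *: "partial j (\<lambda>x. inverse (f x)) = (\<lambda>x. (- 1) * (inverse (f x) * inverse (f x)) * partial j f x)" for j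
    by auto
  have "Ck_on k UNIV (\<lambda>x. inverse (f x))"
    using Suc Ck_on_SucD by blast
  then show ?case
    using Suc.prems unfolding Ck_on.simps * by (intro conjI ballI allI Ck_on_mult Ck_on_const) auto
qed (auto intro: continuous_intros)

lemma Ck_on_sum:
  assumes "\<And>i. i \<in> I \<Longrightarrow> Ck_on k UNIV (f i)"
  shows "Ck_on k UNIV (\<lambda>x. \<Sum>i\<in>I. f i x)"
  using assms by (induction I rule: infinite_finite_induct) (auto intro!: Ck_on_add)

lemma Ck_on_prod:
  assumes "\<And>i. i \<in> I \<Longrightarrow> Ck_on k UNIV (f i)"
  shows "Ck_on k UNIV (\<lambda>x. \<Prod>i\<in>I. f i x)"
  using assms by (induction I rule: infinite_finite_induct) (auto intro!: Ck_on_mult)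

lemma Ck_on_uminus: "Ck_on k UNIV f \<Longrightarrow> Ck_on k UNIV (\<lambda>x. - f x)"
  using Ck_on_mult[of k "\<lambda>x. - 1" f] by simp

lemma Ck_on_diff: "Ck_on k UNIV f \<Longrightarrow> Ck_on k UNIV g \<Longrightarrow> Ck_on k UNIV (\<lambda>x. f x - g x)"
  using Ck_on_add[of k f "\<lambda>x. - g x"] Ck_on_uminus[of k g] by simp

lemma Ck_on_det:
  assumes "\<And>i j. Ck_on k UNIV (\<lambda>x. M x $ i $ j)"
  shows "Ck_on k UNIV (\<lambda>x. det (M x))"
  unfolding det_def by (intro Ck_on_sum Ck_on_mult Ck_on_prod Ck_on_const assms)

section \<open>Regularity of the inverse matrix\<close>

lemma matrix_inv_left_right:
  fixes M :: "'a::field^'n::finite^'n"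
  assumes "det M \<noteq> 0"
  shows "M ** matrix_inv M = mat 1" "matrix_inv M ** M = mat 1"
proof -
  have "invertible M" using assms by (simp add: invertible_det_nz)
  then have "M ** matrix_inv M = mat 1 \<and> matrix_inv M ** M = mat 1"
    unfolding invertible_def matrix_inv_def by (rule someI2_ex) simp
  then show "M ** matrix_inv M = mat 1" "matrix_inv M ** M = mat 1" by auto
qed

text \<open>Cramer's rule: the entries of the inverse are quotients of determinants, so their
  regularity reduces to that of sums, products and reciprocals.\<close>

lemma matrix_inv_nth:
  fixes M :: "real^'n::finite^'n"
  assumes nz: "det M \<noteq> 0"
  shows "matrix_inv M $ i $ j = det (\<chi> p q. if q = i then axis j 1 $ p else M $ p $ q) / det M"
proof -
  have "M *v (matrix_inv M *v axis j 1) = axis j 1"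
    by (simp add: matrix_vector_mul_assoc matrix_inv_left_right(1)[OF nz])
  then have "matrix_inv M *v axis j 1 = (\<chi> k. det (\<chi> p q. if q = k then axis j 1 $ p else M $ p $ q) / det M)"
    using cramer[OF nz] by blast
  then have "(matrix_inv M *v axis j 1) $ i = det (\<chi> p q. if q = i then axis j 1 $ p else M $ p $ q) / det M"
    by simp
  then show ?thesis by (simp add: matrix_vector_mult_basis column_def)
qed

lemma Ck_on_matrix_inv:
  fixes M :: "real^'n::finite \<Rightarrow> real^'m::finite^'m"
  assumes M: "\<And>i j. Ck_on k UNIV (\<lambda>x. M x $ i $ j)" and nz: "\<And>x. det (M x) \<noteq> 0"
  shows "Ck_on k UNIV (\<lambda>x. matrix_inv (M x) $ i $ j)"
proof -
  let ?C = "\<lambda>x. \<chi> p q. if q = i then axis j 1 $ p else M x $ p $ q"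
  have "Ck_on k UNIV (\<lambda>x. ?C x $ p $ q)" for p q
    by (cases "q = i") (auto intro: M)
  then show ?thesis
    unfolding matrix_inv_nth[OF nz] divide_inverse
    by (intro Ck_on_mult Ck_on_inverse Ck_on_det M nz)
qed

lemma continuous_on_det:
  assumes "\<And>i j. continuous_on S (\<lambda>x. M x $ i $ j :: real)"
  shows "continuous_on S (\<lambda>x. det (M x))"
  unfolding det_def by (intro continuous_on_sum continuous_on_mult continuous_on_const continuous_on_prod assms)

lemma continuous_on_matrix_inv:
  fixes M :: "'a::topological_space \<Rightarrow> real^'m::finite^'m"
  assumes M: "\<And>i j. continuous_on S (\<lambda>x. M x $ i $ j)" and nz: "\<And>x. x \<in> S \<Longrightarrow> det (M x) \<noteq> 0"
  shows "continuous_on S (\<lambda>x. matrix_inv (M x) $ i $ j)"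
proof -
  let ?C = "\<lambda>x. \<chi> p q. if q = i then axis j 1 $ p else M x $ p $ q"
  have C: "continuous_on S (\<lambda>x. ?C x $ p $ q)" for p q
    by (cases "q = i") (auto intro: M)
  have "continuous_on S (\<lambda>x. det (?C x) / det (M x))"
    using nz by (intro continuous_on_divide continuous_on_det M C) auto
  then show ?thesis
    by (rule continuous_on_eq) (simp add: matrix_inv_nth nz)
qed

lemma Ck_on_imp_continuous: "Ck_on k S f \<Longrightarrow> continuous_on S f"
  using Ck_on_le[of k S f 0] by simp

lemma Ck_on_imp_differentiable: "Ck_on k S f \<Longrightarrow> k > 0 \<Longrightarrow> x \<in> S \<Longrightarrow> f differentiable (at x)"
  by (cases k) auto

lemma Ck_on_partial: "Ck_on (Suc k) S f \<Longrightarrow> Ck_on k S (partial j f)"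
  by simp

section \<open>The distance of a frame metric\<close>

lemma matrix_inv_eqI:
  fixes M :: "'a::field^'n::finite^'n"
  assumes "M ** B = mat 1"
  shows "matrix_inv M = B"
proof -
  have "det M \<noteq> 0" using assms by (metis det_I det_mul mult_zero_left zero_neq_one)
  then show ?thesis
    by (metis assms matrix_inv_left_right(2) matrix_mul_assoc matrix_mul_lid matrix_mul_rid)
qed

lemma norm_matrix_vector_mult_le:
  fixes M :: "real^'n::finite^'m::finite"
  shows "norm (M *v v) \<le> (\<Sum>i\<in>UNIV. \<Sum>j\<in>UNIV. \<bar>M $ i $ j\<bar>) * norm v"
proof -
  have "norm (M *v v) \<le> (\<Sum>i\<in>UNIV. \<bar>(M *v v) $ i\<bar>)" by (rule norm_le_l1_cart)
  also have "\<dots> \<le> (\<Sum>i\<in>UNIV. \<Sum>j\<in>UNIV. \<bar>M $ i $ j\<bar> * norm v)"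
  proof (rule sum_mono)
    fix i
    have "\<bar>(M *v v) $ i\<bar> \<le> (\<Sum>j\<in>UNIV. \<bar>M $ i $ j * v $ j\<bar>)"
      by (simp add: matrix_vector_mult_def)
    also have "\<dots> \<le> (\<Sum>j\<in>UNIV. \<bar>M $ i $ j\<bar> * norm v)"
      by (rule sum_mono) (simp add: abs_mult component_le_norm_cart mult_left_mono)
    finally show "\<bar>(M *v v) $ i\<bar> \<le> (\<Sum>j\<in>UNIV. \<bar>M $ i $ j\<bar> * norm v)" .
  qed
  finally show ?thesis by (simp add: sum_distrib_right)
qed

lemma continuous_on_compact_bounded:
  fixes f :: "'a::topological_space \<Rightarrow> 'b::real_normed_vector"
  assumes "compact K" "continuous_on K f"
  obtains C where "C > 0" "\<And>x. x \<in> K \<Longrightarrow> norm (f x) \<le> C"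
proof -
  have "bounded (f ` K)"
    using compact_continuous_image[OF assms(2,1)] by (rule compact_imp_bounded)
  then show ?thesis
    using that unfolding bounded_pos by blast
qed

section \<open>Length of curves and affine reparametrization\<close>

definition speed :: "(real^'n::finite \<Rightarrow> real^'n^'n) \<Rightarrow> (real \<Rightarrow> real^'n) \<Rightarrow> real \<Rightarrow> real"
  where "speed G c t = metric_norm G (c t) (vector_derivative c (at t))"

definition rectifiable :: "(real^'n::finite \<Rightarrow> real^'n^'n) \<Rightarrow> (real \<Rightarrow> real^'n) \<Rightarrow> bool"
  where "rectifiable G c \<longleftrightarrow> valid_path c \<and> speed G c integrable_on {0..1}"

lemma riem_dist_eq:
  "riem_dist G x y = Inf {integral {0..1} (speed G c) | c. rectifiable G c \<and> pathstart c = x \<and> pathfinish c = y}"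
  unfolding riem_dist_def rectifiable_def speed_def by (rule arg_cong[where f=Inf]) blast

lemma metric_norm_scale: "metric_norm G x (k *\<^sub>R v) = \<bar>k\<bar> * metric_norm G x v"
proof -
  have "metric_inner G x (k *\<^sub>R v) (k *\<^sub>R v) = k\<^sup>2 * metric_inner G x v v"
    by (simp add: metric_inner_def matrix_vector_mult_scaleR power2_eq_square)
  then show ?thesis by (simp add: metric_norm_def real_sqrt_mult)
qed

lemma speed_affine:
  assumes "c differentiable at (m * t + b)"
  shows "speed G (\<lambda>t. c (m * t + b)) t = \<bar>m\<bar> * speed G c (m * t + b)"
proof -
  have "((\<lambda>t. m * t + b) has_vector_derivative m) (at t)"
    by (auto intro!: derivative_eq_intros)
  moreover have "(c has_vector_derivative vector_derivative c (at (m * t + b))) (at (m * t + b))"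
    using assms vector_derivative_works by blast
  ultimately have "((\<lambda>t. c (m * t + b)) has_vector_derivative m *\<^sub>R vector_derivative c (at (m * t + b))) (at t)"
    using vector_diff_chain_at[of "\<lambda>t. m * t + b" m t c] by (simp add: o_def)
  then show ?thesis
    by (simp add: speed_def vector_derivative_at metric_norm_scale)
qed

lemma speed_cong:
  assumes "\<forall>\<^sub>F s in nhds t. c s = c' s"
  shows "speed G c t = speed G c' t"
proof -
  have "vector_derivative c (at t) = vector_derivative c' (at t)"
    using assms by (intro vector_derivative_cong_eq) (auto simp: eventually_at_filter elim: eventually_mono)
  then show ?thesis
    using eventually_nhds_x_imp_x[OF assms] by (simp add: speed_def)
qed

lemma valid_path_differentiableE:
  assumes "valid_path c"
  obtains S where "finite S" "\<And>t. t \<in> {0..1} - S \<Longrightarrow> c differentiable (at t)"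
proof -
  obtain S where "finite S" "c C1_differentiable_on ({0..1} - S)"
    using assms unfolding valid_path_def piecewise_C1_differentiable_on_def by blast
  then show ?thesis
    using that unfolding C1_differentiable_on_def by (metis differentiableI_vector)
qed

lemma image_affine_interval:
  fixes a b k m :: real
  shows "m > 0 \<Longrightarrow> (\<lambda>x. (x - k) / m) ` {a..b} = {(a - k) / m..(b - k) / m}"
    and "m < 0 \<Longrightarrow> (\<lambda>x. (x - k) / m) ` {a..b} = {(b - k) / m..(a - k) / m}"
proof -
  show "m > 0 \<Longrightarrow> (\<lambda>x. (x - k) / m) ` {a..b} = {(a - k) / m..(b - k) / m}"
  proof (intro equalityI subsetI)
    fix y assume "m > 0" "y \<in> {(a - k) / m..(b - k) / m}"
    then show "y \<in> (\<lambda>x. (x - k) / m) ` {a..b}"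
      by (intro image_eqI[of _ _ "m * y + k"]) (auto simp: field_simps)
  qed (auto simp: field_simps)
  show "m < 0 \<Longrightarrow> (\<lambda>x. (x - k) / m) ` {a..b} = {(b - k) / m..(a - k) / m}"
  proof (intro equalityI subsetI)
    fix y assume "m < 0" "y \<in> {(b - k) / m..(a - k) / m}"
    then show "y \<in> (\<lambda>x. (x - k) / m) ` {a..b}"
      by (intro image_eqI[of _ _ "m * y + k"]) (auto simp: field_simps)
  qed (auto simp: field_simps)
qed

text \<open>The factor \<open>\<bar>m\<bar>\<close> of the speed cancels the one from the change of
  variables. The domain is written as an image so that one statement covers subpaths and joins
  (\<open>m > 0\<close>) as well as reversal (\<open>m < 0\<close>).\<close>

lemma has_integral_speed_affine:
  assumes c: "valid_path c" and m: "m \<noteq> 0" and ab: "a \<le> b" "{a..b} \<subseteq> {0..1}"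
    and i: "(speed G c has_integral i) {a..b}"
  shows "(speed G (\<lambda>t. c (m * t + k)) has_integral i) ((\<lambda>x. (x - k) / m) ` {a..b})"
proof -
  obtain S where S: "finite S" "\<And>t. t \<in> {0..1} - S \<Longrightarrow> c differentiable (at t)"
    using valid_path_differentiableE[OF c] by metis
  have "((\<lambda>t. \<bar>m\<bar> * speed G c (m * t + k)) has_integral \<bar>m\<bar> * (i / \<bar>m\<bar>)) ((\<lambda>x. (x - k) / m) ` {a..b})"
    using has_integral_affinity[of "speed G c" i a b m k] i m
    by (intro has_integral_mult_right) (simp add: cbox_interval divide_inverse algebra_simps)
  then have I: "((\<lambda>t. \<bar>m\<bar> * speed G c (m * t + k)) has_integral i) ((\<lambda>x. (x - k) / m) ` {a..b})"
    using m by simp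
  show ?thesis
  proof (rule has_integral_spike_finite[OF _ _ I])
    show "finite ((\<lambda>x. (x - k) / m) ` S)" using S by simp
    fix t assume t: "t \<in> (\<lambda>x. (x - k) / m) ` {a..b} - (\<lambda>x. (x - k) / m) ` S"
    then have "m * t + k \<in> {a..b}" using m by auto
    moreover have "m * t + k \<notin> S" using t m by (auto simp: image_iff field_simps)
    ultimately show "speed G (\<lambda>t. c (m * t + k)) t = \<bar>m\<bar> * speed G c (m * t + k)"
      using ab S by (intro speed_affine) auto
  qed
qed

locale framed_space =
  fixes A :: "real^'n::finite \<Rightarrow> real^'n^'n"
  assumes smooth_frame: "smooth_frame A"
begin

abbreviation "g \<equiv> frame_metric A"
abbreviation "d \<equiv> riem_dist g"

text \<open>\<open>coframe x *v v\<close> is the coordinate vector of \<open>v\<close> with respect to the frame at \<open>x\<close>.\<close>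

definition coframe :: "real^'n \<Rightarrow> real^'n^'n"
  where "coframe x = matrix_inv (transpose (A x))"

lemma det_A: "det (A x) \<noteq> 0"
  using smooth_frame by (simp add: smooth_frame_def)

lemma det_tA: "det (transpose (A x)) \<noteq> 0"
  by (simp add: det_A)

lemma Ck_A: "Ck_on k UNIV (\<lambda>x. A x $ i $ j)"
  using smooth_frame by (simp add: smooth_frame_def smooth_on_def)

lemma Ck_coframe: "Ck_on k UNIV (\<lambda>x. coframe x $ i $ j)"
  unfolding coframe_def
proof (rule Ck_on_matrix_inv)
  show "Ck_on k UNIV (\<lambda>x. transpose (A x) $ i $ j)" for i j by (simp add: transpose_def Ck_A)
qed (rule det_tA)

lemma coframe_left: "coframe x *v (transpose (A x) *v w) = w"
  using matrix_inv_left_right(2)[OF det_tA[of x]]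
  by (simp add: matrix_vector_mul_assoc coframe_def del: transpose_matrix_vector)

lemma coframe_right: "transpose (A x) *v (coframe x *v v) = v"
  using matrix_inv_left_right(1)[OF det_tA[of x]]
  by (simp add: matrix_vector_mul_assoc coframe_def del: transpose_matrix_vector)

lemma metric_eq: "g x = transpose (coframe x) ** coframe x"
proof -
  have A: "transpose (A x) ** coframe x = mat 1" "coframe x ** transpose (A x) = mat 1"
    using matrix_inv_left_right[OF det_tA[of x]] by (auto simp: coframe_def)
  then have "A x ** transpose (coframe x) = mat 1"
    by (metis matrix_transpose_mul transpose_mat transpose_transpose)
  then have "(transpose (A x) ** A x) ** (transpose (coframe x) ** coframe x) = mat 1"
    by (metis A(1) matrix_mul_assoc matrix_mul_rid)
  then show ?thesis unfolding frame_metric_def by (rule matrix_inv_eqI)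
qed

lemma Ck_metric: "Ck_on k UNIV (\<lambda>x. g x $ i $ j)"
  unfolding metric_eq matrix_matrix_mult_def transpose_def
  by (auto intro!: Ck_on_sum Ck_on_mult Ck_coframe)

lemma metric_symmetric: "g x $ i $ j = g x $ j $ i"
  by (simp add: metric_eq matrix_matrix_mult_def transpose_def mult.commute)

lemma metric_inner_eq: "metric_inner g x v w = (coframe x *v v) \<bullet> (coframe x *v w)"
  by (simp add: metric_inner_def metric_eq dot_lmul_matrix[symmetric] matrix_vector_mul_assoc[symmetric])
     (metis dot_lmul_matrix transpose_matrix_vector inner_commute vector_transpose_matrix)

lemma metric_norm_eq: "metric_norm g x v = norm (coframe x *v v)"
  by (simp add: metric_norm_def metric_inner_eq norm_eq_sqrt_inner)

lemma metric_norm_nonneg [simp]: "0 \<le> metric_norm g x v"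
  by (simp add: metric_norm_eq)

lemma speed_nonneg [simp]: "0 \<le> speed g c t"
  by (simp add: speed_def)

lemma metric_inner_le: "metric_inner g x v w \<le> metric_norm g x v * metric_norm g x w"
  unfolding metric_inner_eq metric_norm_eq by (rule norm_cauchy_schwarz)

lemma continuous_coframe: "continuous_on S (\<lambda>x. coframe x $ i $ j)"
  using Ck_on_imp_continuous[OF Ck_coframe[of 0]] continuous_on_subset by blast

lemma continuous_A: "continuous_on S (\<lambda>x. A x $ i $ j)"
  using Ck_on_imp_continuous[OF Ck_A[of 0]] continuous_on_subset by blast

lemma continuous_on_metric_norm:
  assumes "continuous_on S c" "continuous_on S v"
  shows "continuous_on S (\<lambda>t. metric_norm g (c t) (v t))"
proof -
  have c: "continuous_on S (\<lambda>t. coframe (c t) $ i $ j)" for i j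
    using continuous_on_compose2[OF continuous_coframe assms(1)] by blast
  have "continuous_on S (\<lambda>t. \<Sum>j\<in>UNIV. coframe (c t) $ i $ j * v t $ j)" for i
    by (intro continuous_on_sum continuous_on_mult c continuous_on_component[OF assms(2)])
  then have "continuous_on S (\<lambda>t. coframe (c t) *v v t)"
    unfolding matrix_vector_mult_def by (rule continuous_on_vec_lambda)
  then show ?thesis unfolding metric_norm_eq by (rule continuous_on_norm)
qed

lemma metric_norm_compact_le:
  assumes "compact K"
  obtains C where "C > 0" "\<And>x v. x \<in> K \<Longrightarrow> metric_norm g x v \<le> C * norm v"
proof -
  have "continuous_on K (\<lambda>x. \<Sum>i\<in>UNIV. \<Sum>j\<in>UNIV. \<bar>coframe x $ i $ j\<bar>)"
    by (intro continuous_on_sum continuous_on_rabs continuous_coframe)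
  from continuous_on_compact_bounded[OF assms this]
  obtain C where C: "C > 0" "\<And>x. x \<in> K \<Longrightarrow> norm (\<Sum>i\<in>UNIV. \<Sum>j\<in>UNIV. \<bar>coframe x $ i $ j\<bar>) \<le> C"
    by blast
  show ?thesis
  proof (rule that[OF C(1)])
    fix x v assume "x \<in> K"
    then have "(\<Sum>i\<in>UNIV. \<Sum>j\<in>UNIV. \<bar>coframe x $ i $ j\<bar>) \<le> C" using C(2)[of x] by simp
    then show "metric_norm g x v \<le> C * norm v"
      unfolding metric_norm_eq using norm_matrix_vector_mult_le[of "coframe x" v]
      by (meson mult_right_mono norm_ge_zero order_trans)
  qed
qed

lemma metric_norm_compact_ge:
  assumes "compact K"
  obtains C where "C > 0" "\<And>x v. x \<in> K \<Longrightarrow> norm v \<le> C * metric_norm g x v"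
proof -
  have "continuous_on K (\<lambda>x. \<Sum>i\<in>UNIV. \<Sum>j\<in>UNIV. \<bar>transpose (A x) $ i $ j\<bar>)"
    unfolding transpose_def by (simp, intro continuous_on_sum continuous_on_rabs continuous_A)
  from continuous_on_compact_bounded[OF assms this]
  obtain C where C: "C > 0" "\<And>x. x \<in> K \<Longrightarrow> norm (\<Sum>i\<in>UNIV. \<Sum>j\<in>UNIV. \<bar>transpose (A x) $ i $ j\<bar>) \<le> C"
    by blast
  show ?thesis
  proof (rule that[OF C(1)])
    fix x v assume "x \<in> K"
    then have le: "(\<Sum>i\<in>UNIV. \<Sum>j\<in>UNIV. \<bar>transpose (A x) $ i $ j\<bar>) \<le> C" using C(2)[of x] by simp
    have "norm v = norm (transpose (A x) *v (coframe x *v v))" by (simp only: coframe_right)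
    also have "\<dots> \<le> (\<Sum>i\<in>UNIV. \<Sum>j\<in>UNIV. \<bar>transpose (A x) $ i $ j\<bar>) * norm (coframe x *v v)"
      by (rule norm_matrix_vector_mult_le)
    also have "\<dots> \<le> C * norm (coframe x *v v)" by (rule mult_right_mono[OF le]) simp
    finally show "norm v \<le> C * metric_norm g x v" by (simp add: metric_norm_eq)
  qed
qed

lemma rectifiable_C1:
  assumes "\<And>t. t \<in> {0..1} \<Longrightarrow> (c has_vector_derivative c' t) (at t)" "continuous_on {0..1} c'"
  shows "rectifiable g c" "(speed g c has_integral integral {0..1} (\<lambda>t. metric_norm g (c t) (c' t))) {0..1}"
proof -
  have "c C1_differentiable_on {0..1}"
    unfolding C1_differentiable_on_def using assms by blast
  then have v: "valid_path c" by (simp add: valid_path_def C1_differentiable_imp_piecewise)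
  have cc: "continuous_on {0..1} c"
    using assms(1) has_vector_derivative_continuous continuous_at_imp_continuous_on by blast
  have "(\<lambda>t. metric_norm g (c t) (c' t)) integrable_on {0..1}"
    by (intro integrable_continuous_interval continuous_on_metric_norm cc assms(2))
  then have "((\<lambda>t. metric_norm g (c t) (c' t)) has_integral integral {0..1} (\<lambda>t. metric_norm g (c t) (c' t))) {0..1}"
    by (rule integrable_integral)
  moreover have "speed g c t = metric_norm g (c t) (c' t)" if "t \<in> {0..1}" for t
    using vector_derivative_at[OF assms(1)[OF that]] by (simp add: speed_def)
  ultimately show "(speed g c has_integral integral {0..1} (\<lambda>t. metric_norm g (c t) (c' t))) {0..1}"
    using has_integral_cong by (metis (mono_tags, lifting))
  then show "rectifiable g c" using v by (auto simp: rectifiable_def integrable_on_def)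
qed

lemma rectifiable_linepath: "rectifiable g (linepath x y)"
  by (rule rectifiable_C1[where c'="\<lambda>t. y - x"])
     (auto intro: has_vector_derivative_linepath_within)

section \<open>Metric axioms of the distance\<close>

lemma riem_dist_le:
  assumes "rectifiable g c"
  shows "d (pathstart c) (pathfinish c) \<le> integral {0..1} (speed g c)"
  unfolding riem_dist_eq
  by (rule cInf_lower) (use assms in \<open>auto intro!: bdd_belowI[where m=0] integral_nonneg simp: rectifiable_def\<close>)

lemma riem_dist_near:
  assumes "e > 0"
  obtains c where "rectifiable g c" "pathstart c = x" "pathfinish c = y"
    "integral {0..1} (speed g c) < d x y + e"
proof -
  let ?S = "{integral {0..1} (speed g c) | c. rectifiable g c \<and> pathstart c = x \<and> pathfinish c = y}"
  have "?S \<noteq> {}" using rectifiable_linepath[of x y] by (auto intro!: exI[of _ "linepath x y"])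
  then have "\<exists>s\<in>?S. s < Inf ?S + e" using assms by (intro cInf_lessD) auto
  then show ?thesis using that by (auto simp: riem_dist_eq)
qed

lemma riem_dist_nonneg [simp]: "0 \<le> d x y"
proof (rule field_le_epsilon)
  fix e :: real assume "0 < e"
  then obtain c where "rectifiable g c" "integral {0..1} (speed g c) < d x y + e"
    using riem_dist_near by metis
  then show "0 \<le> d x y + e"
    using integral_nonneg[of "speed g c" "{0..1}"] by (auto simp: rectifiable_def)
qed

lemma riem_dist_refl [simp]: "d x x = 0"
proof -
  have "(speed g (linepath x x) has_integral 0) {0..1}"
    using rectifiable_C1(2)[of "linepath x x" "\<lambda>t. x - x", OF has_vector_derivative_linepath_within]
    by (auto simp: metric_norm_eq)
  then have "d x x \<le> 0"
    using riem_dist_le[OF rectifiable_linepath[of x x]] by (simp add: integral_unique)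
  then show ?thesis by (simp add: antisym)
qed

lemma riem_dist_segment:
  assumes c: "rectifiable g c" and ab: "0 \<le> a" "a \<le> b" "b \<le> 1"
  shows "d (c a) (c b) \<le> integral {a..b} (speed g c)"
proof (cases "a = b")
  case False
  have v: "valid_path c" and "speed g c integrable_on {a..b}"
    using c ab by (auto simp: rectifiable_def intro: integrable_subinterval_real)
  then have i: "(speed g c has_integral integral {a..b} (speed g c)) {a..b}"
    by (simp add: integrable_integral)
  have "(\<lambda>x. (x - a) / (b - a)) ` {a..b} = {0..1}"
    using image_affine_interval(1)[of "b - a" a a b] False ab by simp
  then have i: "(speed g (subpath a b c) has_integral integral {a..b} (speed g c)) {0..1}"
    using has_integral_speed_affine[OF v _ _ _ i, of "b - a" a] False ab
    by (simp add: subpath_def)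
  then have "rectifiable g (subpath a b c)"
    using valid_path_subpath[OF v, of a b] ab by (auto simp: rectifiable_def integrable_on_def)
  from riem_dist_le[OF this] show ?thesis
    using i by (simp add: integral_unique)
qed simp

lemma riem_dist_le_sym: "d y x \<le> d x y"
proof (rule field_le_epsilon)
  fix e :: real assume "0 < e"
  then obtain c where c: "rectifiable g c" "pathstart c = x" "pathfinish c = y" "integral {0..1} (speed g c) < d x y + e"
    using riem_dist_near by metis
  then have v: "valid_path c" and i: "(speed g c has_integral integral {0..1} (speed g c)) {0..1}"
    by (auto simp: rectifiable_def integrable_integral)
  have im: "(\<lambda>x. 1 - x) ` {0..1::real} = {0..1}"
    using image_affine_interval(2)[of "-1" 1 0 1] by simp
  have "(speed g (reversepath c) has_integral integral {0..1} (speed g c)) {0..1}"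
    using has_integral_speed_affine[OF v _ _ _ i, of "-1" 1] im
    by (simp add: reversepath_def)
  moreover from this have "rectifiable g (reversepath c)"
    using v by (auto simp: rectifiable_def integrable_on_def)
  ultimately show "d y x \<le> d x y + e"
    using riem_dist_le[of "reversepath c"] c by (simp add: integral_unique)
qed

lemma riem_dist_sym: "d x y = d y x"
  by (rule antisym) (rule riem_dist_le_sym)+

lemma riem_dist_triangle: "d x z \<le> d x y + d y z"
proof (rule field_le_epsilon)
  fix e :: real assume e: "0 < e"
  obtain c where c: "rectifiable g c" "pathstart c = x" "pathfinish c = y" "integral {0..1} (speed g c) < d x y + e/2"
    using riem_dist_near[of "e/2" x y] e by auto
  obtain b where b: "rectifiable g b" "pathstart b = y" "pathfinish b = z" "integral {0..1} (speed g b) < d y z + e/2"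
    using riem_dist_near[of "e/2" y z] e by auto
  have v: "valid_path c" "valid_path b"
    and i: "(speed g c has_integral integral {0..1} (speed g c)) {0..1}" "(speed g b has_integral integral {0..1} (speed g b)) {0..1}"
    using b c by (auto simp: rectifiable_def integrable_integral)
  have im: "(\<lambda>x. x / 2) ` {0..1::real} = {0..1/2}" "(\<lambda>x. (x + 1) / 2) ` {0..1::real} = {1/2..1}"
    using image_affine_interval(1)[of 2 0 0 1] image_affine_interval(1)[of 2 "-1" 0 1] by auto
  have "(speed g (\<lambda>t. c (2 * t)) has_integral integral {0..1} (speed g c)) {0..1/2}"
    using has_integral_speed_affine[OF v(1) _ _ _ i(1), of 2 0] im by simp
  \<comment> \<open>The derivative of the joined path is uncontrolled at the junction 1/2, so this
    point is spiked out. Elsewhere \<open>c +++ b\<close> agrees with one of its pieces in a whole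
    neighbourhood, as is required to compare derivatives.\<close>
  then have 1: "(speed g (c +++ b) has_integral integral {0..1} (speed g c)) {0..1/2}"
  proof (rule has_integral_spike_finite[of "{1/2}", rotated 2])
    fix t :: real assume "t \<in> {0..1/2} - {1/2}"
    then have "\<forall>\<^sub>F s in nhds t. s < 1/2" by (intro eventually_nhds_in_open[of "{..<1/2}" t, simplified lessThan_iff]) auto
    then show "speed g (c +++ b) t = speed g (\<lambda>t. c (2 * t)) t"
      by (intro speed_cong) (auto simp: joinpaths_def elim: eventually_mono)
  qed simp
  have "(speed g (\<lambda>t. b (2 * t - 1)) has_integral integral {0..1} (speed g b)) {1/2..1}"
    using has_integral_speed_affine[OF v(2) _ _ _ i(2), of 2 "-1"] im by simp
  then have 2: "(speed g (c +++ b) has_integral integral {0..1} (speed g b)) {1/2..1}"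
  proof (rule has_integral_spike_finite[of "{1/2}", rotated 2])
    fix t :: real assume "t \<in> {1/2..1} - {1/2}"
    then have "\<forall>\<^sub>F s in nhds t. s > 1/2" by (intro eventually_nhds_in_open[of "{1/2<..}" t, simplified greaterThan_iff]) auto
    then show "speed g (c +++ b) t = speed g (\<lambda>t. b (2 * t - 1)) t"
      by (intro speed_cong) (auto simp: joinpaths_def elim: eventually_mono)
  qed simp
  have I: "(speed g (c +++ b) has_integral integral {0..1} (speed g c) + integral {0..1} (speed g b)) {0..1}"
    using has_integral_combine[OF _ _ 1 2] by simp
  then have "rectifiable g (c +++ b)"
    using v b c by (auto simp: rectifiable_def integrable_on_def intro: valid_path_join)
  from riem_dist_le[OF this] show "d x z \<le> d x y + d y z + e"
    using I b c by (simp add: integral_unique)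
qed

section \<open>Lower bounds for the distance by confinement of paths\<close>

lemma path_growth:
  fixes N :: "real^'n \<Rightarrow> real"
  assumes c: "rectifiable g c" and \<tau>: "0 \<le> \<tau>" "\<tau> \<le> 1" and U: "\<And>t. t \<in> {0..\<tau>} \<Longrightarrow> c t \<in> U"
    and der: "\<And>x. x \<in> U \<Longrightarrow> (N has_derivative D x) (at x)"
    and le: "\<And>x v. x \<in> U \<Longrightarrow> D x v \<le> k * metric_norm g x v"
  shows "N (c \<tau>) - N (c 0) \<le> k * integral {0..\<tau>} (speed g c)"
proof -
  have v: "valid_path c" and "speed g c integrable_on {0..1}"
    using c by (auto simp: rectifiable_def)
  then have i: "speed g c integrable_on {0..\<tau>}"
    using \<tau> by (auto intro: integrable_subinterval_real)
  obtain S where S: "finite S" "\<And>t. t \<in> {0..1} - S \<Longrightarrow> c differentiable (at t)"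
    using valid_path_differentiableE[OF v] by metis
  have "continuous_on {0..1} c"
    using v valid_path_imp_path path_def by blast
  then have cc: "continuous_on {0..\<tau>} c"
    using \<tau> by (auto intro: continuous_on_subset)
  have "continuous_on U N"
    using der by (meson continuous_at_imp_continuous_on has_derivative_continuous)
  then have cN: "continuous_on {0..\<tau>} (\<lambda>t. N (c t))"
    using continuous_on_compose2[OF _ cc] U by blast
  let ?f = "\<lambda>t. D (c t) (vector_derivative c (at t))"
  have "((\<lambda>t. N (c t)) has_vector_derivative ?f t) (at t)" if "t \<in> {0<..<\<tau>} - S" for t
  proof -
    have "(c has_vector_derivative vector_derivative c (at t)) (at t)"
      using S(2)[of t] that \<tau> vector_derivative_works by auto
    moreover have "(N has_derivative D (c t)) (at (c t))" using der U that by auto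
    ultimately show ?thesis
      using vector_derivative_diff_chain_within[of c _ t UNIV N "D (c t)"]
      by (auto simp: o_def intro: has_derivative_at_withinI)
  qed
  then have I: "(?f has_integral (N (c \<tau>) - N (c 0))) {0..\<tau>}"
    by (rule fundamental_theorem_of_calculus_interior_strong[OF S(1) \<tau>(1) _ cN])
  show ?thesis
  proof (rule has_integral_le[OF I])
    show "((\<lambda>t. k * speed g c t) has_integral k * integral {0..\<tau>} (speed g c)) {0..\<tau>}"
      using i by (intro has_integral_mult_right integrable_integral)
    show "?f t \<le> k * speed g c t" if "t \<in> {0..\<tau>}" for t
      using le U[OF that] by (simp add: speed_def)
  qed
qed

text \<open>A continuity argument. At the first time outside \<open>{x \<in> U. N x < s}\<close> the
  path is still in the closed set \<open>{x \<in> U. N x \<le> s}\<close>, hence in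
  \<open>U\<close>; there the growth bound holds and gives \<open>N < s\<close>, a contradiction.
  Closedness in the whole space is what forbids an escape through the boundary of
  \<open>U\<close>.\<close>

lemma path_confined:
  fixes N :: "real^'n \<Rightarrow> real"
  assumes c: "rectifiable g c" and U: "open U" "c 0 \<in> U"
    and der: "\<And>x. x \<in> U \<Longrightarrow> (N has_derivative D x) (at x)"
    and le: "\<And>x v. x \<in> U \<Longrightarrow> D x v \<le> k * metric_norm g x v" and k: "0 \<le> k"
    and cl: "closed {x \<in> U. N x \<le> s}" and s: "N (c 0) + k * integral {0..1} (speed g c) < s"
    and t: "t \<in> {0..1}"
  shows "c t \<in> U" "N (c t) \<le> N (c 0) + k * integral {0..1} (speed g c)"
proof -
  let ?l = "integral {0..1} (speed g c)"
  have i: "speed g c integrable_on {0..1}" and v: "valid_path c" using c by (auto simp: rectifiable_def)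
  have mono: "integral {0..\<tau>} (speed g c) \<le> ?l" if "\<tau> \<in> {0..1}" for \<tau>
    using that i by (intro integral_subset_le) (auto intro: integrable_subinterval_real)
  have growth: "N (c \<tau>) \<le> N (c 0) + k * ?l" if "\<tau> \<in> {0..1}" "\<And>t. t \<in> {0..\<tau>} \<Longrightarrow> c t \<in> U" for \<tau>
    using path_growth[OF c _ _ that(2) der le, of \<tau>] mult_left_mono[OF mono[OF that(1)] k] that(1) by auto
  have contN: "continuous_on U N"
    using der by (meson continuous_at_imp_continuous_on has_derivative_continuous)
  have cc: "continuous_on {0..1} c"
    using v valid_path_imp_path path_def by blast
  define O' where "O' = {x \<in> U. N x < s}"
  have "O' = U \<inter> N -` {..<s}" by (auto simp: O'_def)
  then have O': "open O'"
    using continuous_open_preimage[OF contN U(1), of "{..<s}"] by simp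
  have "c t \<in> O'" if t: "t \<in> {0..1}" for t
  proof (rule ccontr)
    assume nt: "c t \<notin> O'"
    define B where "B = {0..1} \<inter> c -` (- O')"
    have "closed B"
      unfolding B_def using O' by (intro continuous_closed_preimage[OF cc]) auto
    moreover have "bounded B"
      by (rule bounded_subset[of "{0..1}"]) (auto simp: B_def)
    ultimately have "compact B" by (simp add: compact_eq_bounded_closed)
    moreover have "B \<noteq> {}" using t nt by (auto simp: B_def)
    \<comment> \<open>\<open>\<tau>\<close> is the first exit time; it exists because the exit times
      form a compact set.\<close>
    ultimately obtain \<tau> where \<tau>: "\<tau> \<in> B" "\<And>s. s \<in> B \<Longrightarrow> \<tau> \<le> s"
      using compact_attains_inf[of B] by metis
    have k0: "0 \<le> k * ?l" using k integral_nonneg[OF i] by simp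
    then have c0: "c 0 \<in> O'" using U s by (auto simp: O'_def)
    then have \<tau>0: "0 < \<tau>" "\<tau> \<le> 1" using \<tau> by (auto simp: B_def less_le)
    have inO: "c r \<in> O'" if "r \<in> {0..<\<tau>}" for r
      using \<tau>(2)[of r] that \<tau>0 by (auto simp: B_def)
    have "\<tau> \<in> closure {0..<\<tau>}" using \<tau>0 by simp
    moreover have "continuous_on (closure {0..<\<tau>}) c"
      using \<tau>0 by (auto intro: continuous_on_subset[OF cc])
    moreover have "c ` {0..<\<tau>} \<subseteq> {x \<in> U. N x \<le> s}" using inO by (fastforce simp: O'_def)
    ultimately have c\<tau>: "c \<tau> \<in> U"
      using image_closure_subset[OF _ cl, of "{0..<\<tau>}" c] by auto
    have "c r \<in> U" if "r \<in> {0..\<tau>}" for r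
      using inO[of r] c\<tau> that by (cases "r = \<tau>") (auto simp: O'_def)
    then have "N (c \<tau>) \<le> N (c 0) + k * ?l" using growth[of \<tau>] \<tau>0 by simp
    then show False using \<tau>(1) c\<tau> s by (auto simp: B_def O'_def)
  qed
  then have "\<And>t. t \<in> {0..1} \<Longrightarrow> c t \<in> U" by (auto simp: O'_def)
  then show "c t \<in> U" "N (c t) \<le> N (c 0) + k * ?l" using t growth[OF t] by auto
qed

text \<open>
  The norm is not differentiable at zeros of \<open>\<Phi>\<close>, so the previous lemma is applied to
  \<open>sqrt (e\<^sup>2 + (norm (\<Phi> x))\<^sup>2)\<close> with \<open>e\<close> tending to \<open>0\<close>.
\<close>

lemma path_confined_norm:
  fixes \<Phi> :: "real^'n \<Rightarrow> real^'n"
  assumes c: "rectifiable g c" and U: "open U" "c 0 \<in> U"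
    and der: "\<And>x. x \<in> U \<Longrightarrow> (\<Phi> has_derivative D x) (at x)"
    and le: "\<And>x v. x \<in> U \<Longrightarrow> \<Phi> x \<bullet> D x v \<le> k * norm (\<Phi> x) * metric_norm g x v" and k: "0 \<le> k"
    and cl: "closed {x \<in> U. norm (\<Phi> x) \<le> s}" and s: "k * integral {0..1} (speed g c) < s"
    and z: "\<Phi> (c 0) = 0" and t: "t \<in> {0..1}"
  shows "c t \<in> U" "norm (\<Phi> (c t)) \<le> k * integral {0..1} (speed g c)"
proof -
  let ?l = "integral {0..1} (speed g c)"
  have i: "speed g c integrable_on {0..1}" using c by (auto simp: rectifiable_def)
  have k0: "0 \<le> k * ?l" using k integral_nonneg[OF i] by simp
  have *: "c t \<in> U \<and> norm (\<Phi> (c t)) \<le> e + k * ?l" if e: "0 < e" "e + k * ?l < s" for e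
  proof -
    let ?N = "\<lambda>x. sqrt (e\<^sup>2 + (norm (\<Phi> x))\<^sup>2)"
    let ?D = "\<lambda>x v. (\<Phi> x \<bullet> D x v) / ?N x"
    have pos: "0 < e\<^sup>2 + (norm (\<Phi> x))\<^sup>2" for x using e by (simp add: add_pos_nonneg)
    have d: "(?N has_derivative ?D x) (at x)" if "x \<in> U" for x
    proof -
      have "((\<lambda>x. sqrt (e\<^sup>2 + \<Phi> x \<bullet> \<Phi> x)) has_derivative ?D x) (at x)"
        using pos[of x] der[OF that]
        by (auto intro!: derivative_eq_intros simp: power2_norm_eq_inner inner_commute divide_simps)
      then show ?thesis by (simp add: power2_norm_eq_inner)
    qed
    have l: "?D x v \<le> k * metric_norm g x v" if "x \<in> U" for x v
    proof -
      have "norm (\<Phi> x) \<le> ?N x" by (rule real_le_rsqrt) simp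
      then have "k * norm (\<Phi> x) * metric_norm g x v \<le> k * ?N x * metric_norm g x v"
        using k by (intro mult_right_mono mult_left_mono) auto
      then have "\<Phi> x \<bullet> D x v \<le> k * metric_norm g x v * ?N x"
        using le[OF that, of v] by (simp add: algebra_simps)
      then show ?thesis using pos[of x] by (simp add: divide_le_eq)
    qed
    have s0: "0 < s" using s k0 by linarith
    have "{x \<in> U. ?N x \<le> sqrt (e\<^sup>2 + s\<^sup>2)} = {x \<in> U. norm (\<Phi> x) \<le> s}"
      using s0 by (auto simp: abs_le_square_iff[symmetric])
    then have cl': "closed {x \<in> U. ?N x \<le> sqrt (e\<^sup>2 + s\<^sup>2)}" using cl by simp
    have "s \<le> sqrt (e\<^sup>2 + s\<^sup>2)" by (rule real_le_rsqrt) simp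
    then have "?N (c 0) + k * ?l < sqrt (e\<^sup>2 + s\<^sup>2)"
      using e z by (simp, linarith)
    note conf = path_confined[OF c U, of ?N ?D, OF d l k cl' this t]
    have "norm (\<Phi> (c t)) \<le> ?N (c t)" by (rule real_le_rsqrt) simp
    moreover have "?N (c 0) = e" using z e by simp
    ultimately show ?thesis using conf by linarith
  qed
  have "0 < (s - k * ?l) / 2" "(s - k * ?l) / 2 + k * ?l < s" using s by (auto simp: field_simps)
  from *[OF this] show "c t \<in> U" by blast
  show "norm (\<Phi> (c t)) \<le> k * ?l"
  proof (rule field_le_epsilon)
    fix e :: real assume "0 < e"
    define e' where "e' = min e ((s - k * ?l) / 2)"
    have "0 < e'" "e' + k * ?l < s" using s \<open>0 < e\<close> by (auto simp: e'_def min_def field_simps)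
    from *[OF this] show "norm (\<Phi> (c t)) \<le> k * ?l + e" by (auto simp: e'_def)
  qed
qed

text \<open>Confinement applied to almost shortest paths. Only the radial component
  \<open>\<Phi> x \<bullet> D x v\<close> of the derivative has to be bounded, which is exactly what
  the Gauss lemma provides. The lemma is used for Euclidean coordinates, for second-order normal
  coordinates and for the inverse of the exponential map.\<close>

lemma riem_dist_ge_norm:
  fixes \<Phi> :: "real^'n \<Rightarrow> real^'n"
  assumes U: "open U" "x \<in> U"
    and der: "\<And>x. x \<in> U \<Longrightarrow> (\<Phi> has_derivative D x) (at x)"
    and le: "\<And>x v. x \<in> U \<Longrightarrow> \<Phi> x \<bullet> D x v \<le> k * norm (\<Phi> x) * metric_norm g x v" and k: "0 \<le> k"
    and cl: "closed {x \<in> U. norm (\<Phi> x) \<le> s}" and s: "k * d x y < s"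
    and z: "\<Phi> x = 0"
  shows "y \<in> U" "norm (\<Phi> y) \<le> k * d x y"
proof -
  have *: "y \<in> U \<and> norm (\<Phi> y) \<le> k * (d x y + e)" if e: "0 < e" "k * (d x y + e) < s" for e
  proof -
    obtain c where c: "rectifiable g c" "pathstart c = x" "pathfinish c = y" "integral {0..1} (speed g c) < d x y + e"
      using riem_dist_near[OF e(1)] by metis
    then have "k * integral {0..1} (speed g c) \<le> k * (d x y + e)"
      using k by (intro mult_left_mono) auto
    then show ?thesis
      using path_confined_norm[OF c(1) U(1) _ der le k cl, of 1] c e U z
      by (auto simp: pathstart_def pathfinish_def)
  qed
  have small: "\<exists>\<delta>>0. \<delta> \<le> e \<and> k * (d x y + \<delta>) < s" if "0 < e" for e
  proof -
    define \<delta> where "\<delta> = min e ((s - k * d x y) / (2 * (k + 1)))"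
    have "k * \<delta> \<le> (k + 1) * ((s - k * d x y) / (2 * (k + 1)))"
      using k s that by (intro mult_mono) (auto simp: \<delta>_def)
    also have "\<dots> = (s - k * d x y) / 2" using k by (auto simp: divide_simps)
    also have "\<dots> < s - k * d x y" using s by simp
    finally have "k * (d x y + \<delta>) < s" by (simp add: algebra_simps)
    moreover have "0 < \<delta>" using that s k by (auto simp: \<delta>_def)
    ultimately show ?thesis by (auto simp: \<delta>_def intro!: exI[of _ \<delta>])
  qed
  from small[of 1] * show "y \<in> U" by auto
  show "norm (\<Phi> y) \<le> k * d x y"
  proof (rule field_le_epsilon)
    fix e :: real assume e: "0 < e"
    then obtain \<delta> where \<delta>: "0 < \<delta>" "\<delta> \<le> e / (k + 1)" "k * (d x y + \<delta>) < s"
      using small[of "e / (k + 1)"] k by auto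
    have "k * \<delta> \<le> (k + 1) * (e / (k + 1))" using k \<delta> e by (intro mult_mono) auto
    then have "k * \<delta> \<le> e" using k by simp
    then show "norm (\<Phi> y) \<le> k * d x y + e"
      using *[OF \<delta>(1,3)] by (simp add: algebra_simps)
  qed
qed

text \<open>\<open>C\<close> compares the norms on the Euclidean ball of radius \<open>r\<close>;
  the premise \<open>C * d x y < r\<close> keeps almost shortest paths inside that ball.\<close>

lemma norm_diff_le_riem_dist:
  obtains C where "C > 0" "\<And>y. C * d x y < r \<Longrightarrow> norm (y - x) \<le> C * d x y"
proof (cases "r > 0")
  case True
  obtain C where C: "C > 0" "\<And>y v. y \<in> cball x r \<Longrightarrow> norm v \<le> C * metric_norm g y v"
    using metric_norm_compact_ge[OF compact_cball] by metis
  show ?thesis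
  proof (rule that[OF C(1)])
    fix y assume y: "C * d x y < r"
    define s where "s = (C * d x y + r) / 2"
    have s: "s < r" "C * d x y < s" using y by (auto simp: s_def)
    have "{z \<in> ball x r. norm (z - x) \<le> s} = cball x s"
      using s by (auto simp: dist_norm norm_minus_commute)
    then have cl: "closed {z \<in> ball x r. norm (z - x) \<le> s}" by simp
    show "norm (y - x) \<le> C * d x y"
    proof (rule riem_dist_ge_norm(2)[of "ball x r" x "\<lambda>z. z - x" "\<lambda>_ v. v" C s, OF _ _ _ _ _ cl s(2)])
      show "((\<lambda>z. z - x) has_derivative (\<lambda>v. v)) (at z)" for z
        by (auto intro!: derivative_eq_intros)
      show "(z - x) \<bullet> v \<le> C * norm (z - x) * metric_norm g z v" if "z \<in> ball x r" for z v
      proof -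
        have "(z - x) \<bullet> v \<le> norm (z - x) * norm v" by (rule norm_cauchy_schwarz)
        also have "\<dots> \<le> norm (z - x) * (C * metric_norm g z v)"
          using C(2)[of z v] that by (intro mult_left_mono) auto
        finally show ?thesis by (simp add: algebra_simps)
      qed
    qed (use True C in auto)
  qed
next
  case False
  have "norm (y - x) \<le> 1 * d x y" if "1 * d x y < r" for y
    using that False riem_dist_nonneg[of x y] by linarith
  with that show ?thesis using zero_less_one by blast
qed

section \<open>Upper bounds and continuity of the distance\<close>

lemma riem_dist_le_length:
  assumes "\<And>t. t \<in> {0..1} \<Longrightarrow> (c has_vector_derivative c' t) (at t)" "continuous_on {0..1} c'"
    and "\<And>t. t \<in> {0..1} \<Longrightarrow> metric_norm g (c t) (c' t) \<le> B"
  shows "d (c 0) (c 1) \<le> B"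
proof -
  have i: "(speed g c has_integral integral {0..1} (\<lambda>t. metric_norm g (c t) (c' t))) {0..1}"
    using rectifiable_C1(2)[OF assms(1,2)] .
  have "(speed g c has_integral integral {0..1} (speed g c)) {0..1}"
    using i by (simp add: integral_unique)
  moreover have "((\<lambda>t. B) has_integral B) {0..1::real}"
    using has_integral_const_real[of B 0 1] by simp
  moreover have "speed g c t \<le> B" if "t \<in> {0..1}" for t
    using assms(3)[OF that] vector_derivative_at[OF assms(1)[OF that]] by (simp add: speed_def)
  ultimately have "integral {0..1} (speed g c) \<le> B"
    by (rule has_integral_le)
  with riem_dist_le[OF rectifiable_C1(1)[OF assms(1,2)]] show ?thesis
    by (simp add: pathstart_def pathfinish_def)
qed

lemma riem_dist_le_norm_diff:
  obtains C where "C > 0" "\<And>y z. y \<in> cball x r \<Longrightarrow> z \<in> cball x r \<Longrightarrow> d y z \<le> C * norm (z - y)"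
proof -
  obtain C where C: "C > 0" "\<And>y v. y \<in> cball x r \<Longrightarrow> metric_norm g y v \<le> C * norm v"
    using metric_norm_compact_le[OF compact_cball] by metis
  show ?thesis
  proof (rule that[OF C(1)])
    fix y z assume yz: "y \<in> cball x r" "z \<in> cball x r"
    have "d (linepath y z 0) (linepath y z 1) \<le> C * norm (z - y)"
    proof (rule riem_dist_le_length[where c'="\<lambda>t. z - y"])
      fix t :: real assume "t \<in> {0..1}"
      then have "linepath y z t \<in> closed_segment y z"
        using linepath_image_01 by blast
      then have "linepath y z t \<in> cball x r"
        using yz closed_segment_subset[OF _ _ convex_cball] by blast
      then show "metric_norm g (linepath y z t) (z - y) \<le> C * norm (z - y)" by (rule C(2))
    qed (auto intro: has_vector_derivative_linepath_within)
    then show "d y z \<le> C * norm (z - y)" by (simp add: linepath_def)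
  qed
qed

lemma continuous_on_riem_dist: "continuous_on S (d y)"
proof (rule continuous_at_imp_continuous_on, rule ballI)
  fix x
  obtain C where C: "C > 0" "\<And>y z. y \<in> cball x 1 \<Longrightarrow> z \<in> cball x 1 \<Longrightarrow> d y z \<le> C * norm (z - y)"
    using riem_dist_le_norm_diff by metis
  have le: "\<forall>\<^sub>F z in at x. norm (d y z - d y x) \<le> C * norm (z - x)"
  proof -
    have "\<forall>\<^sub>F z in at x. z \<in> ball x 1" by (intro eventually_at_in_open') auto
    then show ?thesis
    proof (rule eventually_mono)
      fix z assume "z \<in> ball x 1"
      then have "d x z \<le> C * norm (z - x)" using C(2)[of x z] by simp
      then show "norm (d y z - d y x) \<le> C * norm (z - x)"
        using riem_dist_triangle[of y z x] riem_dist_triangle[of y x z] riem_dist_sym[of x z]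
        unfolding real_norm_def by linarith
    qed
  qed
  have "((\<lambda>z. C * norm (z - x)) \<longlongrightarrow> C * norm (x - x)) (at x)"
    by (intro tendsto_intros)
  then have "((\<lambda>z. d y z - d y x) \<longlongrightarrow> 0) (at x)"
    using Lim_null_comparison[OF le] by simp
  then show "isCont (d y) x" by (simp add: isCont_def LIM_zero_iff)
qed

lemma riem_dist_pos:
  assumes "x \<noteq> y" shows "0 < d x y"
proof -
  obtain C where C: "C > 0" "C * d x y < 1 \<Longrightarrow> norm (y - x) \<le> C * d x y"
    using norm_diff_le_riem_dist[of x 1] by metis
  have "d x y \<noteq> 0" using C(2) assms by auto
  then show ?thesis using riem_dist_nonneg[of x y] by linarith
qed

text \<open>A shortest path need not exist, so an almost shortest one is cut where its length from
  \<open>y\<close> equals \<open>d y x - r\<close>. The whole defect \<open>e\<close> then falls on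
  the second piece.\<close>

lemma riem_dist_intermediate:
  assumes r: "0 \<le> r" "r \<le> d y x" and e: "0 < e"
  obtains z where "d y z \<le> d y x - r" "d z x \<le> r + e"
proof -
  obtain c where c: "rectifiable g c" "pathstart c = y" "pathfinish c = x" "integral {0..1} (speed g c) < d y x + e"
    using riem_dist_near[OF e] by metis
  then have i: "speed g c integrable_on {0..1}" by (simp add: rectifiable_def)
  let ?I = "\<lambda>t. integral {0..t} (speed g c)"
  have "continuous_on {0..1} ?I" by (rule indefinite_integral_continuous_1[OF i])
  moreover have "?I 0 \<le> d y x - r" using r by simp
  moreover have "d y x - r \<le> ?I 1" using riem_dist_le[OF c(1)] c r by simp
  ultimately obtain \<tau> where \<tau>: "0 \<le> \<tau>" "\<tau> \<le> 1" "?I \<tau> = d y x - r"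
    using IVT'[of ?I 0 "d y x - r" 1] by auto
  have "?I \<tau> + integral {\<tau>..1} (speed g c) = ?I 1"
    using Henstock_Kurzweil_Integration.integral_combine[OF \<tau>(1,2) i] .
  then show ?thesis
    using riem_dist_segment[OF c(1), of 0 \<tau>] riem_dist_segment[OF c(1), of \<tau> 1] \<tau> c that[of "c \<tau>"]
    by (simp add: pathstart_def pathfinish_def)
qed

subsection \<open>Second-order normal coordinates\<close>

abbreviation "X \<equiv> frame_deriv A"

lemma X_const [simp]: "X i (\<lambda>x. c) x = 0"
  by (simp add: frame_deriv_def)

lemma X_add:
  assumes "\<phi> differentiable (at x)" "\<psi> differentiable (at x)"
  shows "X i (\<lambda>x. \<phi> x + \<psi> x) x = X i \<phi> x + X i \<psi> x"
  by (simp add: frame_deriv_def partial_add[OF assms] algebra_simps sum.distrib)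

lemma X_mult:
  assumes "\<phi> differentiable (at x)" "\<psi> differentiable (at x)"
  shows "X i (\<lambda>x. \<phi> x * \<psi> x) x = \<phi> x * X i \<psi> x + \<psi> x * X i \<phi> x"
  by (simp add: frame_deriv_def partial_mult[OF assms] algebra_simps sum.distrib sum_distrib_left)

lemma X_cmult:
  assumes "\<phi> differentiable (at x)"
  shows "X i (\<lambda>x. c * \<phi> x) x = c * X i \<phi> x"
  using X_mult[OF differentiable_const assms, of i c] by simp

lemma X_sum:
  assumes "finite I" "\<And>k. k \<in> I \<Longrightarrow> \<phi> k differentiable (at x)"
  shows "X i (\<lambda>x. \<Sum>k\<in>I. \<phi> k x) x = (\<Sum>k\<in>I. X i (\<phi> k) x)"
  using assms by (induction I rule: finite_induct) (auto simp: X_add)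

lemma X_compose:
  assumes "\<phi> differentiable (at x)" "(h has_real_derivative h') (at (\<phi> x))"
  shows "X i (\<lambda>x. h (\<phi> x)) x = h' * X i \<phi> x"
  by (simp add: frame_deriv_def partial_compose[OF assms] algebra_simps sum_distrib_left)

lemma Ck_X: "Ck_on (Suc k) UNIV \<phi> \<Longrightarrow> Ck_on k UNIV (X i \<phi>)"
  unfolding frame_deriv_def by (intro Ck_on_sum Ck_on_mult Ck_A Ck_on_partial)

lemma has_derivative_frame:
  assumes "\<phi> differentiable (at x)"
  shows "(\<phi> has_derivative (\<lambda>v. \<Sum>i\<in>UNIV. (coframe x *v v) $ i * X i \<phi> x)) (at x)"
proof -
  have "(\<Sum>j\<in>UNIV. v $ j * partial j \<phi> x) = (\<Sum>i\<in>UNIV. (coframe x *v v) $ i * X i \<phi> x)" for v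
  proof -
    have "v $ j = (\<Sum>i\<in>UNIV. A x $ i $ j * (coframe x *v v) $ i)" for j
      using coframe_right[of x v] by (simp add: vec_eq_iff matrix_vector_mult_def transpose_def del: transpose_matrix_vector)
    then have "(\<Sum>j\<in>UNIV. v $ j * partial j \<phi> x)
        = (\<Sum>j\<in>UNIV. \<Sum>i\<in>UNIV. A x $ i $ j * (coframe x *v v) $ i * partial j \<phi> x)"
      by (simp add: sum_distrib_right)
    also have "\<dots> = (\<Sum>i\<in>UNIV. \<Sum>j\<in>UNIV. A x $ i $ j * (coframe x *v v) $ i * partial j \<phi> x)"
      by (rule sum.swap)
    finally show ?thesis by (simp add: frame_deriv_def sum_distrib_left mult_ac)
  qed
  then show ?thesis using has_derivative_partial[OF assms] by simp
qed

text \<open>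
  \<open>gram \<Psi> x $ k $ l\<close> is the \<open>g\<close>-inner product of the gradients of the components
  \<open>k\<close> and \<open>l\<close> of \<open>\<Psi>\<close>.
\<close>

definition gram :: "(real^'n \<Rightarrow> real^'n) \<Rightarrow> real^'n \<Rightarrow> real^'n^'n"
  where "gram \<Psi> x = (\<chi> k l. \<Sum>i\<in>UNIV. X i (\<lambda>x. \<Psi> x $ k) x * X i (\<lambda>x. \<Psi> x $ l) x)"

text \<open>
  Second-order normal coordinates. In the linear coordinates \<open>\<eta>\<close> adapted to the frame at \<open>p\<close>, the
  condition that the first derivatives of the Gram matrix vanish reads
  \<open>q l n k + q k n l = - s n k l\<close>, where \<open>q\<close> are the quadratic coefficients of \<open>\<Psi>\<close> and \<open>s\<close> the
  first derivatives of the Gram matrix of \<open>\<eta>\<close>; it is solved by the Koszul formula.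
\<close>

lemma normal_coordinates:
  obtains \<Psi> :: "real^'n \<Rightarrow> real^'n" where
    "\<And>m k. Ck_on m UNIV (\<lambda>x. \<Psi> x $ k)" "\<Psi> p = 0"
    "\<And>i k. X i (\<lambda>x. \<Psi> x $ k) p = (if i = k then 1 else 0)"
    "\<And>n k l. X n (\<lambda>x. gram \<Psi> x $ k $ l) p = 0"
proof -
  define \<eta> where "\<eta> l x = (coframe p *v (x - p)) $ l" for l x
  have \<eta>: "\<eta> l = (\<lambda>x. \<Sum>j\<in>UNIV. coframe p $ l $ j * (x $ j - p $ j))" for l
    by (simp add: \<eta>_def matrix_vector_mult_def fun_eq_iff)
  have C\<eta>: "Ck_on m UNIV (\<eta> l)" for m l
    unfolding \<eta> by (intro Ck_on_sum Ck_on_mult Ck_on_diff Ck_on_const Ck_on_component)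
  define Z where "Z i l = X i (\<eta> l)" for i l
  have CZ: "Ck_on m UNIV (Z i l)" for m i l
    unfolding Z_def by (intro Ck_X C\<eta>)
  have d\<eta>: "\<eta> l differentiable (at x)" for l x
    using Ck_on_imp_differentiable[OF C\<eta>[of 1]] by simp
  have dZ: "Z i l differentiable (at x)" for i l x
    using Ck_on_imp_differentiable[OF CZ[of 1]] by simp
  have \<eta>p: "\<eta> l p = 0" for l by (simp add: \<eta>_def)
  have Zp: "Z i l p = (if i = l then 1 else 0)" for i l
  proof -
    have lin: "bounded_linear (\<lambda>v. (coframe p *v v) $ l)"
      by (intro bounded_linear_compose[OF bounded_linear_vec_nth] matrix_vector_mul_bounded_linear)
    have "((\<lambda>x. x - p) has_derivative (\<lambda>v. v)) (at p)"
      by (auto intro!: derivative_eq_intros)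
    then have "(\<eta> l has_derivative (\<lambda>v. (coframe p *v v) $ l)) (at p)"
      unfolding \<eta>_def[abs_def] using bounded_linear.has_derivative[OF lin] by blast
    then have "partial j (\<eta> l) p = coframe p $ l $ j" for j
      by (simp add: partial_eq matrix_vector_mult_basis column_def)
    then have "Z i l p = (\<Sum>j\<in>UNIV. A p $ i $ j * coframe p $ l $ j)"
      by (simp add: Z_def frame_deriv_def)
    also have "\<dots> = (coframe p *v (transpose (A p) *v axis i 1)) $ l"
      unfolding matrix_vector_mult_basis by (simp add: matrix_vector_mult_def column_def transpose_def mult.commute)
    also have "\<dots> = axis i 1 $ l" by (simp only: coframe_left)
    finally show ?thesis by (simp add: axis_def)
  qed
  define s where "s n k l = X n (\<lambda>x. \<Sum>i\<in>UNIV. Z i k x * Z i l x) p" for n k l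
  have s_sym: "s n k l = s n l k" for n k l by (simp add: s_def mult.commute)
  define q where "q k a b = - (1/2) * (s b k a + s a k b - s k a b)" for k a b
  have q_sym: "q k a b = q k b a" for k a b using s_sym by (simp add: q_def)
  have q_eq: "s n k l + q l n k + q k n l = 0" for n k l
    using s_sym[of n k l] s_sym[of k l n] s_sym[of l k n] by (simp add: q_def field_simps)
  define \<Psi> :: "real^'n \<Rightarrow> real^'n"
    where "\<Psi> x = (\<chi> k. \<eta> k x + (1/2) * (\<Sum>a\<in>UNIV. \<Sum>b\<in>UNIV. q k a b * (\<eta> a x * \<eta> b x)))" for x
  have C\<Psi>: "Ck_on m UNIV (\<lambda>x. \<Psi> x $ k)" for m k
    unfolding \<Psi>_def vec_lambda_beta by (intro Ck_on_add Ck_on_sum Ck_on_mult Ck_on_const C\<eta>)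
  define R where "R i k x = (\<Sum>a\<in>UNIV. \<Sum>b\<in>UNIV. q k a b * (\<eta> a x * Z i b x))" for i k x
  have CR: "Ck_on m UNIV (R i k)" for m i k
    unfolding R_def[abs_def] by (intro Ck_on_sum Ck_on_mult Ck_on_const C\<eta> CZ)
  have dR: "R i k differentiable (at x)" for i k x
    using Ck_on_imp_differentiable[OF CR[of 1]] by simp
  have X\<Psi>: "X i (\<lambda>x. \<Psi> x $ k) = (\<lambda>x. Z i k x + R i k x)" for i k
  proof
    fix x
    have d: "(\<lambda>x. q k a b * (\<eta> a x * \<eta> b x)) differentiable (at x)" for a b
      by (intro differentiable_mult differentiable_const d\<eta>)
    let ?S = "\<lambda>x. \<Sum>a\<in>UNIV. \<Sum>b\<in>UNIV. q k a b * (\<eta> a x * \<eta> b x)"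
    have dS: "?S differentiable (at x)" by (intro differentiable_sum d finite_UNIV ballI) auto
    have "X i ?S x = (\<Sum>a\<in>UNIV. X i (\<lambda>x. \<Sum>b\<in>UNIV. q k a b * (\<eta> a x * \<eta> b x)) x)"
      by (rule X_sum) (auto intro!: differentiable_sum d)
    also have "\<dots> = (\<Sum>a\<in>UNIV. \<Sum>b\<in>UNIV. X i (\<lambda>x. q k a b * (\<eta> a x * \<eta> b x)) x)"
      by (intro sum.cong refl X_sum d) auto
    also have "\<dots> = (\<Sum>a\<in>UNIV. \<Sum>b\<in>UNIV. q k a b * (\<eta> a x * Z i b x + \<eta> b x * Z i a x))"
      by (intro sum.cong refl) (simp add: X_cmult X_mult differentiable_mult d\<eta> Z_def)
    finally have S: "X i ?S x = (\<Sum>a\<in>UNIV. \<Sum>b\<in>UNIV. q k a b * (\<eta> a x * Z i b x + \<eta> b x * Z i a x))" .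
    have "X i (\<lambda>x. \<Psi> x $ k) x = Z i k x + (1/2) * X i ?S x"
      unfolding \<Psi>_def vec_lambda_beta Z_def
      using X_add[OF d\<eta>[of k x] differentiable_mult[OF differentiable_const[of "1/2"] dS], of i] X_cmult[OF dS, of i "1/2"] by simp
    also note S
    also have "(\<Sum>a\<in>UNIV. \<Sum>b\<in>UNIV. q k a b * (\<eta> a x * Z i b x + \<eta> b x * Z i a x))
        = R i k x + (\<Sum>a\<in>UNIV. \<Sum>b\<in>UNIV. q k a b * (\<eta> b x * Z i a x))"
      by (simp add: R_def distrib_left sum.distrib)
    also have "(\<Sum>a\<in>UNIV. \<Sum>b\<in>UNIV. q k a b * (\<eta> b x * Z i a x)) = R i k x"
      unfolding R_def by (subst sum.swap) (simp add: q_sym)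
    finally show "X i (\<lambda>x. \<Psi> x $ k) x = Z i k x + R i k x" by simp
  qed
  have Rp: "R i k p = 0" for i k by (simp add: R_def \<eta>p)
  have X\<eta>: "X n (\<eta> a) p = Z n a p" for n a by (simp add: Z_def)
  have XRp: "X n (R i k) p = q k n i" for n i k
  proof -
    have d: "(\<lambda>x. q k a b * (\<eta> a x * Z i b x)) differentiable (at p)" for a b
      by (intro differentiable_mult differentiable_const d\<eta> dZ)
    have "X n (R i k) p = (\<Sum>a\<in>UNIV. X n (\<lambda>x. \<Sum>b\<in>UNIV. q k a b * (\<eta> a x * Z i b x)) p)"
      unfolding R_def[abs_def] by (rule X_sum) (auto intro!: differentiable_sum d)
    also have "\<dots> = (\<Sum>a\<in>UNIV. \<Sum>b\<in>UNIV. X n (\<lambda>x. q k a b * (\<eta> a x * Z i b x)) p)"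
      by (intro sum.cong refl X_sum d) auto
    also have "\<dots> = (\<Sum>a\<in>UNIV. \<Sum>b\<in>UNIV. q k a b * (Z n a p * Z i b p))"
      by (intro sum.cong refl) (simp add: X_cmult X_mult differentiable_mult d\<eta> dZ \<eta>p X\<eta>)
    also have "\<dots> = (\<Sum>a\<in>UNIV. \<Sum>b\<in>UNIV. if b = i then if a = n then q k a b else 0 else 0)"
      by (intro sum.cong refl) (auto simp: Zp)
    finally show ?thesis by simp
  qed
  have grad: "X n (\<lambda>x. gram \<Psi> x $ k $ l) p = 0" for n k l
  proof -
    \<comment> \<open>All terms other than \<open>Z i k x * Z i l x\<close> contain a factor
      \<open>R\<close>, which vanishes at \<open>p\<close>. Hence only the derivative of
      \<open>R\<close>, that is \<open>q\<close>, is added to \<open>s\<close>.\<close>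
    have "(\<lambda>x. gram \<Psi> x $ k $ l) = (\<lambda>x. \<Sum>i\<in>UNIV. Z i k x * Z i l x + (Z i k x * R i l x + R i k x * (Z i l x + R i l x)))"
      by (simp add: gram_def X\<Psi> fun_eq_iff algebra_simps)
    also have "\<dots> = (\<lambda>x. (\<Sum>i\<in>UNIV. Z i k x * Z i l x) + (\<Sum>i\<in>UNIV. Z i k x * R i l x + R i k x * (Z i l x + R i l x)))"
      by (simp add: sum.distrib)
    finally have "X n (\<lambda>x. gram \<Psi> x $ k $ l) p
        = s n k l + X n (\<lambda>x. \<Sum>i\<in>UNIV. Z i k x * R i l x + R i k x * (Z i l x + R i l x)) p"
      unfolding s_def by (simp add: X_add differentiable_sum differentiable_mult differentiable_add dZ dR)
    also have "X n (\<lambda>x. \<Sum>i\<in>UNIV. Z i k x * R i l x + R i k x * (Z i l x + R i l x)) p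
        = (\<Sum>i\<in>UNIV. X n (\<lambda>x. Z i k x * R i l x + R i k x * (Z i l x + R i l x)) p)"
      by (rule X_sum) (auto intro!: differentiable_add differentiable_mult dZ dR)
    also have "\<dots> = (\<Sum>i\<in>UNIV. (if i = k then q l n i else 0) + (if i = l then q k n i else 0))"
      by (intro sum.cong refl) (auto simp: X_add X_mult differentiable_add differentiable_mult dZ dR Rp XRp Zp)
    also have "\<dots> = q l n k + q k n l" by (simp add: sum.distrib)
    finally show ?thesis using q_eq[of n k l] by simp
  qed
  show ?thesis
    by (rule that[of \<Psi>]) (use C\<Psi> grad in \<open>auto simp: X\<Psi> Zp Rp\<close>, simp add: \<Psi>_def \<eta>p vec_eq_iff)
qed

end

section \<open>Coordinates that are almost isometric at small scales\<close>

lemma transpose_mult_inner: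
  fixes Y :: "real^'n::finite^'n"
  shows "v \<bullet> (transpose Y *v w) = (Y *v v) \<bullet> w"
  by (metis dot_lmul_matrix inner_commute transpose_matrix_vector)

text \<open>The Gram matrix controls \<open>transpose Y ** Y\<close>, hence \<open>Y\<close>,
  whereas the differential of the coordinates acts on frame coordinates by
  \<open>transpose Y\<close>. The bounds are therefore transferred to the transpose. The first one
  makes the coordinate map almost contracting, the second one its inverse.\<close>

lemma near_orthogonal_bounds:
  fixes Y :: "real^'n::finite^'n"
  assumes H: "\<And>\<theta>. norm (transpose Y *v (Y *v \<theta>) - \<theta>) \<le> \<kappa> * norm \<theta>" and \<kappa>: "0 \<le> \<kappa>" "\<kappa> \<le> 1/2"
  shows "norm (transpose Y *v w) \<le> (1 + \<kappa>) * norm w"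
    and "norm w \<le> (1 + 2 * \<kappa>) * norm (transpose Y *v w)"
proof -
  have inner: "\<bar>(norm (Y *v \<theta>))\<^sup>2 - (norm \<theta>)\<^sup>2\<bar> \<le> \<kappa> * (norm \<theta>)\<^sup>2" for \<theta>
  proof -
    have "(norm (Y *v \<theta>))\<^sup>2 - (norm \<theta>)\<^sup>2 = \<theta> \<bullet> (transpose Y *v (Y *v \<theta>) - \<theta>)"
      by (simp add: inner_diff_right transpose_mult_inner power2_norm_eq_inner del: transpose_matrix_vector)
    then have "\<bar>(norm (Y *v \<theta>))\<^sup>2 - (norm \<theta>)\<^sup>2\<bar> \<le> norm \<theta> * norm (transpose Y *v (Y *v \<theta>) - \<theta>)"
      by (metis Cauchy_Schwarz_ineq2)
    also have "\<dots> \<le> norm \<theta> * (\<kappa> * norm \<theta>)" by (rule mult_left_mono[OF H]) simp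
    finally show ?thesis by (simp add: power2_eq_square mult_ac)
  qed
  show "norm (transpose Y *v w) \<le> (1 + \<kappa>) * norm w"
  proof -
    let ?v = "transpose Y *v w"
    have "(norm (Y *v ?v))\<^sup>2 \<le> (1 + \<kappa>) * (norm ?v)\<^sup>2" using inner[of ?v] by (simp add: algebra_simps)
    also have "\<dots> \<le> (1 + \<kappa>)\<^sup>2 * (norm ?v)\<^sup>2"
      using \<kappa> by (intro mult_right_mono) (auto simp: power2_eq_square algebra_simps)
    finally have Yv: "norm (Y *v ?v) \<le> (1 + \<kappa>) * norm ?v"
      using \<kappa> by (simp add: power_mult_distrib[symmetric] power2_le_iff_abs_le)
    have "(norm ?v)\<^sup>2 = (Y *v ?v) \<bullet> w"
      by (simp add: transpose_mult_inner power2_norm_eq_inner del: transpose_matrix_vector)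
    also have "\<dots> \<le> norm (Y *v ?v) * norm w" by (rule norm_cauchy_schwarz)
    also have "\<dots> \<le> ((1 + \<kappa>) * norm ?v) * norm w" by (rule mult_right_mono[OF Yv]) simp
    finally have "norm ?v * norm ?v \<le> norm ?v * ((1 + \<kappa>) * norm w)"
      by (simp add: power2_eq_square mult_ac)
    then show ?thesis
      using \<kappa> by (cases "?v = 0") (auto simp del: transpose_matrix_vector)
  qed
  \<comment> \<open>Injectivity, hence surjectivity, lets \<open>w\<close> be written as
    \<open>Y *v \<theta>\<close>; then
    \<open>(norm w)\<^sup>2 = \<theta> \<bullet> (transpose Y *v w)\<close> bounds \<open>w\<close>
    by its image.\<close>
  have "inj ((*v) Y)"
  proof (rule injI)
    fix a b assume "Y *v a = Y *v b"
    then have "Y *v (a - b) = 0" by (simp add: matrix_vector_mult_diff_distrib)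
    then have "\<bar>0 - (norm (a - b))\<^sup>2\<bar> \<le> \<kappa> * (norm (a - b))\<^sup>2"
      using inner[of "a - b"] by simp
    moreover have "\<kappa> * (norm (a - b))\<^sup>2 \<le> (1/2) * (norm (a - b))\<^sup>2"
      using \<kappa>(2) by (rule mult_right_mono) simp
    ultimately have "(norm (a - b))\<^sup>2 \<le> 0" by linarith
    then show "a = b" by simp
  qed
  then have "surj ((*v) Y)"
    by (intro linear_injective_imp_surjective) auto
  then obtain \<theta> where \<theta>: "w = Y *v \<theta>" by (metis surjD)
  have "(1 - \<kappa>) * (norm \<theta>)\<^sup>2 \<le> (norm w)\<^sup>2" using inner[of \<theta>] \<theta> by (simp add: algebra_simps)
  moreover have "(1 - \<kappa>)\<^sup>2 * (norm \<theta>)\<^sup>2 \<le> (1 - \<kappa>) * (norm \<theta>)\<^sup>2"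
    using \<kappa> by (intro mult_right_mono) (auto simp: power2_eq_square algebra_simps mult_left_le)
  ultimately have "((1 - \<kappa>) * norm \<theta>)\<^sup>2 \<le> (norm w)\<^sup>2" by (simp add: power_mult_distrib)
  then have \<theta>w: "(1 - \<kappa>) * norm \<theta> \<le> norm w" by (simp add: power2_le_iff_abs_le)
  have "(norm w)\<^sup>2 = \<theta> \<bullet> (transpose Y *v w)"
    by (simp add: transpose_mult_inner power2_norm_eq_inner \<theta> del: transpose_matrix_vector)
  also have "\<dots> \<le> norm \<theta> * norm (transpose Y *v w)" by (rule norm_cauchy_schwarz)
  finally have "(1 - \<kappa>) * (norm w)\<^sup>2 \<le> ((1 - \<kappa>) * norm \<theta>) * norm (transpose Y *v w)"
    using \<kappa> mult_left_mono[of "(norm w)\<^sup>2" "norm \<theta> * norm (transpose Y *v w)" "1 - \<kappa>"] by (simp add: mult_ac)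
  also have "\<dots> \<le> norm w * norm (transpose Y *v w)" by (rule mult_right_mono[OF \<theta>w]) simp
  finally have "norm w * ((1 - \<kappa>) * norm w) \<le> norm w * norm (transpose Y *v w)"
    by (simp add: power2_eq_square mult_ac)
  then have 1: "(1 - \<kappa>) * norm w \<le> norm (transpose Y *v w)"
    by (cases "w = 0") (auto simp del: transpose_matrix_vector)
  \<comment> \<open>The product is \<open>1 + \<kappa> - 2 * \<kappa>\<^sup>2\<close>, so this is
    where \<open>\<kappa> \<le> 1/2\<close> is sharp.\<close>
  have "1 \<le> (1 + 2 * \<kappa>) * (1 - \<kappa>)"
  proof -
    have "\<kappa> * \<kappa> \<le> \<kappa> * (1/2)" using \<kappa> by (intro mult_left_mono) auto
    then show ?thesis by (simp add: algebra_simps)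
  qed
  then have "1 * norm w \<le> (1 + 2 * \<kappa>) * (1 - \<kappa>) * norm w" by (rule mult_right_mono) simp
  also have "\<dots> \<le> (1 + 2 * \<kappa>) * norm (transpose Y *v w)"
    using 1 \<kappa> by (simp add: mult.assoc mult_left_mono del: transpose_matrix_vector)
  finally show "norm w \<le> (1 + 2 * \<kappa>) * norm (transpose Y *v w)" by simp
qed

locale normal_coords = framed_space A for A :: "real^'n::finite \<Rightarrow> real^'n^'n" +
  fixes p :: "real^'n" and \<Psi> :: "real^'n \<Rightarrow> real^'n"
  assumes Ck_\<Psi>: "\<And>m k. Ck_on m UNIV (\<lambda>x. \<Psi> x $ k)" and \<Psi>_p: "\<Psi> p = 0"
    and X_\<Psi>_p: "\<And>i k. X i (\<lambda>x. \<Psi> x $ k) p = (if i = k then 1 else 0)"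
    and X_gram_p: "\<And>n k l. X n (\<lambda>x. gram \<Psi> x $ k $ l) p = 0"
begin

definition Y :: "real^'n \<Rightarrow> real^'n^'n" where "Y x = (\<chi> i k. X i (\<lambda>x. \<Psi> x $ k) x)"

lemma Ck_Y: "Ck_on m UNIV (\<lambda>x. Y x $ i $ k)"
  using Ck_X[OF Ck_\<Psi>] by (simp add: Y_def)

lemma gram_eq: "gram \<Psi> x = transpose (Y x) ** Y x"
  by (simp add: gram_def Y_def matrix_matrix_mult_def transpose_def)

lemma Ck_gram: "Ck_on m UNIV (\<lambda>x. gram \<Psi> x $ k $ l)"
  unfolding gram_def by (simp, intro Ck_on_sum Ck_on_mult Ck_X Ck_\<Psi>)

lemma differentiable_\<Psi>: "(\<lambda>x. \<Psi> x $ k) differentiable (at x)"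
  using Ck_on_imp_differentiable[OF Ck_\<Psi>[of 1]] by simp

definition J :: "real^'n \<Rightarrow> real^'n^'n" where "J x = transpose (Y x) ** coframe x"

lemma J_mult: "J x *v v = transpose (Y x) *v (coframe x *v v)"
  by (simp add: J_def matrix_vector_mul_assoc del: transpose_matrix_vector)

lemma has_derivative_\<Psi>: "(\<Psi> has_derivative (\<lambda>v. J x *v v)) (at x)"
proof -
  have "(J x *v v) $ k = (\<Sum>i\<in>UNIV. (coframe x *v v) $ i * X i (\<lambda>x. \<Psi> x $ k) x)" for v k
    unfolding J_mult matrix_vector_mult_def[of "transpose (Y x)"]
    by (simp add: transpose_def Y_def mult.commute)
  then have "((\<lambda>x. \<Psi> x $ k) has_derivative (\<lambda>v. (J x *v v) $ k)) (at x)" for k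
    using has_derivative_frame[OF differentiable_\<Psi>] by simp
  then show ?thesis
    unfolding has_derivative_componentwise_within[of \<Psi>] by (auto simp: Basis_vec_def inner_axis)
qed

lemma gram_p: "gram \<Psi> p = mat 1"
  by (auto simp: gram_def X_\<Psi>_p mat_def vec_eq_iff if_distrib[of "\<lambda>x. x * _"] cong: if_cong)

text \<open>The differential of the Gram matrix vanishes at \<open>p\<close>, so its entries differ
  from those of the identity by o(norm (x - p)). The factor \<open>N * N\<close> distributes
  \<open>\<epsilon>\<close> over the entries.\<close>

lemma gram_close:
  assumes \<epsilon>: "\<epsilon> > 0"
  obtains \<delta> where "\<delta> > 0"
    "\<And>x \<theta>. norm (x - p) < \<delta> \<Longrightarrow> norm (gram \<Psi> x *v \<theta> - \<theta>) \<le> \<epsilon> * norm (x - p) * norm \<theta>"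
    "\<And>x n k l. norm (x - p) < \<delta> \<Longrightarrow> \<bar>X n (\<lambda>x. gram \<Psi> x $ k $ l) x\<bar> \<le> \<epsilon>"
proof -
  define N where "N = real CARD('n)"
  have N: "N > 0" by (simp add: N_def)
  have 1: "\<forall>\<^sub>F x in nhds p. \<bar>gram \<Psi> x $ k $ l - mat 1 $ k $ l\<bar> \<le> \<epsilon> / (N * N) * norm (x - p)" for k l
  proof -
    have "((\<lambda>x. gram \<Psi> x $ k $ l) has_derivative (\<lambda>v. 0)) (at p)"
      using has_derivative_frame[OF Ck_on_imp_differentiable[OF Ck_gram[of 1]], of p k l] by (simp add: X_gram_p)
    then have "\<exists>d>0. \<forall>y. norm (y - p) < d \<longrightarrow> norm (gram \<Psi> y $ k $ l - gram \<Psi> p $ k $ l - 0) \<le> \<epsilon> / (N * N) * norm (y - p)"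
      using \<epsilon> N unfolding has_derivative_at_alt by (metis divide_pos_pos mult_pos_pos)
    then show ?thesis by (simp add: eventually_nhds_metric dist_norm gram_p)
  qed
  have 2: "\<forall>\<^sub>F x in nhds p. \<bar>X n (\<lambda>x. gram \<Psi> x $ k $ l) x\<bar> \<le> \<epsilon>" for n k l
  proof -
    have "continuous_on UNIV (X n (\<lambda>x. gram \<Psi> x $ k $ l))"
      using Ck_on_imp_continuous[OF Ck_X[OF Ck_gram, of 0]] .
    then have "isCont (X n (\<lambda>x. gram \<Psi> x $ k $ l)) p"
      by (simp add: continuous_on_eq_continuous_at)
    then have "filterlim (X n (\<lambda>x. gram \<Psi> x $ k $ l)) (nhds 0) (nhds p)"
      by (simp add: isCont_def tendsto_at_iff_tendsto_nhds X_gram_p[symmetric, of n k l])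
    then have "\<forall>\<^sub>F x in nhds p. dist (X n (\<lambda>x. gram \<Psi> x $ k $ l) x) 0 < \<epsilon>"
      using \<epsilon> by (rule tendstoD)
    then show ?thesis by (rule eventually_mono) (simp add: dist_real_def)
  qed
  have "\<forall>\<^sub>F x in nhds p. (\<forall>k l. \<bar>gram \<Psi> x $ k $ l - mat 1 $ k $ l\<bar> \<le> \<epsilon> / (N * N) * norm (x - p)) \<and>
      (\<forall>n k l. \<bar>X n (\<lambda>x. gram \<Psi> x $ k $ l) x\<bar> \<le> \<epsilon>)"
    by (intro eventually_conj eventually_all_finite 1 2)
  then obtain \<delta> where \<delta>: "\<delta> > 0" "\<And>x. norm (x - p) < \<delta> \<Longrightarrow> (\<forall>k l. \<bar>gram \<Psi> x $ k $ l - mat 1 $ k $ l\<bar> \<le> \<epsilon> / (N * N) * norm (x - p)) \<and>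
      (\<forall>n k l. \<bar>X n (\<lambda>x. gram \<Psi> x $ k $ l) x\<bar> \<le> \<epsilon>)"
    unfolding eventually_nhds_metric dist_norm by blast
  show ?thesis
  proof (rule that[OF \<delta>(1)])
    fix x \<theta> assume x: "norm (x - p) < \<delta>"
    have "norm (gram \<Psi> x *v \<theta> - \<theta>) = norm ((gram \<Psi> x - mat 1) *v \<theta>)"
      by (simp add: matrix_vector_mult_diff_rdistrib)
    also have "\<dots> \<le> (\<Sum>i\<in>UNIV. \<Sum>j\<in>UNIV. \<bar>(gram \<Psi> x - mat 1) $ i $ j\<bar>) * norm \<theta>"
      by (rule norm_matrix_vector_mult_le)
    also have "\<dots> \<le> (\<Sum>i\<in>(UNIV::'n set). \<Sum>j\<in>(UNIV::'n set). \<epsilon> / (N * N) * norm (x - p)) * norm \<theta>"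
      using \<delta>(2)[OF x] by (intro mult_right_mono sum_mono) auto
    also have "\<dots> = \<epsilon> * norm (x - p) * norm \<theta>" using N by (simp add: N_def)
    finally show "norm (gram \<Psi> x *v \<theta> - \<theta>) \<le> \<epsilon> * norm (x - p) * norm \<theta>" .
  qed (use \<delta>(2) in blast)
qed

text \<open>The inverse function theorem, with continuity of \<open>\<Theta>'\<close> along curves
  added: it makes the images of segments admissible in \<open>riem_dist_le_length\<close>. The
  continuity is read off from \<open>\<Theta>' w\<close> being multiplication by
  \<open>matrix_inv (J (\<Theta> w))\<close>.\<close>

lemma local_inverse:
  obtains U V \<Theta> \<Theta>' where "open U" "p \<in> U" "open V" "0 \<in> V" "homeomorphism U V \<Psi> \<Theta>"
    "\<And>w. w \<in> V \<Longrightarrow> (\<Theta> has_derivative \<Theta>' w) (at w)"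
    "\<And>w v. w \<in> V \<Longrightarrow> J (\<Theta> w) *v \<Theta>' w v = v"
    "\<And>v S c. continuous_on S c \<Longrightarrow> c ` S \<subseteq> V \<Longrightarrow> continuous_on S (\<lambda>t. \<Theta>' (c t) v)"
proof -
  define B where "B x = Blinfun (\<lambda>v. J x *v v)" for x
  have B: "blinfun_apply (B x) = (\<lambda>v. J x *v v)" for x
    by (simp add: B_def bounded_linear_Blinfun_apply matrix_vector_mul_bounded_linear)
  have cJ: "continuous_on S (\<lambda>x. J x $ i $ j)" for S i j
  proof -
    have "Ck_on 0 UNIV (\<lambda>x. J x $ i $ j)"
      unfolding J_def matrix_matrix_mult_def transpose_def
      by (simp del: Ck_on.simps, intro Ck_on_sum Ck_on_mult Ck_Y Ck_coframe)
    then show ?thesis using Ck_on_imp_continuous continuous_on_subset by blast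
  qed
  have cJv: "continuous_on S (\<lambda>x. J x *v v)" for S v
    unfolding matrix_vector_mult_def
    by (rule continuous_on_vec_lambda) (intro continuous_on_sum continuous_on_mult cJ continuous_on_const)
  have contB: "continuous_on UNIV B"
    by (rule continuous_on_blinfun_componentwise) (simp add: B cJv)
  have Yp: "Y p = mat 1" by (simp add: Y_def mat_def X_\<Psi>_p vec_eq_iff)
  have Jp: "J p = coframe p" by (simp add: J_def Yp)
  define I where "I = Blinfun (\<lambda>v. transpose (A p) *v v)"
  have I: "blinfun_apply I = (\<lambda>v. transpose (A p) *v v)"
    unfolding I_def by (rule bounded_linear_Blinfun_apply) (rule matrix_vector_mul_bounded_linear)
  have "I o\<^sub>L B p = id_blinfun"
    by (rule blinfun_eqI) (simp add: B I Jp coframe_right del: transpose_matrix_vector)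
  then obtain U V \<Theta> \<Theta>' where *: "open U" "U \<subseteq> UNIV" "p \<in> U" "open V" "\<Psi> p \<in> V" "homeomorphism U V \<Psi> \<Theta>"
    "\<And>w. w \<in> V \<Longrightarrow> (\<Theta> has_derivative \<Theta>' w) (at w)"
    "\<And>w. w \<in> V \<Longrightarrow> \<Theta>' w = inv (blinfun_apply (B (\<Theta> w)))"
    "\<And>w. w \<in> V \<Longrightarrow> bij (blinfun_apply (B (\<Theta> w)))"
    by (rule inverse_function_theorem[of UNIV \<Psi> B p I, rotated 4]) (use contB has_derivative_\<Psi> in \<open>auto simp: B\<close>)
  have inv: "J (\<Theta> w) *v \<Theta>' w v = v" if "w \<in> V" for w v
    using *(8)[OF that] *(9)[OF that] by (simp add: B bij_is_surj surj_f_inv_f)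
  have det: "det (J (\<Theta> w)) \<noteq> 0" if "w \<in> V" for w
  proof -
    have "inj ((*v) (J (\<Theta> w)))" using *(9)[OF that] by (simp add: B bij_is_inj)
    then show ?thesis by (metis invertible_det_nz invertible_left_inverse matrix_left_invertible_injective)
  qed
  have \<Theta>': "\<Theta>' w v = matrix_inv (J (\<Theta> w)) *v v" if "w \<in> V" for w v
  proof -
    have "matrix_inv (J (\<Theta> w)) *v (J (\<Theta> w) *v \<Theta>' w v) = \<Theta>' w v"
      using matrix_inv_left_right(2)[OF det[OF that]] by (simp add: matrix_vector_mul_assoc)
    then show ?thesis by (simp add: inv[OF that])
  qed
  have cont: "continuous_on S (\<lambda>t. \<Theta>' (c t) v)" if c: "continuous_on S c" "c ` S \<subseteq> V" for v and S :: "'b::topological_space set" and c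
  proof -
    have "continuous_on V \<Theta>" using *(6) by (simp add: homeomorphism_def)
    then have c\<Theta>: "continuous_on S (\<lambda>t. \<Theta> (c t))" using c continuous_on_compose2 by blast
    have "continuous_on S (\<lambda>t. J (\<Theta> (c t)) $ i $ j)" for i j
      using continuous_on_compose2[OF cJ[of UNIV] c\<Theta>] by auto
    then have m: "continuous_on S (\<lambda>t. matrix_inv (J (\<Theta> (c t))) $ i $ j)" for i j
      using det c(2) by (intro continuous_on_matrix_inv) auto
    have "continuous_on S (\<lambda>t. matrix_inv (J (\<Theta> (c t))) *v v)"
      unfolding matrix_vector_mult_def
      by (rule continuous_on_vec_lambda) (intro continuous_on_sum continuous_on_mult m continuous_on_const)
    then show ?thesis
      by (rule continuous_on_eq) (use c \<Theta>' in auto)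
  qed
  show ?thesis
    by (rule that[OF *(1,3,4) _ *(6,7) inv cont]) (use *(5) \<Psi>_p in auto)
qed

lemma gram_mult: "gram \<Psi> x *v \<theta> = transpose (Y x) *v (Y x *v \<theta>)"
  by (simp add: gram_eq matrix_vector_mul_assoc del: transpose_matrix_vector)

lemma continuous_\<Psi>: "continuous_on S \<Psi>"
  using has_derivative_\<Psi> by (meson continuous_at_imp_continuous_on has_derivative_continuous)

text \<open>At scale \<open>r\<close> all relative errors are at most \<open>\<epsilon> * r\<close>,
  so distances are Euclidean up to order \<open>\<epsilon> * r\<^sup>2\<close>. The upper bound is
  for arbitrary pairs, since it estimates the distance from \<open>z\<close>; the lower bound, from
  \<open>p\<close> only, locates \<open>\<Psi> z\<close>.\<close>

definition almost_flat ::
  "(real^'n) set \<Rightarrow> (real^'n) set \<Rightarrow> (real^'n \<Rightarrow> real^'n) \<Rightarrow> real \<Rightarrow> real \<Rightarrow> bool"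
  where "almost_flat U V \<Theta> \<epsilon> r \<longleftrightarrow> cball 0 (4 * r) \<subseteq> V \<and>
    (\<forall>w\<in>cball 0 (4 * r). \<forall>w'\<in>cball 0 (4 * r). d (\<Theta> w) (\<Theta> w') \<le> (1 + \<epsilon> * r) * norm (w' - w)) \<and>
    (\<forall>z. d p z \<le> 2 * r \<longrightarrow> z \<in> U \<and> norm (\<Psi> z) \<le> (1 + \<epsilon> * r) * d p z) \<and>
    (\<forall>w\<in>cball 0 (4 * r). (\<forall>\<theta>. norm (gram \<Psi> (\<Theta> w) *v \<theta> - \<theta>) \<le> \<epsilon> * r * norm \<theta>) \<and>
      (\<forall>n k l. \<bar>X n (\<lambda>x. gram \<Psi> x $ k $ l) (\<Theta> w)\<bar> \<le> \<epsilon>))"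

text \<open>Upper bounds come from images of segments under \<open>\<Theta>\<close>, lower bounds
  from \<open>riem_dist_ge_norm\<close> with \<open>\<Psi>\<close>. The estimate is bootstrapped: a
  bound with factor 2 shows that \<open>\<Theta>\<close> maps \<open>cball 0 (4 * r)\<close> into a
  Euclidean ball of radius O(r), where \<open>gram_close\<close> gives the sharp error.\<close>

lemma local_estimates:
  obtains U V \<Theta> where "open U" "p \<in> U" "open V" "0 \<in> V" "homeomorphism U V \<Psi> \<Theta>"
    "\<forall>\<epsilon>>0. \<exists>r0>0. \<forall>r. 0 < r \<and> r < r0 \<longrightarrow> almost_flat U V \<Theta> \<epsilon> r"
proof -
  obtain U V \<Theta> \<Theta>' where UV: "open U" "p \<in> U" "open V" "0 \<in> V" and hom: "homeomorphism U V \<Psi> \<Theta>"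
    and der: "\<And>w. w \<in> V \<Longrightarrow> (\<Theta> has_derivative \<Theta>' w) (at w)"
    and inv: "\<And>w v. w \<in> V \<Longrightarrow> J (\<Theta> w) *v \<Theta>' w v = v"
    and cont\<Theta>': "\<And>v S c. continuous_on S c \<Longrightarrow> c ` S \<subseteq> V \<Longrightarrow> continuous_on S (\<lambda>t::real. \<Theta>' (c t) v)"
    by (rule local_inverse) blast
  have \<Theta>\<Psi>: "\<Theta> (\<Psi> x) = x" if "x \<in> U" for x using hom that by (simp add: homeomorphism_def)
  have \<Psi>\<Theta>: "\<Psi> (\<Theta> w) = w" if "w \<in> V" for w using hom that by (simp add: homeomorphism_def)
  have \<Theta>0: "\<Theta> 0 = p" using \<Theta>\<Psi>[OF UV(2)] by (simp add: \<Psi>_p)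
  obtain C where C: "C > 0" "\<And>y. C * d p y < 1 \<Longrightarrow> norm (y - p) \<le> C * d p y"
    using norm_diff_le_riem_dist[of p 1] by metis
  have "\<exists>r0>0. \<forall>r. 0 < r \<and> r < r0 \<longrightarrow> almost_flat U V \<Theta> \<epsilon> r" if \<epsilon>: "\<epsilon> > 0" for \<epsilon>
  proof -
    \<comment> \<open>The image of \<open>cball 0 (4 * r)\<close> has Euclidean radius at most
      \<open>8 * C * r\<close>, so the Gram error there is at most
      \<open>8 * C * r * \<epsilon>1 \<le> \<epsilon> * r / 2\<close>.\<close>
    define \<epsilon>1 where "\<epsilon>1 = min \<epsilon> (\<epsilon> / (16 * C))"
    have \<epsilon>1: "\<epsilon>1 > 0" "\<epsilon>1 \<le> \<epsilon>" "\<epsilon>1 \<le> \<epsilon> / (16 * C)" using \<epsilon> C by (auto simp: \<epsilon>1_def)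
    obtain \<delta> where \<delta>: "\<delta> > 0"
      "\<And>x \<theta>. norm (x - p) < \<delta> \<Longrightarrow> norm (gram \<Psi> x *v \<theta> - \<theta>) \<le> \<epsilon>1 * norm (x - p) * norm \<theta>"
      "\<And>x n k l. norm (x - p) < \<delta> \<Longrightarrow> \<bar>X n (\<lambda>x. gram \<Psi> x $ k $ l) x\<bar> \<le> \<epsilon>1"
      by (rule gram_close[OF \<epsilon>1(1)]) blast
    \<comment> \<open>The second bound keeps the Gram error below 1/2, as
      \<open>near_orthogonal_bounds\<close> demands, before any sharper information is
      available.\<close>
    define \<delta>' where "\<delta>' = min \<delta> (1 / (2 * \<epsilon>1))"
    have \<delta>': "\<delta>' > 0" "\<delta>' \<le> \<delta>" "\<delta>' \<le> 1 / (2 * \<epsilon>1)" using \<delta> \<epsilon>1 by (auto simp: \<delta>'_def)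
    have "isCont \<Theta> 0" using der[OF UV(4)] has_derivative_continuous by blast
    then have "(\<Theta> \<longlongrightarrow> \<Theta> 0) (nhds 0)" by (simp only: isCont_def tendsto_at_iff_tendsto_nhds)
    then have "\<forall>\<^sub>F w in nhds 0. \<Theta> w \<in> ball p \<delta>'"
      by (rule topological_tendstoD) (use \<delta>'(1) \<Theta>0 in auto)
    moreover have "\<forall>\<^sub>F w in nhds 0. w \<in> V" using UV by (simp add: eventually_nhds_in_open)
    ultimately have "\<forall>\<^sub>F w in nhds 0. \<Theta> w \<in> ball p \<delta>' \<and> w \<in> V" by (rule eventually_conj)
    then obtain \<rho> where \<rho>: "\<rho> > 0" "\<And>w. w \<in> ball 0 \<rho> \<Longrightarrow> \<Theta> w \<in> ball p \<delta>' \<and> w \<in> V"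
      unfolding eventually_nhds_metric by (auto simp: dist_commute)
    have g\<kappa>: "norm (transpose (Y (\<Theta> w)) *v (Y (\<Theta> w) *v \<theta>) - \<theta>) \<le> K * norm \<theta>"
      if "w \<in> ball 0 \<rho>" "\<epsilon>1 * norm (\<Theta> w - p) \<le> K" for w \<theta> K
    proof -
      have "norm (gram \<Psi> (\<Theta> w) *v \<theta> - \<theta>) \<le> \<epsilon>1 * norm (\<Theta> w - p) * norm \<theta>"
        using \<rho>(2)[OF that(1)] \<delta>' by (intro \<delta>(2)) (auto simp: dist_norm norm_minus_commute)
      also have "\<dots> \<le> K * norm \<theta>" using that by (intro mult_right_mono) auto
      finally show ?thesis by (simp add: gram_mult del: transpose_matrix_vector)
    qed
    have iso: "d (\<Theta> w) (\<Theta> w') \<le> (1 + 2 * K) * norm (w' - w)"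
      if S: "convex S" "S \<subseteq> ball 0 \<rho>" "w \<in> S" "w' \<in> S" and K: "\<And>v. v \<in> S \<Longrightarrow> \<epsilon>1 * norm (\<Theta> v - p) \<le> K" "K \<le> 1/2"
      for S K w w'
    proof -
      have K0: "0 \<le> K" using K(1)[OF S(3)] \<epsilon>1 by (meson mult_nonneg_nonneg less_imp_le norm_ge_zero order_trans)
      have l: "linepath w w' t \<in> S" if "t \<in> {0..1}" for t
        using S closed_segment_subset[OF S(3,4,1)] linepath_image_01[of w w'] that by blast
      have lV: "linepath w w' t \<in> V" if "t \<in> {0..1}" for t
        using l[OF that] S(2) \<rho>(2) by blast
      have "d (\<Theta> (linepath w w' 0)) (\<Theta> (linepath w w' 1)) \<le> (1 + 2 * K) * norm (w' - w)"
      proof (rule riem_dist_le_length[where c'="\<lambda>t. \<Theta>' (linepath w w' t) (w' - w)"])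
        fix t :: real assume t: "t \<in> {0..1}"
        have "((\<Theta> \<circ> linepath w w') has_vector_derivative \<Theta>' (linepath w w' t) (w' - w)) (at t)"
          using vector_derivative_diff_chain_within[OF has_vector_derivative_linepath_within[of w w' t UNIV]
              has_derivative_at_withinI[OF der[OF lV[OF t]]]] by simp
        then show "((\<lambda>t. \<Theta> (linepath w w' t)) has_vector_derivative \<Theta>' (linepath w w' t) (w' - w)) (at t)"
          by (simp add: o_def)
        have "norm (coframe (\<Theta> (linepath w w' t)) *v \<Theta>' (linepath w w' t) (w' - w))
          \<le> (1 + 2 * K) * norm (transpose (Y (\<Theta> (linepath w w' t))) *v (coframe (\<Theta> (linepath w w' t)) *v \<Theta>' (linepath w w' t) (w' - w)))"
          using g\<kappa>[of "linepath w w' t" K] l[OF t] S(2) K K0 by (intro near_orthogonal_bounds(2)) auto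
        then show "metric_norm g (\<Theta> (linepath w w' t)) (\<Theta>' (linepath w w' t) (w' - w)) \<le> (1 + 2 * K) * norm (w' - w)"
          using inv[OF lV[OF t], of "w' - w"] by (simp add: metric_norm_eq J_mult del: transpose_matrix_vector)
      next
        show "continuous_on {0..1} (\<lambda>t. \<Theta>' (linepath w w' t) (w' - w))"
          using lV by (intro cont\<Theta>' continuous_on_linepath) auto
      qed
      then show ?thesis by (simp add: linepath_def)
    qed
    have crude: "d p (\<Theta> w) \<le> 2 * norm w" if "w \<in> ball 0 \<rho>" for w
    proof -
      have "\<epsilon>1 * norm (\<Theta> v - p) \<le> 1/2" if "v \<in> ball 0 \<rho>" for v
      proof -
        have "norm (\<Theta> v - p) \<le> 1 / (2 * \<epsilon>1)"
          using \<rho>(2)[OF that] \<delta>' by (auto simp: dist_norm norm_minus_commute)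
        then show ?thesis using \<epsilon>1 by (simp add: field_simps)
      qed
      from iso[of "ball 0 \<rho>" 0 w "1/2", OF _ _ _ that this] show ?thesis using \<rho>(1) \<Theta>0 by simp
    qed
    \<comment> \<open>In this order: \<open>cball 0 (4 * r)\<close> lies in the ball of radius
      \<open>\<rho>\<close>; the crude bound meets the premise of
      \<open>norm_diff_le_riem_dist\<close>; and \<open>\<epsilon> * r < 1/2\<close>.\<close>
    define r0 where "r0 = min (\<rho> / 4) (min (1 / (8 * C)) (1 / (2 * \<epsilon>)))"
    have r0: "r0 > 0" using \<rho> C \<epsilon> by (auto simp: r0_def)
    show ?thesis
    proof (intro exI[of _ r0] conjI[OF r0] allI impI)
      fix r assume "0 < r \<and> r < r0"
      then have r: "0 < r" "4 * r < \<rho>" "r * (8 * C) < 1" "\<epsilon> * r < 1/2"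
        using C \<epsilon> by (auto simp: r0_def less_divide_eq mult_ac)
      have sub: "cball 0 (4 * r) \<subseteq> ball 0 \<rho>" using r by auto
      have near: "norm (\<Theta> w - p) \<le> 8 * C * r" if w: "w \<in> cball 0 (4 * r)" for w
      proof -
        have "C * d p (\<Theta> w) \<le> C * (2 * norm w)" using crude[OF subsetD[OF sub w]] C by (intro mult_left_mono) auto
        also have "\<dots> \<le> C * (2 * (4 * r))" using w C by (intro mult_left_mono) auto
        finally have "C * d p (\<Theta> w) \<le> 8 * C * r" by (simp add: mult_ac)
        moreover from this have "C * d p (\<Theta> w) < 1" using r(3) by (simp add: mult_ac)
        ultimately show ?thesis using C(2)[of "\<Theta> w"] by linarith
      qed
      have K: "\<epsilon>1 * norm (\<Theta> w - p) \<le> \<epsilon> * r / 2" if w: "w \<in> cball 0 (4 * r)" for w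
      proof -
        have "\<epsilon>1 * norm (\<Theta> w - p) \<le> \<epsilon> / (16 * C) * (8 * C * r)"
          using near[OF w] \<epsilon>1 \<epsilon> C by (intro mult_mono) auto
        then show ?thesis using C by simp
      qed
      have K': "\<epsilon> * r / 2 \<le> 1/2" "0 \<le> \<epsilon> * r / 2" using r \<epsilon> by auto
      have iso': "d (\<Theta> w) (\<Theta> w') \<le> (1 + \<epsilon> * r) * norm (w' - w)" if "w \<in> cball 0 (4 * r)" "w' \<in> cball 0 (4 * r)" for w w'
        using iso[OF convex_cball sub that K K'(1)] by simp
      have gr: "norm (gram \<Psi> (\<Theta> w) *v \<theta> - \<theta>) \<le> \<epsilon> * r * norm \<theta>" if "w \<in> cball 0 (4 * r)" for w \<theta>
      proof -
        have "norm (gram \<Psi> (\<Theta> w) *v \<theta> - \<theta>) \<le> \<epsilon> * r / 2 * norm \<theta>"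
          using g\<kappa>[OF subsetD[OF sub that] K[OF that]] by (simp add: gram_mult del: transpose_matrix_vector)
        also have "\<dots> \<le> \<epsilon> * r * norm \<theta>" using K' by (intro mult_right_mono) auto
        finally show ?thesis .
      qed
      have Xgr: "\<bar>X n (\<lambda>x. gram \<Psi> x $ k $ l) (\<Theta> w)\<bar> \<le> \<epsilon>" if "w \<in> cball 0 (4 * r)" for w n k l
      proof -
        have "norm (\<Theta> w - p) < \<delta>" using \<rho>(2)[OF subsetD[OF sub that]] \<delta>'(2) by (auto simp: dist_norm norm_minus_commute)
        from \<delta>(3)[OF this, of n k l] \<epsilon>1(2) show ?thesis by linarith
      qed
      have lower: "z \<in> U \<and> norm (\<Psi> z) \<le> (1 + \<epsilon> * r) * d p z" if z: "d p z \<le> 2 * r" for z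
      proof -
        \<comment> \<open>The confining set. Its part with
          \<open>norm (\<Psi> x) \<le> 3 * r\<close> is the image of a compact ball, hence closed,
          and \<open>3 * r\<close> exceeds \<open>(1 + \<epsilon> * r) * (2 * r)\<close> because
          \<open>\<epsilon> * r < 1/2\<close>.\<close>
        let ?W = "\<Theta> ` ball 0 (4 * r)"
        have V4: "ball 0 (4 * r) \<subseteq> V" using \<rho>(2) sub ball_subset_cball[of 0 "4 * r"] by blast
        have "?W = U \<inter> \<Psi> -` ball 0 (4 * r)"
        proof (intro equalityI subsetI)
          fix x assume "x \<in> ?W"
          then obtain w where "w \<in> ball 0 (4 * r)" "x = \<Theta> w" by blast
          then show "x \<in> U \<inter> \<Psi> -` ball 0 (4 * r)"
            using V4 \<Psi>\<Theta>[of w] hom by (auto simp: homeomorphism_def)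
        next
          fix x assume x: "x \<in> U \<inter> \<Psi> -` ball 0 (4 * r)"
          then show "x \<in> ?W" by (intro image_eqI[of _ _ "\<Psi> x"]) (auto simp: \<Theta>\<Psi>)
        qed
        then have oW: "open ?W"
          using continuous_open_preimage[OF continuous_\<Psi> UV(1) open_ball] by metis
        have "{x \<in> ?W. norm (\<Psi> x) \<le> 3 * r} = \<Theta> ` cball 0 (3 * r)"
        proof (intro equalityI subsetI)
          fix x assume "x \<in> {x \<in> ?W. norm (\<Psi> x) \<le> 3 * r}"
          then obtain w where w: "w \<in> ball 0 (4 * r)" "x = \<Theta> w" "norm (\<Psi> (\<Theta> w)) \<le> 3 * r" by blast
          then have "norm w \<le> 3 * r" using V4 \<Psi>\<Theta>[of w] by auto
          then show "x \<in> \<Theta> ` cball 0 (3 * r)" using w by auto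
        next
          fix x assume "x \<in> \<Theta> ` cball 0 (3 * r)"
          then obtain w where w: "norm w \<le> 3 * r" "x = \<Theta> w" by auto
          then have "w \<in> ball 0 (4 * r)" using r by auto
          then show "x \<in> {x \<in> ?W. norm (\<Psi> x) \<le> 3 * r}" using w V4 \<Psi>\<Theta>[of w] by auto
        qed
        moreover have "compact (\<Theta> ` cball 0 (3 * r))"
        proof (rule compact_continuous_image[OF _ compact_cball])
          have "cball 0 (3 * r) \<subseteq> V" using V4 r by (auto simp: subset_iff)
          then show "continuous_on (cball 0 (3 * r)) \<Theta>"
            using hom continuous_on_subset by (auto simp: homeomorphism_def)
        qed
        ultimately have cl: "closed {x \<in> ?W. norm (\<Psi> x) \<le> 3 * r}" by (simp add: compact_imp_closed)
        have pW: "p \<in> ?W" using \<Theta>0 r by (metis image_eqI centre_in_ball mult_pos_pos zero_less_numeral)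
        have le: "\<Psi> x \<bullet> (J x *v v) \<le> (1 + \<epsilon> * r) * norm (\<Psi> x) * metric_norm g x v" if x: "x \<in> ?W" for x v
        proof -
          obtain w where w: "w \<in> ball 0 (4 * r)" "x = \<Theta> w" using x by blast
          have "norm (transpose (Y x) *v (coframe x *v v)) \<le> (1 + \<epsilon> * r / 2) * norm (coframe x *v v)"
            unfolding w(2) using w(1) subsetD[OF sub, of w] by (intro near_orthogonal_bounds(1) g\<kappa> K K') auto
          also have "\<dots> \<le> (1 + \<epsilon> * r) * norm (coframe x *v v)" using K' by (intro mult_right_mono) auto
          finally have "norm (J x *v v) \<le> (1 + \<epsilon> * r) * metric_norm g x v"
            by (simp add: J_mult metric_norm_eq del: transpose_matrix_vector)
          then have "norm (\<Psi> x) * norm (J x *v v) \<le> norm (\<Psi> x) * ((1 + \<epsilon> * r) * metric_norm g x v)"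
            by (intro mult_left_mono) auto
          then show ?thesis using norm_cauchy_schwarz[of "\<Psi> x" "J x *v v"] by (simp add: mult_ac)
        qed
        have "(1 + \<epsilon> * r) * d p z \<le> (1 + \<epsilon> * r) * (2 * r)" using z K' by (intro mult_left_mono) auto
        also have "\<dots> < (3/2) * (2 * r)" using r by (intro mult_strict_right_mono) auto
        finally have s: "(1 + \<epsilon> * r) * d p z < 3 * r" by simp
        have k: "0 \<le> 1 + \<epsilon> * r" using K' by simp
        note res = riem_dist_ge_norm[of ?W p \<Psi> "\<lambda>x v. J x *v v", OF oW pW has_derivative_\<Psi> le k cl s \<Psi>_p]
        then have "z \<in> U" using V4 hom by (auto simp: homeomorphism_def)
        with res show ?thesis by blast
      qed
      show "almost_flat U V \<Theta> \<epsilon> r"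
        unfolding almost_flat_def using sub \<rho>(2) iso' lower gr Xgr by blast
    qed
  qed
  then show ?thesis by (intro that[OF UV hom]) blast
qed

subsection \<open>The \<open>\<infinity>\<close>-Laplacian in normal coordinates\<close>

text \<open>Here \<open>grd\<close> is the gradient of \<open>\<psi>\<close> with respect to the
  coordinates \<open>\<Psi>\<close> and \<open>M\<close> its Hessian. The second term collects the
  second derivatives of \<open>\<Psi>\<close>; it involves them only through first derivatives of
  the Gram matrix, which are small near \<open>p\<close>.\<close>

lemma inf_laplacian_chain:
  assumes X\<psi>: "\<And>j. X j \<psi> = (\<lambda>x. \<Sum>k\<in>UNIV. P k x * Y x $ j $ k)"
    and dP: "\<And>k. P k differentiable (at x)"
    and XP: "\<And>i k. X i (P k) x = (\<Sum>l\<in>UNIV. M $ k $ l * Y x $ i $ l)"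
  defines "grd \<equiv> (\<chi> k. P k x)"
  shows "frame_grad A \<psi> x = Y x *v grd"
    and "inf_laplacian A \<psi> x = (gram \<Psi> x *v grd) \<bullet> (M *v (gram \<Psi> x *v grd))
      + (\<Sum>i\<in>UNIV. (Y x *v grd) $ i * (\<Sum>k\<in>UNIV. \<Sum>n\<in>UNIV. grd $ k * grd $ n * X i (\<lambda>x. gram \<Psi> x $ k $ n) x)) / 2"
proof -
  show D: "frame_grad A \<psi> x = Y x *v grd"
    by (simp add: frame_grad_def X\<psi> matrix_vector_mult_def grd_def mult.commute)
  let ?D = "Y x *v grd"
  have Di: "X i \<psi> x = ?D $ i" for i using D by (simp add: frame_grad_def vec_eq_iff)
  have dY: "(\<lambda>x. Y x $ i $ k) differentiable (at x)" for i k
    using Ck_on_imp_differentiable[OF Ck_Y[of 1]] by simp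
  define W where "W i j k = X i (\<lambda>x. Y x $ j $ k) x" for i j k
  have XX: "X i (X j \<psi>) x = (\<Sum>k\<in>UNIV. (\<Sum>l\<in>UNIV. M $ k $ l * Y x $ i $ l) * Y x $ j $ k) + (\<Sum>k\<in>UNIV. grd $ k * W i j k)" for i j
  proof -
    have "X i (X j \<psi>) x = (\<Sum>k\<in>UNIV. X i (\<lambda>x. P k x * Y x $ j $ k) x)"
      unfolding X\<psi> by (rule X_sum) (auto intro!: differentiable_mult dP dY)
    also have "\<dots> = (\<Sum>k\<in>UNIV. P k x * W i j k + Y x $ j $ k * X i (P k) x)"
      by (simp add: X_mult dP dY W_def)
    finally show ?thesis by (simp add: XP sum.distrib grd_def mult.commute)
  qed
  have YD: "gram \<Psi> x *v grd = transpose (Y x) *v ?D" by (rule gram_mult)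
  have tD: "(transpose (Y x) *v ?D) $ k = (\<Sum>i\<in>UNIV. Y x $ i $ k * ?D $ i)" for k
    unfolding matrix_vector_mult_def[of "transpose (Y x)"] by (simp add: transpose_def)
  have 1: "(\<Sum>i\<in>UNIV. \<Sum>j\<in>UNIV. (\<Sum>k\<in>UNIV. (\<Sum>l\<in>UNIV. M $ k $ l * Y x $ i $ l) * Y x $ j $ k) * ?D $ i * ?D $ j)
      = (gram \<Psi> x *v grd) \<bullet> (M *v (gram \<Psi> x *v grd))"
  proof -
    have "(gram \<Psi> x *v grd) \<bullet> (M *v (gram \<Psi> x *v grd))
        = (\<Sum>k\<in>UNIV. (\<Sum>j\<in>UNIV. Y x $ j $ k * ?D $ j) * (\<Sum>l\<in>UNIV. M $ k $ l * (\<Sum>i\<in>UNIV. Y x $ i $ l * ?D $ i)))"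
      unfolding inner_vec_def YD matrix_vector_mult_def[of M] by (simp add: tD del: transpose_matrix_vector)
    also have "\<dots> = (\<Sum>k\<in>UNIV. \<Sum>l\<in>UNIV. \<Sum>i\<in>UNIV. \<Sum>j\<in>UNIV. M $ k $ l * Y x $ i $ l * Y x $ j $ k * ?D $ i * ?D $ j)"
      by (simp add: sum_distrib_left sum_distrib_right mult_ac)
    also have "\<dots> = (\<Sum>k\<in>UNIV. \<Sum>i\<in>UNIV. \<Sum>l\<in>UNIV. \<Sum>j\<in>UNIV. M $ k $ l * Y x $ i $ l * Y x $ j $ k * ?D $ i * ?D $ j)"
      by (rule sum.cong[OF refl sum.swap])
    also have "\<dots> = (\<Sum>i\<in>UNIV. \<Sum>k\<in>UNIV. \<Sum>l\<in>UNIV. \<Sum>j\<in>UNIV. M $ k $ l * Y x $ i $ l * Y x $ j $ k * ?D $ i * ?D $ j)"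
      by (rule sum.swap)
    also have "\<dots> = (\<Sum>i\<in>UNIV. \<Sum>k\<in>UNIV. \<Sum>j\<in>UNIV. \<Sum>l\<in>UNIV. M $ k $ l * Y x $ i $ l * Y x $ j $ k * ?D $ i * ?D $ j)"
      by (intro sum.cong[OF refl] sum.swap)
    also have "\<dots> = (\<Sum>i\<in>UNIV. \<Sum>j\<in>UNIV. \<Sum>k\<in>UNIV. \<Sum>l\<in>UNIV. M $ k $ l * Y x $ i $ l * Y x $ j $ k * ?D $ i * ?D $ j)"
      by (rule sum.cong[OF refl sum.swap])
    finally show ?thesis by (simp add: sum_distrib_left sum_distrib_right mult_ac)
  qed
  have XH: "X i (\<lambda>x. gram \<Psi> x $ k $ n) x = (\<Sum>j\<in>UNIV. Y x $ j $ k * W i j n + Y x $ j $ n * W i j k)" for i k n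
  proof -
    have "X i (\<lambda>x. gram \<Psi> x $ k $ n) x = (\<Sum>j\<in>UNIV. X i (\<lambda>x. Y x $ j $ k * Y x $ j $ n) x)"
      unfolding gram_eq matrix_matrix_mult_def transpose_def vec_lambda_beta
      by (rule X_sum) (auto intro!: differentiable_mult dY)
    then show ?thesis by (simp add: X_mult dY W_def)
  qed
  \<comment> \<open>With \<open>grd\<close> frozen, this is half the derivative of the squared norm
    of \<open>Y x *v grd\<close>, a quadratic form in \<open>grd\<close> with matrix
    \<open>gram \<Psi> x\<close>.\<close>
  have 2: "(\<Sum>j\<in>UNIV. (\<Sum>k\<in>UNIV. grd $ k * W i j k) * ?D $ j)
      = (\<Sum>k\<in>UNIV. \<Sum>n\<in>UNIV. grd $ k * grd $ n * X i (\<lambda>x. gram \<Psi> x $ k $ n) x) / 2" for i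
  proof -
    let ?S = "\<Sum>k\<in>UNIV. \<Sum>n\<in>UNIV. \<Sum>j\<in>UNIV. grd $ k * grd $ n * (Y x $ j $ n * W i j k)"
    have "(\<Sum>k\<in>UNIV. \<Sum>n\<in>UNIV. grd $ k * grd $ n * X i (\<lambda>x. gram \<Psi> x $ k $ n) x)
        = ?S + (\<Sum>k\<in>UNIV. \<Sum>n\<in>UNIV. \<Sum>j\<in>UNIV. grd $ k * grd $ n * (Y x $ j $ k * W i j n))"
      by (simp add: XH sum_distrib_left distrib_left sum.distrib)
    also have "(\<Sum>k\<in>UNIV. \<Sum>n\<in>UNIV. \<Sum>j\<in>UNIV. grd $ k * grd $ n * (Y x $ j $ k * W i j n)) = ?S"
      by (subst sum.swap) (simp add: mult_ac)
    finally have S: "(\<Sum>k\<in>UNIV. \<Sum>n\<in>UNIV. grd $ k * grd $ n * X i (\<lambda>x. gram \<Psi> x $ k $ n) x) / 2 = ?S" by simp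
    have "(\<Sum>j\<in>UNIV. (\<Sum>k\<in>UNIV. grd $ k * W i j k) * ?D $ j)
        = (\<Sum>j\<in>UNIV. \<Sum>n\<in>UNIV. \<Sum>k\<in>UNIV. grd $ k * grd $ n * (Y x $ j $ n * W i j k))"
      by (simp add: matrix_vector_mult_def sum_distrib_left sum_distrib_right mult_ac)
    also have "\<dots> = (\<Sum>j\<in>UNIV. \<Sum>k\<in>UNIV. \<Sum>n\<in>UNIV. grd $ k * grd $ n * (Y x $ j $ n * W i j k))"
      by (rule sum.cong[OF refl sum.swap])
    also have "\<dots> = (\<Sum>k\<in>UNIV. \<Sum>j\<in>UNIV. \<Sum>n\<in>UNIV. grd $ k * grd $ n * (Y x $ j $ n * W i j k))"
      by (rule sum.swap)
    also have "\<dots> = ?S" by (intro sum.cong refl sum.swap)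
    finally show ?thesis using S by simp
  qed
  have "inf_laplacian A \<psi> x
      = (\<Sum>i\<in>UNIV. \<Sum>j\<in>UNIV. (\<Sum>k\<in>UNIV. (\<Sum>l\<in>UNIV. M $ k $ l * Y x $ i $ l) * Y x $ j $ k) * ?D $ i * ?D $ j)
      + (\<Sum>i\<in>UNIV. \<Sum>j\<in>UNIV. (\<Sum>k\<in>UNIV. grd $ k * W i j k) * ?D $ i * ?D $ j)"
    unfolding inf_laplacian_eq_sum XX Di by (simp add: distrib_right sum.distrib)
  also have "(\<Sum>i\<in>UNIV. \<Sum>j\<in>UNIV. (\<Sum>k\<in>UNIV. grd $ k * W i j k) * ?D $ i * ?D $ j)
      = (\<Sum>i\<in>UNIV. ?D $ i * (\<Sum>j\<in>UNIV. (\<Sum>k\<in>UNIV. grd $ k * W i j k) * ?D $ j))"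
    by (simp add: sum_distrib_left mult_ac)
  also note 1
  finally show "inf_laplacian A \<psi> x = (gram \<Psi> x *v grd) \<bullet> (M *v (gram \<Psi> x *v grd))
      + (\<Sum>i\<in>UNIV. ?D $ i * (\<Sum>k\<in>UNIV. \<Sum>n\<in>UNIV. grd $ k * grd $ n * X i (\<lambda>x. gram \<Psi> x $ k $ n) x)) / 2"
    by (simp only: 2 times_divide_eq_right sum_divide_distrib[symmetric])
qed

definition quadr :: "real^'n \<Rightarrow> real^'n \<Rightarrow> real"
  where "quadr c x = (norm (\<Psi> x - c))\<^sup>2"

lemma quadr_eq: "quadr c = (\<lambda>x. \<Sum>k\<in>UNIV. (\<Psi> x $ k - c $ k) * (\<Psi> x $ k - c $ k))"
  by (simp add: quadr_def power2_norm_eq_inner inner_vec_def fun_eq_iff)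

lemma Ck_quadr: "Ck_on m UNIV (quadr c)"
  unfolding quadr_eq by (intro Ck_on_sum Ck_on_mult Ck_on_diff Ck_\<Psi> Ck_on_const)

lemma X_quadr: "X i (quadr c) x = (\<Sum>k\<in>UNIV. 2 * (\<Psi> x $ k - c $ k) * Y x $ i $ k)"
proof -
  have d: "(\<lambda>x. \<Psi> x $ k - c $ k) differentiable (at x)" for k
    by (intro differentiable_diff differentiable_const differentiable_\<Psi>)
  have X: "X i (\<lambda>x. \<Psi> x $ k - c $ k) x = Y x $ i $ k" for k
    using X_add[OF differentiable_\<Psi>[of k x] differentiable_const[of "- c $ k"], of i] by (simp add: Y_def)
  have "X i (quadr c) x = (\<Sum>k\<in>UNIV. X i (\<lambda>x. (\<Psi> x $ k - c $ k) * (\<Psi> x $ k - c $ k)) x)"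
    unfolding quadr_eq by (rule X_sum) (auto intro!: differentiable_mult d)
  also have "\<dots> = (\<Sum>k\<in>UNIV. 2 * (\<Psi> x $ k - c $ k) * Y x $ i $ k)"
    by (intro sum.cong refl, subst X_mult[OF d d]) (simp add: X)
  finally show ?thesis .
qed

text \<open>The test function is quadratic in the squared coordinate distance from \<open>c\<close>,
  with a penalty \<open>K\<close> centred at \<open>p\<close>. Squared distances keep it smooth
  everywhere, including at \<open>c\<close>.\<close>

lemma inf_laplacian_test:
  fixes a0 b1 b2 K :: real and c x :: "real^'n"
  defines "\<psi> \<equiv> \<lambda>x'. a0 + b1 * (quadr c x' - quadr c x) + b2 * (quadr c x' - quadr c x)\<^sup>2 + K * quadr 0 x'"
    and "y \<equiv> \<Psi> x - c"
  defines "grd \<equiv> (2 * b1) *\<^sub>R y + (2 * K) *\<^sub>R \<Psi> x"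
  defines "v \<equiv> gram \<Psi> x *v grd"
  shows "Ck_on m UNIV \<psi>" and "frame_grad A \<psi> x = Y x *v grd"
    and "inf_laplacian A \<psi> x = 8 * b2 * (y \<bullet> v)\<^sup>2 + 2 * (b1 + K) * (norm v)\<^sup>2
      + (\<Sum>i\<in>UNIV. (Y x *v grd) $ i * (\<Sum>k\<in>UNIV. \<Sum>n\<in>UNIV. grd $ k * grd $ n * X i (\<lambda>x. gram \<Psi> x $ k $ n) x)) / 2"
proof -
  let ?q = "quadr c"
  let ?s = "quadr c x"
  show C\<psi>: "Ck_on m UNIV \<psi>" for m
    unfolding \<psi>_def power2_eq_square by (intro Ck_on_add Ck_on_mult Ck_on_diff Ck_quadr Ck_on_const)
  have dq: "quadr c differentiable (at x)" for c x
    using Ck_on_imp_differentiable[OF Ck_quadr[of 1]] by simp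
  define P where "P k x' = (b1 + 2 * b2 * (?q x' - ?s)) * (2 * (\<Psi> x' $ k - c $ k)) + K * (2 * \<Psi> x' $ k)" for k x'
  have X\<psi>: "X j \<psi> = (\<lambda>x. \<Sum>k\<in>UNIV. P k x * Y x $ j $ k)" for j
  proof
    fix x'
    have h: "((\<lambda>s. a0 + b1 * (s - ?s) + b2 * (s - ?s)\<^sup>2) has_real_derivative b1 + 2 * b2 * (?q x' - ?s)) (at (?q x'))"
      by (auto intro!: derivative_eq_intros simp: algebra_simps)
    have "X j \<psi> x' = X j (\<lambda>x'. a0 + b1 * (?q x' - ?s) + b2 * (?q x' - ?s)\<^sup>2) x' + X j (\<lambda>x'. K * quadr 0 x') x'"
      unfolding \<psi>_def
      by (rule X_add) (simp_all add: dq differentiable_add differentiable_mult differentiable_diff power2_eq_square)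
    also have "\<dots> = (b1 + 2 * b2 * (?q x' - ?s)) * X j ?q x' + K * X j (quadr 0) x'"
      by (simp add: X_compose[OF dq h] X_cmult[OF dq])
    also have "\<dots> = (\<Sum>k\<in>UNIV. P k x' * Y x' $ j $ k)"
      by (simp add: X_quadr P_def sum_distrib_left sum.distrib[symmetric] algebra_simps)
    finally show "X j \<psi> x' = (\<Sum>k\<in>UNIV. P k x' * Y x' $ j $ k)" .
  qed
  have d\<Psi>: "(\<lambda>x. \<Psi> x $ k - c $ k) differentiable (at x)" for k x
    by (intro differentiable_diff differentiable_const differentiable_\<Psi>)
  have CP: "Ck_on 1 UNIV (P k)" for k
    unfolding P_def[abs_def] by (intro Ck_on_add Ck_on_mult Ck_on_diff Ck_quadr Ck_on_const Ck_\<Psi>)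
  have dP: "P k differentiable (at x)" for k
    using Ck_on_imp_differentiable[OF CP] by simp
  \<comment> \<open>The Hessian in the coordinates \<open>\<Psi>\<close> at \<open>x\<close>. The
    rank-one part comes from differentiating the factor
    \<open>b1 + 2 * b2 * (quadr c x' - quadr c x)\<close>.\<close>
  define M :: "real^'n^'n" where "M = (\<chi> k l. 8 * b2 * y $ k * y $ l + (if k = l then 2 * (b1 + K) else 0))"
  have XP: "X i (P k) x = (\<Sum>l\<in>UNIV. M $ k $ l * Y x $ i $ l)" for i k
  proof -
    have X\<Psi>: "X i (\<lambda>x. 2 * (\<Psi> x $ k - c $ k)) x = 2 * Y x $ i $ k" for c
      using X_add[OF differentiable_mult[OF differentiable_const[of 2] differentiable_\<Psi>[of k x]] differentiable_const[of "- 2 * c $ k"], of i]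
        X_cmult[OF differentiable_\<Psi>[of k x], of i 2] by (simp add: Y_def algebra_simps)
    then have X\<Psi>': "X i (\<lambda>x. 2 * \<Psi> x $ k - 2 * c $ k) x = 2 * Y x $ i $ k" for c
      by (simp add: right_diff_distrib)
    have 1: "X i (\<lambda>x'. b1 + 2 * b2 * (?q x' - ?s)) x = 2 * b2 * X i ?q x"
      by (rule X_compose[OF dq]) (auto intro!: derivative_eq_intros)
    have 2: "X i (\<lambda>x'. K * (2 * \<Psi> x' $ k)) x = K * (2 * Y x $ i $ k)"
      using X\<Psi>[of 0] X_cmult[of "\<lambda>x'. 2 * \<Psi> x' $ k" x i K] by (simp add: differentiable_mult differentiable_\<Psi>)
    have "X i (P k) x = b1 * (2 * Y x $ i $ k) + 2 * y $ k * (2 * b2 * X i ?q x) + K * (2 * Y x $ i $ k)"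
      unfolding P_def[abs_def]
      by (subst X_add, (intro differentiable_add differentiable_mult differentiable_diff differentiable_const dq differentiable_\<Psi>)+)
         (subst X_mult, (intro differentiable_add differentiable_mult differentiable_diff differentiable_const dq differentiable_\<Psi>)+,
          simp add: 1 2 X\<Psi>' y_def)
    also have "\<dots> = (\<Sum>l\<in>UNIV. 8 * b2 * y $ k * y $ l * Y x $ i $ l) + 2 * (b1 + K) * Y x $ i $ k"
      by (simp add: X_quadr y_def sum_distrib_left algebra_simps)
    also have "\<dots> = (\<Sum>l\<in>UNIV. M $ k $ l * Y x $ i $ l)"
      by (simp add: M_def distrib_right sum.distrib if_distrib[of "\<lambda>z. z * _"] cong: if_cong)
    finally show ?thesis .
  qed
  have grd: "(\<chi> k. P k x) = grd"
    by (simp add: grd_def P_def y_def vec_eq_iff)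
  have M: "v \<bullet> (M *v v) = 8 * b2 * (y \<bullet> v)\<^sup>2 + 2 * (b1 + K) * (norm v)\<^sup>2"
  proof -
    have "(M *v v) $ k = 8 * b2 * y $ k * (y \<bullet> v) + 2 * (b1 + K) * v $ k" for k
    proof -
      have "(M *v v) $ k = (\<Sum>l\<in>UNIV. 8 * b2 * y $ k * (y $ l * v $ l) + (if l = k then 2 * (b1 + K) * v $ l else 0))"
        unfolding matrix_vector_mult_def by (simp add: M_def) (intro sum.cong refl, simp add: algebra_simps)
      also have "\<dots> = 8 * b2 * y $ k * (y \<bullet> v) + 2 * (b1 + K) * v $ k"
        by (simp add: sum.distrib inner_vec_def sum_distrib_left)
      finally show ?thesis .
    qed
    then have "M *v v = (8 * b2 * (y \<bullet> v)) *\<^sub>R y + (2 * (b1 + K)) *\<^sub>R v"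
      by (simp add: vec_eq_iff mult_ac)
    then show ?thesis
      by (simp add: inner_add_right power2_norm_eq_inner inner_commute[of v y]) (simp add: power2_eq_square)
  qed
  note ch = inf_laplacian_chain[OF X\<psi> dP XP, unfolded grd]
  show "frame_grad A \<psi> x = Y x *v grd" by (rule ch)
  show "inf_laplacian A \<psi> x = 8 * b2 * (y \<bullet> v)\<^sup>2 + 2 * (b1 + K) * (norm v)\<^sup>2
      + (\<Sum>i\<in>UNIV. (Y x *v grd) $ i * (\<Sum>k\<in>UNIV. \<Sum>n\<in>UNIV. grd $ k * grd $ n * X i (\<lambda>x. gram \<Psi> x $ k $ n) x)) / 2"
    using ch(2) M by (simp add: v_def)
qed

end

section \<open>Touching by functions of the distance\<close>

text \<open>The extra square \<open>(s - s0)\<^sup>2\<close> absorbs the Taylor remainder, so no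
  third derivative is required. It reappears as the error \<open>8 * \<sigma>\<^sup>2\<close> in
  \<open>cone_touching_step\<close>.\<close>

lemma second_order_upper_bound:
  fixes f :: "real \<Rightarrow> real"
  assumes f: "\<forall>\<^sub>F s in nhds s0. (f has_real_derivative f' s) (at s)" and f': "(f' has_real_derivative f2) (at s0)"
  shows "\<forall>\<^sub>F s in nhds s0. f s \<le> f s0 + f' s0 * (s - s0) + (f2 / 2 + 1) * (s - s0)\<^sup>2"
proof -
  have "\<exists>\<delta>>0. \<forall>s. norm (s - s0) < \<delta> \<longrightarrow> norm (f' s - f' s0 - f2 * (s - s0)) \<le> 1 * norm (s - s0)"
    using f' zero_less_one unfolding has_field_derivative_def has_derivative_at_alt by blast
  then obtain \<delta>1 where \<delta>1: "\<delta>1 > 0" "\<And>s. \<bar>s - s0\<bar> < \<delta>1 \<Longrightarrow> \<bar>f' s - f' s0 - f2 * (s - s0)\<bar> \<le> \<bar>s - s0\<bar>"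
    by auto
  obtain \<delta>2 where \<delta>2: "\<delta>2 > 0" "\<And>s. \<bar>s - s0\<bar> < \<delta>2 \<Longrightarrow> (f has_real_derivative f' s) (at s)"
    using f unfolding eventually_nhds_metric dist_real_def by blast
  define k where "k s = f s - f' s0 * (s - s0) - (f2 / 2 + 1) * (s - s0)\<^sup>2" for s
  have k: "(k has_real_derivative f' s - f' s0 - (f2 + 2) * (s - s0)) (at s)" if "\<bar>s - s0\<bar> < \<delta>2" for s
    unfolding k_def[abs_def] by (auto intro!: derivative_eq_intros \<delta>2(2)[OF that] simp: field_simps)
  have "f s \<le> f s0 + f' s0 * (s - s0) + (f2 / 2 + 1) * (s - s0)\<^sup>2" if s: "\<bar>s - s0\<bar> < min \<delta>1 \<delta>2" for s
  proof -
    have "k s \<le> k s0"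
    proof (cases "s0 \<le> s")
      case True
      show ?thesis
      proof (rule DERIV_nonpos_imp_nonincreasing[OF True])
        fix x assume x: "s0 \<le> x" "x \<le> s"
        then show "\<exists>y. (k has_real_derivative y) (at x) \<and> y \<le> 0"
          using k[of x] \<delta>1(2)[of x] s by (intro exI[of _ "f' x - f' s0 - (f2 + 2) * (x - s0)"] conjI) (auto simp: algebra_simps abs_le_iff)
      qed
    next
      case False
      then have "s \<le> s0" by simp
      then show ?thesis
      proof (rule DERIV_nonneg_imp_nondecreasing)
        fix x assume x: "s \<le> x" "x \<le> s0"
        then show "\<exists>y. (k has_real_derivative y) (at x) \<and> 0 \<le> y"
          using k[of x] \<delta>1(2)[of x] s by (intro exI[of _ "f' x - f' s0 - (f2 + 2) * (x - s0)"] conjI) (auto simp: algebra_simps abs_le_iff)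
      qed
    qed
    then show ?thesis by (simp add: k_def)
  qed
  then show ?thesis
    unfolding eventually_nhds_metric dist_real_def using \<delta>1(1) \<delta>2(1) by (metis min_less_iff_conj)
qed

text \<open>The error terms of the \<infinity>-Laplacian of the test function: \<open>gd\<close> is
  its coordinate gradient, with radial part \<open>f1 *\<^sub>R e\<close> and penalty part
  \<open>(2 * K) *\<^sub>R w\<close>, \<open>v\<close> is the Gram matrix applied to
  \<open>gd\<close>, and \<open>D\<close> the frame gradient. \<open>B1\<close> bounds
  \<open>norm gd\<close> and \<open>\<epsilon> * \<sigma> * E\<close> bounds
  \<open>norm (v - f1 *\<^sub>R e)\<close>; \<open>C\<close> is the sum of all constants that
  arise.\<close>

lemma test_quadratic_bound:
  fixes e w v gd D :: "real^'n::finite" and S :: "'n \<Rightarrow> 'n \<Rightarrow> 'n \<Rightarrow> real"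
  assumes e: "norm e = 1" and gd: "gd = f1 *\<^sub>R e + (2 * K) *\<^sub>R w" and w: "norm w \<le> \<sigma>"
    and v: "norm (v - gd) \<le> 4 * \<epsilon> * \<sigma> * norm gd" and f1: "0 < f1" "f1 \<le> B"
    and \<epsilon>: "0 < \<epsilon>" "\<epsilon> \<le> 1" and \<sigma>: "0 < \<sigma>" "\<sigma> \<le> 1" and K: "0 \<le> K" "K \<le> k0 * \<epsilon>"
    and D: "D \<bullet> D = gd \<bullet> v" and S: "\<And>i k l. \<bar>S i k l\<bar> \<le> \<epsilon>"
    and C: "C = B * E + 10 * k0 * B1 + E + 2 * real CARD('n) ^ 3 * B1 ^ 3 + 50 * k0 * B1\<^sup>2 + B * E\<^sup>2"
    and BE: "B1 = B + 2 * k0" "E = 4 * B1 + 2 * k0"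
  shows "\<bar>e \<bullet> v - f1\<bar> \<le> C * \<epsilon>" and "\<bar>(norm D)\<^sup>2 - f1\<^sup>2\<bar> \<le> C * \<epsilon>"
    and "(f1 / \<sigma>) * ((norm v)\<^sup>2 - (e \<bullet> v)\<^sup>2) + 2 * K * (norm v)\<^sup>2
      + (\<Sum>i\<in>UNIV. D $ i * (\<Sum>k\<in>UNIV. \<Sum>l\<in>UNIV. gd $ k * gd $ l * S i k l)) / 2 \<le> C * \<epsilon>"
proof -
  have k0: "0 \<le> k0" using K \<epsilon> by (meson order_trans zero_le_mult_iff not_le)
  have "k0 * \<epsilon> \<le> k0 * 1" using k0 \<epsilon> by (intro mult_left_mono) auto
  then have Kk0: "K \<le> k0" using K by simp
  have B: "0 < B" using f1 by linarith
  have B1: "0 < B1" and E: "0 < E" using BE B k0 by auto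
  have gdB: "norm gd \<le> B1"
  proof -
    have "norm gd \<le> norm (f1 *\<^sub>R e) + norm ((2 * K) *\<^sub>R w)" unfolding gd by (rule norm_triangle_ineq)
    also have "\<dots> = f1 + 2 * K * norm w" using e f1 K by simp
    also have "\<dots> \<le> B + 2 * k0 * 1"
      using f1 K Kk0 w \<sigma> k0 by (intro add_mono mult_mono) auto
    finally show ?thesis using BE by simp
  qed
  have v1: "norm (v - gd) \<le> 4 * \<epsilon> * \<sigma> * B1"
    using order_trans[OF v mult_left_mono[OF gdB, of "4 * \<epsilon> * \<sigma>"]] \<epsilon> \<sigma> by simp
  have "4 * \<epsilon> * \<sigma> * B1 \<le> 4 * 1 * 1 * B1"
    using \<epsilon> \<sigma> B1 by (intro mult_mono mult_nonneg_nonneg) auto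
  then have vB: "norm v \<le> 5 * B1"
    using norm_triangle_ineq[of "v - gd" gd] v1 gdB by simp
  have \<delta>: "norm (v - f1 *\<^sub>R e) \<le> \<epsilon> * \<sigma> * E"
  proof -
    have "v - f1 *\<^sub>R e = (v - gd) + (2 * K) *\<^sub>R w" by (simp add: gd)
    then have "norm (v - f1 *\<^sub>R e) \<le> norm (v - gd) + norm ((2 * K) *\<^sub>R w)" by (metis norm_triangle_ineq)
    also have "\<dots> \<le> 4 * \<epsilon> * \<sigma> * B1 + 2 * (k0 * \<epsilon>) * \<sigma>"
    proof -
      have "2 * K * norm w \<le> 2 * (k0 * \<epsilon>) * \<sigma>" using K w by (intro mult_mono) auto
      then show ?thesis using v1 K by simp
    qed
    finally show ?thesis using BE by (simp add: algebra_simps)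
  qed
  have \<epsilon>\<sigma>: "\<epsilon> * \<sigma> \<le> \<epsilon>" using \<epsilon> \<sigma> by (simp add: mult_left_le)
  have \<delta>': "norm (v - f1 *\<^sub>R e) \<le> \<epsilon> * E"
    using \<delta> mult_right_mono[OF \<epsilon>\<sigma>, of E] E by simp
  have ee: "e \<bullet> e = 1" using e by (simp add: dot_square_norm)
  have ev: "e \<bullet> v - f1 = e \<bullet> (v - f1 *\<^sub>R e)"
    using ee by (simp add: inner_diff_right)
  have le1: "\<bar>e \<bullet> v - f1\<bar> \<le> norm (v - f1 *\<^sub>R e)"
    unfolding ev using Cauchy_Schwarz_ineq2[of e "v - f1 *\<^sub>R e"] e by simp
  have pos: "0 \<le> B * E" "0 \<le> 10 * k0 * B1" "0 \<le> E" "0 \<le> 2 * real CARD('n) ^ 3 * B1 ^ 3" "0 \<le> 50 * k0 * B1\<^sup>2" "0 \<le> B * E\<^sup>2"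
    using B E B1 k0 by auto
  have Cle: "x * \<epsilon> \<le> C * \<epsilon>" if "x \<le> C" for x using that \<epsilon> by (simp add: mult_right_mono)
  show "\<bar>e \<bullet> v - f1\<bar> \<le> C * \<epsilon>"
    using le1 \<delta>' Cle[of E] C pos by (simp add: mult.commute)
  have gv: "gd \<bullet> v - f1\<^sup>2 = f1 * (e \<bullet> v - f1) + 2 * K * (w \<bullet> v)"
    by (simp add: gd inner_add_left power2_eq_square algebra_simps)
  have "\<bar>gd \<bullet> v - f1\<^sup>2\<bar> \<le> B * (\<epsilon> * E) + 2 * (k0 * \<epsilon>) * (1 * (5 * B1))"
  proof -
    have "\<bar>f1 * (e \<bullet> v - f1)\<bar> \<le> B * (\<epsilon> * E)"
      using f1 le1 \<delta>' by (auto simp: abs_mult intro!: mult_mono)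
    moreover have "\<bar>w \<bullet> v\<bar> \<le> 1 * (5 * B1)"
      using Cauchy_Schwarz_ineq2[of w v] mult_mono[of "norm w" 1 "norm v" "5 * B1"] w \<sigma> vB by simp
    then have "\<bar>2 * K * (w \<bullet> v)\<bar> \<le> 2 * (k0 * \<epsilon>) * (1 * (5 * B1))"
      using K unfolding abs_mult by (intro mult_mono) auto
    ultimately show ?thesis unfolding gv by linarith
  qed
  also have "\<dots> = (B * E + 10 * k0 * B1) * \<epsilon>" by (simp add: algebra_simps)
  also have "\<dots> \<le> C * \<epsilon>" using C pos by (intro Cle) auto
  finally show "\<bar>(norm D)\<^sup>2 - f1\<^sup>2\<bar> \<le> C * \<epsilon>" using D by (simp add: power2_norm_eq_inner)
  have 1: "(f1 / \<sigma>) * ((norm v)\<^sup>2 - (e \<bullet> v)\<^sup>2) \<le> B * E\<^sup>2 * \<epsilon>"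
  proof -
    \<comment> \<open>The left side is the squared distance of \<open>v\<close> from the line
      spanned by \<open>e\<close>. Its bound \<open>(\<epsilon> * \<sigma> * E)\<^sup>2\<close>
      compensates the factor 1/\<sigma> of the tangential second derivatives.\<close>
    have "(norm v)\<^sup>2 - (e \<bullet> v)\<^sup>2 \<le> (norm (v - f1 *\<^sub>R e))\<^sup>2"
    proof -
      have "(norm (v - f1 *\<^sub>R e))\<^sup>2 = (norm v)\<^sup>2 - 2 * f1 * (e \<bullet> v) + f1\<^sup>2"
        using ee by (simp add: power2_norm_eq_inner inner_diff_left inner_diff_right inner_commute[of v e])
           (simp add: power2_eq_square algebra_simps)
      then show ?thesis using zero_le_power2[of "e \<bullet> v - f1"] by (simp add: power2_diff mult_ac)
    qed
    also have "\<dots> \<le> (\<epsilon> * \<sigma> * E)\<^sup>2" using \<delta> by (intro power_mono) auto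
    finally have "(f1 / \<sigma>) * ((norm v)\<^sup>2 - (e \<bullet> v)\<^sup>2) \<le> (f1 / \<sigma>) * (\<epsilon> * \<sigma> * E)\<^sup>2"
      by (rule mult_left_mono) (use f1 \<sigma> in simp)
    also have "\<dots> \<le> (B / \<sigma>) * (\<epsilon> * \<sigma> * E)\<^sup>2"
      using f1 \<sigma> by (intro mult_right_mono divide_right_mono) auto
    also have "\<dots> = B * E\<^sup>2 * \<epsilon> * (\<epsilon> * \<sigma>)" using \<sigma> by (simp add: power2_eq_square)
    also have "\<dots> \<le> B * E\<^sup>2 * \<epsilon> * 1" using B \<epsilon> \<sigma> by (intro mult_left_mono) (auto simp: mult_le_one)
    finally show ?thesis by simp
  qed
  have 2: "2 * K * (norm v)\<^sup>2 \<le> 50 * k0 * B1\<^sup>2 * \<epsilon>"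
  proof -
    have "2 * K * (norm v)\<^sup>2 \<le> 2 * (k0 * \<epsilon>) * (5 * B1)\<^sup>2"
      using K vB by (intro mult_mono power_mono) auto
    then show ?thesis by (simp add: power_mult_distrib mult_ac)
  qed
  have 3: "(\<Sum>i\<in>UNIV. D $ i * (\<Sum>k\<in>UNIV. \<Sum>l\<in>UNIV. gd $ k * gd $ l * S i k l)) / 2 \<le> 2 * real CARD('n) ^ 3 * B1 ^ 3 * \<epsilon>"
  proof -
    have "(norm D)\<^sup>2 \<le> norm gd * norm v" using D norm_cauchy_schwarz[of gd v] by (simp add: power2_norm_eq_inner)
    also have "\<dots> \<le> B1 * (5 * B1)" using gdB vB B1 by (intro mult_mono) auto
    also have "\<dots> \<le> (3 * B1)\<^sup>2" by (simp add: power2_eq_square)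
    finally have DB: "norm D \<le> 3 * B1" by (rule power2_le_imp_le) (use B1 in simp)
    have comp: "\<bar>gd $ k\<bar> \<le> B1" for k using component_le_norm_cart[of gd k] gdB by linarith
    have compD: "\<bar>D $ k\<bar> \<le> 3 * B1" for k using component_le_norm_cart[of D k] DB by linarith
    have "\<bar>D $ i * (\<Sum>k\<in>UNIV. \<Sum>l\<in>UNIV. gd $ k * gd $ l * S i k l)\<bar> \<le> (3 * B1) * (\<Sum>k\<in>(UNIV::'n set). \<Sum>l\<in>(UNIV::'n set). B1 * B1 * \<epsilon>)" for i
    proof -
      have "\<bar>\<Sum>k\<in>UNIV. \<Sum>l\<in>UNIV. gd $ k * gd $ l * S i k l\<bar> \<le> (\<Sum>k\<in>(UNIV::'n set). \<Sum>l\<in>(UNIV::'n set). B1 * B1 * \<epsilon>)"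
      proof (intro order_trans[OF sum_abs] sum_mono)
        fix k l
        show "\<bar>gd $ k * gd $ l * S i k l\<bar> \<le> B1 * B1 * \<epsilon>"
          unfolding abs_mult using comp S B1 by (intro mult_mono) auto
      qed
      then show ?thesis unfolding abs_mult using compD[of i] B1 by (intro mult_mono) auto
    qed
    then have "(\<Sum>i\<in>UNIV. D $ i * (\<Sum>k\<in>UNIV. \<Sum>l\<in>UNIV. gd $ k * gd $ l * S i k l))
      \<le> (\<Sum>i\<in>(UNIV::'n set). (3 * B1) * (\<Sum>k\<in>(UNIV::'n set). \<Sum>l\<in>(UNIV::'n set). B1 * B1 * \<epsilon>))"
      by (intro sum_mono) (meson abs_le_D1)
    also have "\<dots> = 3 * real CARD('n) ^ 3 * B1 ^ 3 * \<epsilon>" by (simp add: power3_eq_cube)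
    also have "\<dots> \<le> 4 * real CARD('n) ^ 3 * B1 ^ 3 * \<epsilon>" using B1 \<epsilon> by (intro mult_right_mono) auto
    finally show ?thesis by simp
  qed
  have "(f1 / \<sigma>) * ((norm v)\<^sup>2 - (e \<bullet> v)\<^sup>2) + 2 * K * (norm v)\<^sup>2
      + (\<Sum>i\<in>UNIV. D $ i * (\<Sum>k\<in>UNIV. \<Sum>l\<in>UNIV. gd $ k * gd $ l * S i k l)) / 2
      \<le> (B * E\<^sup>2 + 50 * k0 * B1\<^sup>2 + 2 * real CARD('n) ^ 3 * B1 ^ 3) * \<epsilon>"
    using 1 2 3 by (simp add: algebra_simps)
  also have "\<dots> \<le> C * \<epsilon>" using C pos by (intro Cle) auto
  finally show "(f1 / \<sigma>) * ((norm v)\<^sup>2 - (e \<bullet> v)\<^sup>2) + 2 * K * (norm v)\<^sup>2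
      + (\<Sum>i\<in>UNIV. D $ i * (\<Sum>k\<in>UNIV. \<Sum>l\<in>UNIV. gd $ k * gd $ l * S i k l)) / 2 \<le> C * \<epsilon>" .
qed

lemma isCont_tendsto_nhds: "isCont f a \<Longrightarrow> (f \<longlongrightarrow> f a) (nhds a)"
  by (simp only: isCont_def tendsto_at_iff_tendsto_nhds)

context normal_coords
begin

text \<open>The differential inequality for \<open>\<phi>\<close> at \<open>T\<close> up to an error
  \<open>C * \<epsilon>\<close>, with \<open>C\<close> depending only on \<open>B\<close> and the
  dimension. In \<open>k0 = 113 * B\<close> one has 113 = 7 * 16 + 1. The number 7 is 4 + 3:
  \<open>T'\<close> carries an excess \<open>4 * (\<epsilon> * r\<^sup>2)\<close>, and
  \<open>norm c\<close> exceeds \<open>r\<close> by at most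
  \<open>3 * (\<epsilon> * r\<^sup>2)\<close>. The factor 16 comes from the radius
  \<open>r / 4\<close> of the ball carrying the penalty.\<close>

lemma cone_touching_step:
  fixes \<phi> \<phi>' \<phi>'' :: "real \<Rightarrow> real" and h :: "real \<Rightarrow> real"
  assumes \<Omega>: "open \<Omega>" "p \<in> \<Omega>" and u: "continuous_on \<Omega> u"
    and sub: "\<And>x0 \<psi>. x0 \<in> \<Omega> \<Longrightarrow> Ck_on 2 UNIV \<psi> \<Longrightarrow> \<psi> x0 = u x0 \<Longrightarrow> \<forall>\<^sub>F y in nhds x0. u y \<le> \<psi> y \<Longrightarrow>
      - h (norm (frame_grad A \<psi> x0)) \<le> inf_laplacian A \<psi> x0"
    and T: "T = d y p" "0 < T" and \<tau>: "0 < \<tau>" "\<tau> \<le> T"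
    and \<phi>: "\<And>t. \<bar>t - T\<bar> < \<tau> \<Longrightarrow> (\<phi> has_real_derivative \<phi>' t) (at t)"
    and \<phi>': "\<And>t. \<bar>t - T\<bar> < \<tau> \<Longrightarrow> (\<phi>' has_real_derivative \<phi>'' t) (at t)"
    and pos: "\<And>t. \<bar>t - T\<bar> < \<tau> \<Longrightarrow> 0 < \<phi>' t \<and> \<phi>' t \<le> B"
    and max: "\<forall>\<^sub>F x in nhds p. u x - \<phi> (d y x) \<le> u p - \<phi> T"
    and BE: "k0 = 113 * B" "B1 = B + 2 * k0" "E = 4 * B1 + 2 * k0"
    and C: "C = B * E + 10 * k0 * B1 + E + 2 * real CARD('n) ^ 3 * B1 ^ 3 + 50 * k0 * B1\<^sup>2 + B * E\<^sup>2"
    and \<epsilon>: "0 < \<epsilon>" "\<epsilon> \<le> 1"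
  obtains t \<sigma> a N where "\<bar>t - T\<bar> \<le> \<epsilon>" "\<bar>t - T\<bar> < \<tau>" "0 < \<sigma>" "\<sigma> \<le> \<epsilon>" "\<bar>a\<bar> \<le> C * \<epsilon>" "0 \<le> N" "\<bar>N\<^sup>2 - (\<phi>' t)\<^sup>2\<bar> \<le> C * \<epsilon>"
    "- h N \<le> (\<phi>'' t + 8 * \<sigma>\<^sup>2) * (\<phi>' t + a)\<^sup>2 + C * \<epsilon>"
proof -
  have B: "0 < B" using pos[of T] \<tau> by auto
  obtain U V \<Theta> where UV: "open U" "p \<in> U" "open V" "0 \<in> V" and hom: "homeomorphism U V \<Psi> \<Theta>"
    and est: "\<forall>\<epsilon>>0. \<exists>r0>0. \<forall>r. 0 < r \<and> r < r0 \<longrightarrow> almost_flat U V \<Theta> \<epsilon> r"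
    by (rule local_estimates) (rule that)
  have \<Theta>\<Psi>: "\<Theta> (\<Psi> x) = x" if "x \<in> U" for x using hom that by (simp add: homeomorphism_def)
  have \<Psi>\<Theta>: "\<Psi> (\<Theta> w) = w" if "w \<in> V" for w using hom that by (simp add: homeomorphism_def)
  have \<Theta>U: "\<Theta> w \<in> U" if "w \<in> V" for w using hom that by (auto simp: homeomorphism_def)
  have \<Theta>0: "\<Theta> 0 = p" using \<Theta>\<Psi>[OF UV(2)] by (simp add: \<Psi>_p)
  have c\<Theta>: "continuous_on V \<Theta>" using hom by (simp add: homeomorphism_def)
  have "\<forall>\<^sub>F x in nhds p. x \<in> \<Omega> \<and> u x - \<phi> (d y x) \<le> u p - \<phi> T"
    using max \<Omega> by (intro eventually_conj) (auto simp: eventually_nhds_in_open)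
  moreover have "(\<Theta> \<longlongrightarrow> p) (nhds 0)"
    using c\<Theta> UV(3,4) \<Theta>0 continuous_on_eq_continuous_at[of V \<Theta>]
    by (metis isCont_def tendsto_at_iff_tendsto_nhds)
  ultimately have "\<forall>\<^sub>F w in nhds 0. \<Theta> w \<in> \<Omega> \<and> u (\<Theta> w) - \<phi> (d y (\<Theta> w)) \<le> u p - \<phi> T"
    by (rule eventually_compose_filterlim)
  then obtain \<rho> where \<rho>: "\<rho> > 0" "\<And>w. norm w < \<rho> \<Longrightarrow> \<Theta> w \<in> \<Omega> \<and> u (\<Theta> w) - \<phi> (d y (\<Theta> w)) \<le> u p - \<phi> T"
    unfolding eventually_nhds_metric by (auto simp: dist_norm)
  obtain r0 where r0: "r0 > 0" and r0': "\<forall>r. 0 < r \<and> r < r0 \<longrightarrow> almost_flat U V \<Theta> \<epsilon> r"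
    by (rule exE[OF mp[OF spec[OF est] \<epsilon>(1)]], elim conjE) (rule that)
  \<comment> \<open>All radii that occur differ from \<open>T\<close> by at most
    \<open>4 * r\<close>, so the last two bounds keep them within \<open>\<epsilon>\<close> of
    \<open>T\<close> and inside the interval where \<open>\<phi>\<close> is controlled.\<close>
  define r where "r = min (min (r0 / 2) \<rho>) (min (\<epsilon> / 16) (\<tau> / 16))"
  have r: "0 < r" "r < r0" "r \<le> \<rho>" "r \<le> \<epsilon> / 16" "r \<le> \<tau> / 16"
    using r0 \<rho> \<epsilon> \<tau> by (auto simp: r_def)
  have r1: "r \<le> 1 / 16" using r \<epsilon> by linarith
  have rT: "r \<le> T" using r \<tau> by linarith
  have \<epsilon>r: "\<epsilon> * r \<le> 1/16" "0 < \<epsilon> * r" using \<epsilon> r r1 mult_mono[of \<epsilon> 1 r "1/16"] by auto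
  have \<epsilon>r2: "\<epsilon> * r\<^sup>2 \<le> r / 16" "0 < \<epsilon> * r\<^sup>2"
    using mult_right_mono[OF \<epsilon>r(1), of r] r \<epsilon> by (auto simp: power2_eq_square mult_ac)
  note est_r = mp[OF spec[OF r0'] conjI[OF r(1,2)], unfolded almost_flat_def]
  note V = est_r[THEN conjunct1]
    and up = est_r[THEN conjunct2, THEN conjunct1, rule_format]
    and lo = est_r[THEN conjunct2, THEN conjunct2, THEN conjunct1, rule_format]
    and gX = est_r[THEN conjunct2, THEN conjunct2, THEN conjunct2, THEN bspec]
  note gr = gX[THEN conjunct1, rule_format] and Xgr = gX[THEN conjunct2, rule_format]
  obtain z where z: "d y z \<le> T - r" "d z p \<le> r + \<epsilon> * r\<^sup>2"
    using riem_dist_intermediate[of r y p "\<epsilon> * r\<^sup>2"] rT r \<epsilon>r2 T by auto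
  have zp: "r \<le> d z p" using riem_dist_triangle[of y p z] z T by linarith
  define c where "c = \<Psi> z"
  have zU: "z \<in> U" and c1: "norm c \<le> (1 + \<epsilon> * r) * (r + \<epsilon> * r\<^sup>2)"
  proof -
    have le: "d p z \<le> 2 * r" using z riem_dist_sym[of z p] \<epsilon>r2 r by linarith
    show "z \<in> U" using lo[OF le] by blast
    have "(1 + \<epsilon> * r) * d p z \<le> (1 + \<epsilon> * r) * (r + \<epsilon> * r\<^sup>2)"
      using z riem_dist_sym[of z p] \<epsilon>r by (intro mult_left_mono) auto
    then show "norm c \<le> (1 + \<epsilon> * r) * (r + \<epsilon> * r\<^sup>2)" using lo[OF le] by (simp add: c_def)
  qed
  have "(1 + \<epsilon> * r) * (r + \<epsilon> * r\<^sup>2) = r + 2 * (\<epsilon> * r\<^sup>2) + (\<epsilon> * r) * (\<epsilon> * r\<^sup>2)"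
    by (simp add: power2_eq_square algebra_simps)
  also have "\<dots> \<le> r + 2 * (\<epsilon> * r\<^sup>2) + 1 * (\<epsilon> * r\<^sup>2)"
    using \<epsilon>r \<epsilon>r2 by (intro add_left_mono mult_right_mono) auto
  finally have c2: "norm c \<le> r + 3 * (\<epsilon> * r\<^sup>2)" using c1 by linarith
  have c4: "c \<in> cball 0 (4 * r)" using c2 \<epsilon>r2 r by simp
  have \<Theta>c: "\<Theta> c = z" using \<Theta>\<Psi>[OF zU] by (simp add: c_def)
  \<comment> \<open>This keeps \<open>c\<close> away from the ball of radius \<open>r / 4\<close>,
    so that \<open>w \<mapsto> norm (w - c)\<close> is smooth there and the square root is only
    differentiated away from 0.\<close>
  have c3: "r / 2 \<le> norm c"
  proof -
    have "r \<le> (1 + \<epsilon> * r) * norm c"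
      using up[OF c4, of 0] zp \<Theta>c \<Theta>0 r by simp
    also have "\<dots> \<le> 2 * norm c" using \<epsilon>r by (intro mult_right_mono) auto
    finally show ?thesis by simp
  qed
  \<comment> \<open>Three of the four multiples of \<open>\<epsilon> * r\<^sup>2\<close> pay for the
    factor \<open>1 + \<epsilon> * r\<close> at distances up to \<open>3 * r\<close> from
    \<open>c\<close>. Hence \<open>d y (\<Theta> w) \<le> T' + norm (w - c)\<close>.\<close>
  define T' where "T' = T - r + 4 * (\<epsilon> * r\<^sup>2)"
  have wc: "r / 4 \<le> norm (w - c)" "norm (w - c) \<le> 3 * r" if "norm w \<le> r / 4" for w
  proof -
    show "r / 4 \<le> norm (w - c)" using norm_triangle_ineq2[of c w] norm_minus_commute[of w c] c3 that by linarith
    show "norm (w - c) \<le> 3 * r" using norm_triangle_ineq4[of w c] c2 that \<epsilon>r2 r by linarith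
  qed
  have inT: "\<bar>T' + norm (w - c) - T\<bar> \<le> 4 * r" if "norm w \<le> r / 4" for w
    using wc[OF that] \<epsilon>r2 r unfolding T'_def abs_le_iff by (intro conjI; linarith)
  have inT\<tau>: "\<bar>T' + norm (w - c) - T\<bar> < \<tau>" if "norm w \<le> r / 4" for w
    using inT[OF that] r by linarith
  have mono: "\<phi> a \<le> \<phi> b" if ab: "a \<le> b" "\<bar>a - T\<bar> < \<tau>" "\<bar>b - T\<bar> < \<tau>" for a b
  proof (rule DERIV_nonneg_imp_nondecreasing[OF ab(1)])
    fix x assume "a \<le> x" "x \<le> b"
    then have "\<bar>x - T\<bar> < \<tau>" using ab by (auto simp: abs_less_iff)
    then show "\<exists>y. (\<phi> has_real_derivative y) (at x) \<and> 0 \<le> y" using \<phi> pos by (meson less_imp_le)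
  qed
  have lip: "\<phi> b \<le> \<phi> a + B * (b - a)" if ab: "a \<le> b" "\<bar>a - T\<bar> < \<tau>" "\<bar>b - T\<bar> < \<tau>" for a b
  proof -
    have "\<phi> b - B * b \<le> \<phi> a - B * a"
    proof (rule DERIV_nonpos_imp_nonincreasing[OF ab(1)])
      fix x assume "a \<le> x" "x \<le> b"
      then have x: "\<bar>x - T\<bar> < \<tau>" using ab by (auto simp: abs_less_iff)
      have "((\<lambda>x. \<phi> x - B * x) has_real_derivative \<phi>' x - B) (at x)"
        by (auto intro!: derivative_eq_intros \<phi>[OF x])
      then show "\<exists>y. ((\<lambda>x. \<phi> x - B * x) has_real_derivative y) (at x) \<and> y \<le> 0" using pos[OF x] by force
    qed
    then show ?thesis by (simp add: algebra_simps)
  qed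
  have u_le: "u (\<Theta> w) \<le> u p - \<phi> T + \<phi> (T' + norm (w - c))" if w: "norm w \<le> r / 4" for w
  proof -
    have w4: "w \<in> cball 0 (4 * r)" using w r by simp
    have "d z (\<Theta> w) \<le> (1 + \<epsilon> * r) * norm (w - c)" using up[OF c4 w4] \<Theta>c by simp
    also have "\<dots> = norm (w - c) + \<epsilon> * r * norm (w - c)" by (simp add: algebra_simps)
    also have "\<epsilon> * r * norm (w - c) \<le> \<epsilon> * r * (3 * r)" using wc(2)[OF w] \<epsilon>r by (intro mult_left_mono) auto
    also have "\<dots> = 3 * (\<epsilon> * r\<^sup>2)" by (simp add: power2_eq_square)
    finally have le: "d y (\<Theta> w) \<le> T' + norm (w - c)"
      using riem_dist_triangle[of y "\<Theta> w" z] z \<epsilon>r2 by (simp add: T'_def)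
    have "d p (\<Theta> w) \<le> (1 + \<epsilon> * r) * norm w" using up[of 0 w] w4 r \<Theta>0 by simp
    also have "\<dots> \<le> 2 * norm w" using \<epsilon>r by (intro mult_right_mono) auto
    finally have "d p (\<Theta> w) \<le> r" using w r by linarith
    then have "\<bar>d y (\<Theta> w) - T\<bar> < \<tau>"
      using riem_dist_triangle[of y "\<Theta> w" p] riem_dist_triangle[of y p "\<Theta> w"] riem_dist_sym[of p "\<Theta> w"] T r
      by (auto simp: abs_less_iff)
    then have "\<phi> (d y (\<Theta> w)) \<le> \<phi> (T' + norm (w - c))" using le inT\<tau>[OF w] by (intro mono)
    then show ?thesis using \<rho>(2)[of w] w r by force
  qed
  \<comment> \<open>On \<open>norm w = r / 4\<close> the penalty \<open>K (norm w)\<^sup>2 = 113/16 B \<epsilon> r\<^sup>2\<close> exceeds the error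
    \<open>7 B \<epsilon> r\<^sup>2\<close> of the distance approximation, so the maximum below is interior.\<close>
  define K where "K = k0 * \<epsilon>"
  have K0: "0 < K" using B \<epsilon> BE by (simp add: K_def)
  define F where "F w = u (\<Theta> w) - \<phi> (T' + norm (w - c)) - K * (norm w)\<^sup>2" for w
  have sV: "cball 0 (r / 4) \<subseteq> V" using V r by (auto simp: subset_iff)
  have contF: "continuous_on (cball 0 (r / 4)) F"
  proof -
    have "continuous_on (cball 0 (r / 4)) (\<lambda>w. u (\<Theta> w))"
      by (rule continuous_on_compose2[OF u continuous_on_subset[OF c\<Theta> sV]]) (use \<rho>(2) r in force)
    moreover have "continuous_on {t. \<bar>t - T\<bar> < \<tau>} \<phi>"
      using \<phi> by (intro continuous_at_imp_continuous_on) (auto intro: DERIV_isCont)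
    then have "continuous_on (cball 0 (r / 4)) (\<lambda>w. \<phi> (T' + norm (w - c)))"
      by (rule continuous_on_compose2) (use inT\<tau> in \<open>auto intro!: continuous_intros\<close>)
    ultimately show ?thesis unfolding F_def by (intro continuous_intros)
  qed
  have "cball 0 (r / 4) \<noteq> {}" using r by simp
  from continuous_attains_sup[OF compact_cball this contF]
  obtain w2 where w2: "norm w2 \<le> r / 4" "\<And>w. norm w \<le> r / 4 \<Longrightarrow> F w \<le> F w2" by auto
  have F0: "u p - \<phi> T - 7 * B * (\<epsilon> * r\<^sup>2) \<le> F 0"
  proof -
    have T7: "\<bar>T + 7 * (\<epsilon> * r\<^sup>2) - T\<bar> < \<tau>" using \<epsilon>r2 r by linarith
    have "\<phi> (T' + norm c) \<le> \<phi> (T + 7 * (\<epsilon> * r\<^sup>2))"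
      using c2 inT\<tau>[of 0] r T7 by (intro mono) (auto simp: T'_def)
    also have "\<dots> \<le> \<phi> T + B * (T + 7 * (\<epsilon> * r\<^sup>2) - T)"
      using \<epsilon>r2 \<tau> T7 by (intro lip) auto
    finally show ?thesis by (simp add: F_def \<Theta>0)
  qed
  have w2lt: "norm w2 < r / 4"
  proof (rule ccontr)
    assume "\<not> norm w2 < r / 4"
    then have eq: "norm w2 = r / 4" using w2 by simp
    have "F w2 \<le> u p - \<phi> T - K * (r / 4)\<^sup>2" using u_le[OF w2(1)] unfolding F_def eq by linarith
    moreover have "K * (r / 4)\<^sup>2 = 113 / 16 * B * (\<epsilon> * r\<^sup>2)" by (simp add: K_def BE power2_eq_square)
    moreover have "7 * B * (\<epsilon> * r\<^sup>2) < 113 / 16 * B * (\<epsilon> * r\<^sup>2)"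
      using B \<epsilon>r2 by (intro mult_strict_right_mono) auto
    ultimately show False using F0 w2(2)[of 0] r by simp
  qed
  define x2 where "x2 = \<Theta> w2"
  have w24: "w2 \<in> cball 0 (4 * r)" using w2 r by simp
  then have w2V: "w2 \<in> V" using V by blast
  have \<Psi>x2: "\<Psi> x2 = w2" using \<Psi>\<Theta>[OF w2V] by (simp add: x2_def)
  define \<sigma> where "\<sigma> = norm (w2 - c)"
  have \<sigma>: "r / 4 \<le> \<sigma>" "\<sigma> \<le> 3 * r" using wc[OF w2(1)] by (auto simp: \<sigma>_def)
  have \<sigma>0: "0 < \<sigma>" "\<sigma> \<le> \<epsilon>" "\<sigma> \<le> 1" using \<sigma> r \<epsilon> by linarith+
  define t where "t = T' + \<sigma>"
  have t: "\<bar>t - T\<bar> \<le> \<epsilon>" "\<bar>t - T\<bar> < \<tau>" using inT[OF w2(1)] inT\<tau>[OF w2(1)] r \<epsilon> by (auto simp: t_def \<sigma>_def)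
  define s0 where "s0 = \<sigma>\<^sup>2"
  have s0: "0 < s0" "sqrt s0 = \<sigma>" using \<sigma>0 by (auto simp: s0_def)
  let ?f = "\<lambda>s. \<phi> (T' + sqrt s)"
  let ?f' = "\<lambda>s. \<phi>' (T' + sqrt s) * (inverse (sqrt s) / 2)"
  \<comment> \<open>The second derivative of \<open>\<phi> (T' + sqrt s)\<close> at
    \<open>s = \<sigma>\<^sup>2\<close>.\<close>
  define f2 where "f2 = \<phi>'' t / (4 * \<sigma>\<^sup>2) - \<phi>' t / (4 * \<sigma> ^ 3)"
  have "\<forall>\<^sub>F s in nhds s0. 0 < s \<and> \<bar>T' + sqrt s - T\<bar> < \<tau>"
  proof (rule eventually_conj)
    show "\<forall>\<^sub>F s in nhds s0. 0 < s" using s0 eventually_nhds_in_open[of "{0<..}" s0] by simp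
    have "isCont (\<lambda>s. \<bar>T' + sqrt s - T\<bar>) s0" by (intro continuous_intros) 
    then have "((\<lambda>s. \<bar>T' + sqrt s - T\<bar>) \<longlongrightarrow> \<bar>T' + sqrt s0 - T\<bar>) (nhds s0)"
      by (rule isCont_tendsto_nhds)
    then show "\<forall>\<^sub>F s in nhds s0. \<bar>T' + sqrt s - T\<bar> < \<tau>"
      by (rule order_tendstoD(2)) (use t s0 in \<open>simp add: t_def\<close>)
  qed
  then have df: "\<forall>\<^sub>F s in nhds s0. (?f has_real_derivative ?f' s) (at s)"
  proof (rule eventually_mono)
    fix s assume s: "0 < s \<and> \<bar>T' + sqrt s - T\<bar> < \<tau>"
    then have "((\<lambda>s. T' + sqrt s) has_real_derivative inverse (sqrt s) / 2) (at s)"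
      by (auto intro!: derivative_eq_intros)
    from DERIV_chain2[OF \<phi> this] s show "(?f has_real_derivative ?f' s) (at s)" by auto
  qed
  have df': "(?f' has_real_derivative f2) (at s0)"
  proof -
    have 1: "((\<lambda>s. T' + sqrt s) has_real_derivative inverse (sqrt s0) / 2) (at s0)"
      using s0 by (auto intro!: derivative_eq_intros)
    have 2: "((\<lambda>s. \<phi>' (T' + sqrt s)) has_real_derivative \<phi>'' (T' + sqrt s0) * (inverse (sqrt s0) / 2)) (at s0)"
      by (rule DERIV_chain2[OF \<phi>' 1]) (use t s0 in \<open>simp add: t_def\<close>)
    have 3: "((\<lambda>s. inverse (sqrt s) / 2) has_real_derivative - (inverse (sqrt s0) / 2) / s0 / 2) (at s0)"
      using s0 by (auto intro!: derivative_eq_intros simp: field_simps power2_eq_square)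
    have "\<phi>' (T' + sqrt s0) * (- (inverse (sqrt s0) / 2) / s0 / 2)
        + \<phi>'' (T' + sqrt s0) * (inverse (sqrt s0) / 2) * (inverse (sqrt s0) / 2) = f2"
      using \<sigma>0 unfolding s0(2) f2_def t_def s0_def by (simp add: field_simps power2_eq_square power3_eq_cube)
    then show ?thesis by (rule DERIV_cong[OF DERIV_mult'[OF 2 3]])
  qed
  define b1 where "b1 = \<phi>' t / (2 * \<sigma>)"
  define b2 where "b2 = f2 / 2 + 1"
  have f'0: "?f' s0 = b1" using s0 by (simp add: b1_def t_def field_simps)
  have taylor: "\<forall>\<^sub>F s in nhds s0. \<phi> (T' + sqrt s) \<le> \<phi> t + b1 * (s - s0) + b2 * (s - s0)\<^sup>2"
    using second_order_upper_bound[OF df df'] f'0 s0 by (simp add: t_def b2_def)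
  have q2: "quadr c x2 = s0" by (simp add: quadr_def \<Psi>x2 s0_def \<sigma>_def)
  \<comment> \<open>The second-order Taylor polynomial of \<open>\<phi> (T' + sqrt s)\<close> at \<open>s0\<close>, increased by \<open>(s - s0)\<^sup>2\<close>,
    makes the test function a polynomial in \<open>\<Psi>\<close>, hence smooth on the whole space.\<close>
  define a0 where "a0 = F w2 + \<phi> t"
  define \<psi> where "\<psi> x = a0 + b1 * (quadr c x - quadr c x2) + b2 * (quadr c x - quadr c x2)\<^sup>2 + K * quadr 0 x" for x
  have \<psi>x2: "\<psi> x2 = u x2"
    by (simp add: \<psi>_def a0_def F_def quadr_def \<Psi>x2 t_def \<sigma>_def flip: x2_def)
  have touch: "\<forall>\<^sub>F x in nhds x2. u x \<le> \<psi> x"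
  proof -
    have "\<forall>\<^sub>F x in nhds x2. x \<in> U" using UV \<Theta>U[OF w2V] by (simp add: eventually_nhds_in_open x2_def)
    moreover have "(\<Psi> \<longlongrightarrow> \<Psi> x2) (nhds x2)"
      using continuous_\<Psi>[of UNIV] by (intro isCont_tendsto_nhds) (simp add: continuous_on_eq_continuous_at)
    then have "\<forall>\<^sub>F x in nhds x2. \<Psi> x \<in> ball 0 (r / 4)"
      by (rule topological_tendstoD) (use \<Psi>x2 w2lt in auto)
    moreover have "(quadr c \<longlongrightarrow> s0) (nhds x2)"
      unfolding q2[symmetric] using Ck_on_imp_continuous[OF Ck_quadr[of 0 c]]
      by (intro isCont_tendsto_nhds) (simp add: continuous_on_eq_continuous_at)
    from eventually_compose_filterlim[OF taylor this]
    have "\<forall>\<^sub>F x in nhds x2. \<phi> (T' + sqrt (quadr c x)) \<le> \<phi> t + b1 * (quadr c x - s0) + b2 * (quadr c x - s0)\<^sup>2" .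
    ultimately show ?thesis
    proof eventually_elim
      case (elim x)
      then have "F (\<Psi> x) \<le> F w2" by (intro w2(2)) auto
      then have "u x \<le> F w2 + \<phi> (T' + sqrt (quadr c x)) + K * quadr 0 x"
        using \<Theta>\<Psi> elim by (simp add: F_def[of "\<Psi> x"] quadr_def)
      then show ?case using elim unfolding \<psi>_def a0_def q2 by linarith
    qed
  qed
  have x2\<Omega>: "x2 \<in> \<Omega>" using \<rho>(2)[of w2] w2 r by (simp add: x2_def)
  define grd where "grd = (2 * b1) *\<^sub>R (\<Psi> x2 - c) + (2 * K) *\<^sub>R \<Psi> x2"
  define v where "v = gram \<Psi> x2 *v grd"
  define D where "D = Y x2 *v grd"
  note test = inf_laplacian_test[where ?a0.0=a0 and ?b1.0=b1 and ?b2.0=b2 and K=K and c=c and x=x2, folded \<psi>_def[abs_def] grd_def, folded v_def D_def]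
  have "- h (norm (frame_grad A \<psi> x2)) \<le> inf_laplacian A \<psi> x2"
    by (intro sub x2\<Omega> \<psi>x2 touch test(1))
  then have ineq: "- h (norm D) \<le> 8 * b2 * ((\<Psi> x2 - c) \<bullet> v)\<^sup>2 + 2 * (b1 + K) * (norm v)\<^sup>2
      + (\<Sum>i\<in>UNIV. D $ i * (\<Sum>k\<in>UNIV. \<Sum>n\<in>UNIV. grd $ k * grd $ n * X i (\<lambda>x. gram \<Psi> x $ k $ n) x2)) / 2"
    unfolding test(2) test(3) .
  define e where "e = (1 / \<sigma>) *\<^sub>R (w2 - c)"
  have e: "norm e = 1" "\<Psi> x2 - c = \<sigma> *\<^sub>R e" using \<sigma>0 by (auto simp: e_def \<sigma>_def \<Psi>x2)
  have grd: "grd = \<phi>' t *\<^sub>R e + (2 * K) *\<^sub>R w2"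
    using \<sigma>0 unfolding grd_def e(2) b1_def by (simp add: \<Psi>x2)
  have w\<sigma>: "norm w2 \<le> \<sigma>" using w2 \<sigma> by linarith
  have vg: "norm (v - grd) \<le> 4 * \<epsilon> * \<sigma> * norm grd"
  proof -
    have "norm (v - grd) \<le> \<epsilon> * r * norm grd" using gr[OF w24] by (simp add: v_def x2_def)
    also have "\<dots> \<le> \<epsilon> * (4 * \<sigma>) * norm grd" using \<sigma> \<epsilon> by (intro mult_right_mono mult_left_mono) auto
    finally show ?thesis by (simp add: mult_ac)
  qed
  have DD: "D \<bullet> D = grd \<bullet> v"
    by (simp add: D_def v_def gram_mult transpose_mult_inner del: transpose_matrix_vector)
  have Kle: "K \<le> k0 * \<epsilon>" by (simp add: K_def)
  note bd = test_quadratic_bound[OF e(1) grd w\<sigma> vg _ _ \<epsilon> \<sigma>0(1,3) less_imp_le[OF K0] Kle DD _ C BE(2,3),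
      where S="\<lambda>i k n. X i (\<lambda>x. gram \<Psi> x $ k $ n) x2"]
  have bds: "\<bar>e \<bullet> v - \<phi>' t\<bar> \<le> C * \<epsilon>" "\<bar>(norm D)\<^sup>2 - (\<phi>' t)\<^sup>2\<bar> \<le> C * \<epsilon>"
    "(\<phi>' t / \<sigma>) * ((norm v)\<^sup>2 - (e \<bullet> v)\<^sup>2) + 2 * K * (norm v)\<^sup>2
      + (\<Sum>i\<in>UNIV. D $ i * (\<Sum>k\<in>UNIV. \<Sum>n\<in>UNIV. grd $ k * grd $ n * X i (\<lambda>x. gram \<Psi> x $ k $ n) x2)) / 2 \<le> C * \<epsilon>"
    using bd pos[OF t(2)] Xgr[OF w24] by (auto simp: x2_def)
  \<comment> \<open>Since \<open>4 * \<sigma>\<^sup>2 * f2 = \<phi>'' t - \<phi>' t /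
    \<sigma>\<close>, the radial direction carries \<open>\<phi>''\<close> and the orthogonal ones
    \<open>\<phi>' t / \<sigma>\<close>. The summand \<open>8 * \<sigma>\<^sup>2\<close> is the
    trace of the 1 in \<open>b2\<close>.\<close>
  have id: "8 * b2 * ((\<Psi> x2 - c) \<bullet> v)\<^sup>2 + 2 * (b1 + K) * (norm v)\<^sup>2
      = (\<phi>'' t + 8 * \<sigma>\<^sup>2) * (e \<bullet> v)\<^sup>2 + ((\<phi>' t / \<sigma>) * ((norm v)\<^sup>2 - (e \<bullet> v)\<^sup>2) + 2 * K * (norm v)\<^sup>2)"
    using \<sigma>0 unfolding e(2) by (simp add: b2_def b1_def f2_def power_mult_distrib field_simps power2_eq_square power3_eq_cube)
  have "- h (norm D) \<le> (\<phi>'' t + 8 * \<sigma>\<^sup>2) * (\<phi>' t + (e \<bullet> v - \<phi>' t))\<^sup>2 + C * \<epsilon>"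
    using ineq bds(3) unfolding id by simp
  then show ?thesis
    by (intro that[of t \<sigma> "e \<bullet> v - \<phi>' t" "norm D"] t \<sigma>0 bds) auto
qed

end

section \<open>Comparison with Hoelder barriers\<close>

text \<open>
  The inequality is \<open>\<phi>'' \<phi>'\<^sup>2 + C2 \<phi>'\<^sup>\<beta> + C3 < 0\<close> for \<open>\<phi> t = L t\<^sup>\<alpha>\<close>.
\<close>

definition holder_barrier :: "real \<Rightarrow> real \<Rightarrow> real \<Rightarrow> real \<Rightarrow> real \<Rightarrow> real \<Rightarrow> bool"
  where "holder_barrier \<alpha> \<beta> C2 C3 L t0 \<longleftrightarrow> 0 < L \<and> 0 < t0 \<and>
    (\<forall>t. 0 < t \<and> t \<le> t0 \<longrightarrow>
      (L * \<alpha> * (\<alpha> - 1) * t powr (\<alpha> - 2)) * (L * \<alpha> * t powr (\<alpha> - 1))\<^sup>2 + (C2 * rpow (L * \<alpha> * t powr (\<alpha> - 1)) \<beta> + C3) < 0)"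

text \<open>With \<open>s\<close> the derivative of the barrier at \<open>t\<close>, the first term
  is \<open>- (1 - \<alpha>) * s ^ 3 / t\<close>. Fixing \<open>m = L * t0 powr \<alpha>\<close>
  gives \<open>s \<le> m * \<alpha> / t\<close>, so the growth term is at most
  \<open>D * t powr (4 - \<gamma>)\<close> times \<open>s ^ 3 / t\<close>, which loses for small
  \<open>t0\<close>.\<close>

lemma holder_barrier_exists:
  fixes \<alpha> \<beta> C2 C3 R M :: real
  assumes \<alpha>: "0 < \<alpha>" "\<alpha> < 1" and \<beta>: "0 \<le> \<beta>" "\<beta> < 4" and C: "0 \<le> C2" "0 \<le> C3" and R: "0 < R"
  shows "\<exists>L t0. holder_barrier \<alpha> \<beta> C2 C3 L t0 \<and> t0 \<le> R \<and> 2 * M \<le> L * t0 powr \<alpha>"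
proof -
  define m where "m = max 1 (2 * M)"
  have m: "1 \<le> m" "2 * M \<le> m" by (auto simp: m_def)
  \<comment> \<open>At least 3, so that \<open>s powr (\<gamma> - 3)\<close> is monotone in
    \<open>s\<close>; less than 4, so that a positive power of \<open>t\<close> remains.\<close>
  define \<gamma> where "\<gamma> = max \<beta> 3"
  have \<gamma>: "3 \<le> \<gamma>" "\<gamma> < 4" "\<beta> \<le> \<gamma>" using \<beta> by (auto simp: \<gamma>_def)
  define D where "D = (C2 + C3) * (m * \<alpha>) powr (\<gamma> - 3)"
  have D: "0 \<le> D" using C by (simp add: D_def)
  \<comment> \<open>The bound \<open>m * \<alpha>\<close> forces \<open>s \<ge> 1\<close>, which
    lets \<open>s powr \<gamma>\<close> dominate both the constant \<open>C3\<close> and the power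
    \<beta>. The last bound makes \<open>t powr (4 - \<gamma>) * D\<close> at most half of
    \<open>1 - \<alpha>\<close>.\<close>
  define t0 where "t0 = min R (min (m * \<alpha>) (((1 - \<alpha>) / (2 * (D + 1))) powr (1 / (4 - \<gamma>))))"
  have m\<alpha>: "0 < m * \<alpha>" using m \<alpha> by simp
  have t0: "0 < t0" "t0 \<le> R" "t0 \<le> m * \<alpha>" "t0 \<le> ((1 - \<alpha>) / (2 * (D + 1))) powr (1 / (4 - \<gamma>))"
    using R m\<alpha> \<alpha> D by (auto simp: t0_def)
  have small: "t powr (4 - \<gamma>) * D < 1 - \<alpha>" if t: "0 < t" "t \<le> t0" for t
  proof -
    have "t powr (4 - \<gamma>) \<le> (((1 - \<alpha>) / (2 * (D + 1))) powr (1 / (4 - \<gamma>))) powr (4 - \<gamma>)"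
      using t t0 \<gamma> by (intro powr_mono2) auto
    also have "\<dots> = (1 - \<alpha>) / (2 * (D + 1))" using \<gamma> \<alpha> D by (simp add: powr_powr)
    finally have "t powr (4 - \<gamma>) * D \<le> (1 - \<alpha>) / (2 * (D + 1)) * D" using D by (rule mult_right_mono)
    also have "\<dots> \<le> (1 - \<alpha>) / (2 * (D + 1)) * (D + 1)" using \<alpha> D by (intro mult_left_mono) auto
    also have "\<dots> = (1 - \<alpha>) / 2" using D by (simp add: divide_simps)
    also have "\<dots> < 1 - \<alpha>" using \<alpha> by simp
    finally show ?thesis .
  qed
  define L where "L = m * t0 powr (- \<alpha>)"
  have L: "0 < L" using m t0 by (simp add: L_def)
  have "L * t0 powr \<alpha> = m" using t0 by (simp add: L_def powr_minus)
  moreover have "(L * \<alpha> * (\<alpha> - 1) * t powr (\<alpha> - 2)) * (L * \<alpha> * t powr (\<alpha> - 1))\<^sup>2 + (C2 * rpow (L * \<alpha> * t powr (\<alpha> - 1)) \<beta> + C3) < 0"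
    if t: "0 < t" "t \<le> t0" for t
  proof -
    define s where "s = L * \<alpha> * t powr (\<alpha> - 1)"
    have "t powr (\<alpha> - 2) = t powr (\<alpha> - 1) / t"
      using t powr_diff[of t "\<alpha> - 1" 1] by simp
    then have \<phi>2: "L * \<alpha> * (\<alpha> - 1) * t powr (\<alpha> - 2) = - ((1 - \<alpha>) * s / t)"
      by (simp add: s_def algebra_simps diff_divide_distrib)
    have "t0 powr (\<alpha> - 1) \<le> t powr (\<alpha> - 1)" using t \<alpha> by (intro powr_mono2') auto
    then have "L * \<alpha> * t0 powr (\<alpha> - 1) \<le> s" unfolding s_def using L \<alpha> by (intro mult_left_mono) auto
    moreover have "L * \<alpha> * t0 powr (\<alpha> - 1) = m * \<alpha> / t0"
      using t0 powr_add[of t0 "- \<alpha>" "\<alpha> - 1"] by (simp add: L_def powr_minus field_simps)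
    moreover have "1 \<le> m * \<alpha> / t0" using t0 by simp
    ultimately have s1: "1 \<le> s" by linarith
    have s_le: "s \<le> m * \<alpha> / t"
    proof -
      have "t powr \<alpha> \<le> t0 powr \<alpha>" using t \<alpha> by (intro powr_mono2) auto
      then have "t powr \<alpha> * t0 powr (- \<alpha>) \<le> 1" using t0 by (simp add: powr_minus field_simps)
      then have "m * \<alpha> / t * (t powr \<alpha> * t0 powr (- \<alpha>)) \<le> m * \<alpha> / t * 1"
        using m\<alpha> t by (intro mult_left_mono) auto
      moreover have "s = m * \<alpha> / t * (t powr \<alpha> * t0 powr (- \<alpha>))"
        using t powr_diff[of t \<alpha> 1] by (simp add: s_def L_def)
      ultimately show ?thesis by simp
    qed
    have "rpow s \<beta> \<le> s powr \<gamma>"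
      using s1 \<gamma> by (auto simp: rpow_def ge_one_powr_ge_zero intro: powr_mono)
    then have "C2 * rpow s \<beta> + C3 \<le> C2 * s powr \<gamma> + C3 * s powr \<gamma>"
      using C s1 \<gamma> mult_left_mono[of 1 "s powr \<gamma>" C3] by (intro add_mono mult_left_mono) (auto simp: ge_one_powr_ge_zero)
    also have "s powr \<gamma> = s powr (\<gamma> - 3) * s ^ 3"
      using s1 powr_add[of s "\<gamma> - 3" 3] by simp
    also have "C2 * (s powr (\<gamma> - 3) * s ^ 3) + C3 * (s powr (\<gamma> - 3) * s ^ 3) = (C2 + C3) * (s powr (\<gamma> - 3) * s ^ 3)"
      by (simp add: distrib_right)
    also have "\<dots> \<le> (C2 + C3) * ((m * \<alpha> / t) powr (\<gamma> - 3) * s ^ 3)"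
      using C s1 s_le \<gamma> by (intro mult_left_mono mult_right_mono powr_mono2) auto
    also have "(m * \<alpha> / t) powr (\<gamma> - 3) = (m * \<alpha>) powr (\<gamma> - 3) * (t powr (4 - \<gamma>) / t)"
      using t m\<alpha> powr_diff[of t "4 - \<gamma>" 1] powr_minus_divide[of t "\<gamma> - 3"] by (simp add: powr_divide)
    also have "(C2 + C3) * ((m * \<alpha>) powr (\<gamma> - 3) * (t powr (4 - \<gamma>) / t) * s ^ 3) = (t powr (4 - \<gamma>) * D) * (s ^ 3 / t)"
      by (simp add: D_def)
    also have "\<dots> < (1 - \<alpha>) * (s ^ 3 / t)"
      using small[OF t] s1 t by (intro mult_strict_right_mono) auto
    finally have "C2 * rpow s \<beta> + C3 < (1 - \<alpha>) * (s ^ 3 / t)" .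
    moreover have "(1 - \<alpha>) * (s ^ 3 / t) = (1 - \<alpha>) * s / t * s\<^sup>2" by (simp add: power2_eq_square power3_eq_cube)
    ultimately show ?thesis unfolding s_def[symmetric] \<phi>2 mult_minus_left by linarith
  qed
  ultimately show ?thesis
    unfolding holder_barrier_def using L t0 m by (intro exI[of _ L] exI[of _ t0]) auto
qed

context framed_space
begin

text \<open>The limit of \<open>cone_touching_step\<close> along \<epsilon> = 1/(n+1). The constants
  are independent of \<epsilon>, so the perturbed radii tend to \<open>T\<close>, the gradient norms
  to \<open>\<phi>' T\<close>, and the errors to 0.\<close>

lemma cone_touching:
  fixes \<phi> \<phi>' \<phi>'' :: "real \<Rightarrow> real" and h :: "real \<Rightarrow> real"
  assumes \<Omega>: "open \<Omega>" "p \<in> \<Omega>" and u: "continuous_on \<Omega> u"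
    and sub: "\<And>x0 \<psi>. x0 \<in> \<Omega> \<Longrightarrow> Ck_on 2 UNIV \<psi> \<Longrightarrow> \<psi> x0 = u x0 \<Longrightarrow> \<forall>\<^sub>F y in nhds x0. u y \<le> \<psi> y \<Longrightarrow>
      - h (norm (frame_grad A \<psi> x0)) \<le> inf_laplacian A \<psi> x0"
    and T: "T = d y p" "0 < T" and \<tau>: "0 < \<tau>" "\<tau> \<le> T"
    and \<phi>: "\<And>t. \<bar>t - T\<bar> < \<tau> \<Longrightarrow> (\<phi> has_real_derivative \<phi>' t) (at t)"
    and \<phi>': "\<And>t. \<bar>t - T\<bar> < \<tau> \<Longrightarrow> (\<phi>' has_real_derivative \<phi>'' t) (at t)"
    and pos: "\<And>t. \<bar>t - T\<bar> < \<tau> \<Longrightarrow> 0 < \<phi>' t \<and> \<phi>' t \<le> B"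
    and max: "\<forall>\<^sub>F x in nhds p. u x - \<phi> (d y x) \<le> u p - \<phi> T"
    and cont: "isCont \<phi>'' T" "isCont h (\<phi>' T)"
  shows "0 \<le> \<phi>'' T * (\<phi>' T)\<^sup>2 + h (\<phi>' T)"
proof -
  obtain \<Psi> where \<Psi>: "\<And>m k. Ck_on m UNIV (\<lambda>x. \<Psi> x $ k)" "\<Psi> p = 0"
    "\<And>i k. X i (\<lambda>x. \<Psi> x $ k) p = (if i = k then 1 else 0)"
    "\<And>n k l. X n (\<lambda>x. gram \<Psi> x $ k $ l) p = 0"
    by (rule normal_coordinates[of p]) blast
  have nc: "normal_coords A p \<Psi>"
    by (rule normal_coords.intro[OF framed_space_axioms normal_coords_axioms.intro[OF \<Psi>]])
  define k0 where "k0 = 113 * B"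
  define B1 where "B1 = B + 2 * k0"
  define E where "E = 4 * B1 + 2 * k0"
  define C where "C = B * E + 10 * k0 * B1 + E + 2 * real CARD('n) ^ 3 * B1 ^ 3 + 50 * k0 * B1\<^sup>2 + B * E\<^sup>2"
  define P where "P \<epsilon> q = (case q of (t, \<sigma>, a, N) \<Rightarrow> \<bar>t - T\<bar> \<le> \<epsilon> \<and> 0 < \<sigma> \<and> \<sigma> \<le> \<epsilon> \<and> \<bar>a\<bar> \<le> C * \<epsilon> \<and> 0 \<le> N \<and> \<bar>N\<^sup>2 - (\<phi>' t)\<^sup>2\<bar> \<le> C * \<epsilon> \<and>
    - h N \<le> (\<phi>'' t + 8 * \<sigma>\<^sup>2) * (\<phi>' t + a)\<^sup>2 + C * \<epsilon>)" for \<epsilon> and q :: "real \<times> real \<times> real \<times> real"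
  have ex: "\<exists>q. P (inverse (real (Suc n))) q" for n
  proof -
    have "0 < inverse (real (Suc n))" "inverse (real (Suc n)) \<le> 1" by (auto simp: field_simps)
    note step = normal_coords.cone_touching_step[OF nc \<Omega> u sub T \<tau> \<phi> \<phi>' pos max k0_def B1_def E_def C_def this]
    show ?thesis by (rule step) (auto simp: P_def)
  qed
  define q where "q n = (SOME q. P (inverse (real (Suc n))) q)" for n
  have q: "P (inverse (real (Suc n))) (q n)" for n
    unfolding q_def by (rule someI_ex[OF ex])
  define t where "t n = fst (q n)" for n
  define \<sigma> where "\<sigma> n = fst (snd (q n))" for n
  define a where "a n = fst (snd (snd (q n)))" for n
  define N where "N n = snd (snd (snd (q n)))" for n
  have qq: "\<bar>t n - T\<bar> \<le> inverse (real (Suc n))" "0 < \<sigma> n" "\<sigma> n \<le> inverse (real (Suc n))"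
    "\<bar>a n\<bar> \<le> C * inverse (real (Suc n))" "0 \<le> N n" "\<bar>(N n)\<^sup>2 - (\<phi>' (t n))\<^sup>2\<bar> \<le> C * inverse (real (Suc n))"
    "- h (N n) \<le> (\<phi>'' (t n) + 8 * (\<sigma> n)\<^sup>2) * (\<phi>' (t n) + a n)\<^sup>2 + C * inverse (real (Suc n))" for n
    using q[of n] by (auto simp: P_def t_def \<sigma>_def a_def N_def split: prod.splits)
  have inv: "(\<lambda>n. inverse (real (Suc n))) \<longlonglongrightarrow> 0" by (rule LIMSEQ_inverse_real_of_nat)
  then have Cinv: "(\<lambda>n. C * inverse (real (Suc n))) \<longlonglongrightarrow> 0" by (rule tendsto_mult_right_zero)
  have "(\<lambda>n. t n - T) \<longlonglongrightarrow> 0"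
    by (rule Lim_null_comparison[OF _ inv]) (use qq(1) in auto)
  then have t: "t \<longlonglongrightarrow> T" by (simp add: LIM_zero_iff)
  have \<sigma>: "\<sigma> \<longlonglongrightarrow> 0"
    by (rule Lim_null_comparison[OF _ inv]) (use qq(2,3) in \<open>auto simp: less_imp_le\<close>)
  have a: "a \<longlonglongrightarrow> 0"
    by (rule Lim_null_comparison[OF _ Cinv]) (use qq(4) in auto)
  have \<phi>'t: "(\<lambda>n. \<phi>' (t n)) \<longlonglongrightarrow> \<phi>' T"
    by (rule isCont_tendsto_compose[OF DERIV_isCont[OF \<phi>'[of T]] t]) (use \<tau> in simp)
  have \<phi>''t: "(\<lambda>n. \<phi>'' (t n)) \<longlonglongrightarrow> \<phi>'' T"
    by (rule isCont_tendsto_compose[OF cont(1) t])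
  have "(\<lambda>n. (N n)\<^sup>2 - (\<phi>' (t n))\<^sup>2) \<longlonglongrightarrow> 0"
    by (rule Lim_null_comparison[OF _ Cinv]) (use qq(6) in auto)
  from tendsto_add[OF this tendsto_power[OF \<phi>'t, of 2]] have "(\<lambda>n. (N n)\<^sup>2) \<longlonglongrightarrow> (\<phi>' T)\<^sup>2" by simp
  then have "(\<lambda>n. sqrt ((N n)\<^sup>2)) \<longlonglongrightarrow> sqrt ((\<phi>' T)\<^sup>2)" by (rule tendsto_real_sqrt)
  then have N: "N \<longlonglongrightarrow> \<phi>' T" using qq(5) pos[of T] \<tau> by (simp add: less_imp_le)
  have l: "(\<lambda>n. - h (N n)) \<longlonglongrightarrow> - h (\<phi>' T)"
    by (rule tendsto_minus[OF isCont_tendsto_compose[OF cont(2) N]])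
  have r: "(\<lambda>n. (\<phi>'' (t n) + 8 * (\<sigma> n)\<^sup>2) * (\<phi>' (t n) + a n)\<^sup>2 + C * inverse (real (Suc n)))
      \<longlonglongrightarrow> (\<phi>'' T + 8 * 0\<^sup>2) * (\<phi>' T + 0)\<^sup>2 + 0"
    by (intro tendsto_intros \<phi>''t \<phi>'t \<sigma> a Cinv)
  have "- h (\<phi>' T) \<le> (\<phi>'' T + 8 * 0\<^sup>2) * (\<phi>' T + 0)\<^sup>2 + 0"
    by (rule LIMSEQ_le[OF l r]) (use qq(7) in auto)
  then show ?thesis by simp
qed

lemma holder_comparison:
  assumes \<Omega>: "open \<Omega>" and u: "continuous_on \<Omega> u"
    and sub: "\<And>x0 \<psi>. x0 \<in> \<Omega> \<Longrightarrow> Ck_on 2 UNIV \<psi> \<Longrightarrow> \<psi> x0 = u x0 \<Longrightarrow> \<forall>\<^sub>F y in nhds x0. u y \<le> \<psi> y \<Longrightarrow>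
      - (C2 * rpow (norm (frame_grad A \<psi> x0)) \<beta> + C3) \<le> inf_laplacian A \<psi> x0"
    and \<alpha>: "0 < \<alpha>" "\<alpha> < 1" and barrier: "holder_barrier \<alpha> \<beta> C2 C3 L t0"
    and Q: "compact {x. d y x \<le> t0}" "{x. d y x \<le> t0} \<subseteq> \<Omega>"
    and bd: "\<And>x. d y x = t0 \<Longrightarrow> u x - u y \<le> L * t0 powr \<alpha>"
    and x: "d y x \<le> t0"
  shows "u x - u y \<le> L * d y x powr \<alpha>"
proof -
  have L: "0 < L" and neg: "\<And>t. 0 < t \<Longrightarrow> t \<le> t0 \<Longrightarrow>
      (L * \<alpha> * (\<alpha> - 1) * t powr (\<alpha> - 2)) * (L * \<alpha> * t powr (\<alpha> - 1))\<^sup>2 + (C2 * rpow (L * \<alpha> * t powr (\<alpha> - 1)) \<beta> + C3) < 0"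
    using barrier by (auto simp: holder_barrier_def)
  define \<phi> where "\<phi> t = L * t powr \<alpha>" for t :: real
  let ?Q = "{x. d y x \<le> t0}"
  have "continuous_on ?Q (\<lambda>x. u x - \<phi> (d y x))"
    unfolding \<phi>_def using \<alpha>
    by (intro continuous_intros continuous_on_powr' continuous_on_riem_dist continuous_on_subset[OF u Q(2)]) auto
  moreover have "?Q \<noteq> {}" using x by auto
  ultimately obtain p where p: "d y p \<le> t0" "\<And>x. d y x \<le> t0 \<Longrightarrow> u x - \<phi> (d y x) \<le> u p - \<phi> (d y p)"
    using continuous_attains_sup[OF Q(1)] by (metis (lifting) mem_Collect_eq)
  have "u p - \<phi> (d y p) \<le> u y"
  proof (rule ccontr)
    assume "\<not> ?thesis"
    then have gt: "u y < u p - \<phi> (d y p)" by simp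
    define T where "T = d y p"
    \<comment> \<open>At \<open>y\<close> the barrier vanishes, as
      \<open>0 powr \<alpha> = 0\<close>, so \<open>gt\<close> would read
      \<open>u y < u y\<close>.\<close>
    have "p \<noteq> y" using gt by (auto simp: \<phi>_def)
    then have T0: "0 < T" unfolding T_def by (intro riem_dist_pos) auto
    have Tt: "T < t0"
      using p(1) bd[of p] gt by (cases "T = t0") (auto simp: T_def \<phi>_def)
    have "open {x. d y x < t0}"
      using open_Collect_less[OF continuous_on_riem_dist[of UNIV y] continuous_on_const] by simp
    then have "\<forall>\<^sub>F x in nhds p. d y x < t0"
      using Tt eventually_nhds_in_open[of "{x. d y x < t0}" p] by (simp add: T_def)
    then have max: "\<forall>\<^sub>F x in nhds p. u x - \<phi> (d y x) \<le> u p - \<phi> T"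
      unfolding T_def by (rule eventually_mono) (use p(2) in auto)
    have p\<Omega>: "p \<in> \<Omega>" using p(1) Q(2) by auto
    \<comment> \<open>Half of \<open>T\<close> keeps the interval away from the singularity of the
      barrier at 0. There \<open>\<phi>'\<close> is decreasing, and \<open>\<phi>' (T / 2)\<close>
      serves as the upper bound \<open>B\<close>.\<close>
    have tpos: "T / 2 < t" if "\<bar>t - T\<bar> < T / 2" for t using that by linarith
    define \<phi>' where "\<phi>' t = L * \<alpha> * t powr (\<alpha> - 1)" for t :: real
    define \<phi>'' where "\<phi>'' t = L * \<alpha> * (\<alpha> - 1) * t powr (\<alpha> - 2)" for t :: real
    have d1: "(\<phi> has_real_derivative \<phi>' t) (at t)" if "\<bar>t - T\<bar> < T / 2" for t
      unfolding \<phi>_def \<phi>'_def using tpos[OF that] T0 by (auto intro!: derivative_eq_intros)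
    have d2: "(\<phi>' has_real_derivative \<phi>'' t) (at t)" if "\<bar>t - T\<bar> < T / 2" for t
      unfolding \<phi>'_def \<phi>''_def using tpos[OF that] T0 by (auto intro!: derivative_eq_intros)
    have pos: "0 < \<phi>' t \<and> \<phi>' t \<le> \<phi>' (T / 2)" if "\<bar>t - T\<bar> < T / 2" for t
      unfolding \<phi>'_def using tpos[OF that] T0 L \<alpha> by (auto intro!: mult_left_mono powr_mono2')
    have c1: "isCont \<phi>'' T" unfolding \<phi>''_def using T0 by (intro continuous_intros) auto
    have "0 < \<phi>' T" using pos[of T] T0 by simp
    then have c2: "isCont (\<lambda>s. C2 * rpow s \<beta> + C3) (\<phi>' T)"
      unfolding rpow_def by (cases "\<beta> = 0") (auto intro!: continuous_intros)
    have "0 \<le> \<phi>'' T * (\<phi>' T)\<^sup>2 + (C2 * rpow (\<phi>' T) \<beta> + C3)"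
      by (rule cone_touching[where \<tau>="T / 2", OF \<Omega> p\<Omega> u sub T_def T0 _ _ d1 d2 pos max c1 c2]) (use T0 in auto)
    then show False using neg[OF T0] Tt by (simp add: \<phi>'_def \<phi>''_def)
  qed
  then show ?thesis using p(2)[OF x] by (simp add: \<phi>_def)
qed

end

section \<open>Geodesics and the Gauss lemma\<close>

lemma has_real_derivative_nth:
  assumes "(c has_vector_derivative v) (at t within S)"
  shows "((\<lambda>t. c t $ k) has_real_derivative v $ k) (at t within S)"
  using bounded_linear.has_vector_derivative[OF bounded_linear_vec_nth assms]
  by (simp add: has_real_derivative_iff_has_vector_derivative)

lemma has_real_derivative_along:
  fixes \<phi> :: "real^'n::finite \<Rightarrow> real"
  assumes "\<phi> differentiable (at (c t))" "(c has_vector_derivative v) (at t within S)"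
  shows "((\<lambda>t. \<phi> (c t)) has_real_derivative (\<Sum>l\<in>UNIV. v $ l * partial l \<phi> (c t))) (at t within S)"
  using vector_derivative_diff_chain_within[OF assms(2) has_derivative_at_withinI[OF has_derivative_partial[OF assms(1)]]]
  by (simp add: has_real_derivative_iff_has_vector_derivative o_def)

lemma Ck_on_1_lipschitz:
  fixes f :: "real^'n::finite \<Rightarrow> real"
  assumes f: "Ck_on 1 UNIV f"
  obtains K where "K \<ge> 0" "\<And>x y. x \<in> cball 0 R \<Longrightarrow> y \<in> cball 0 R \<Longrightarrow> \<bar>f x - f y\<bar> \<le> K * norm (x - y)"
proof -
  have c: "continuous_on (cball 0 R) (\<lambda>x. \<Sum>j\<in>UNIV. \<bar>partial j f x\<bar>)"
    using f by (intro continuous_on_sum continuous_on_rabs) (auto intro: continuous_on_subset)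
  obtain K where K: "K > 0" "\<And>x. x \<in> cball 0 R \<Longrightarrow> norm (\<Sum>j\<in>UNIV. \<bar>partial j f x\<bar>) \<le> K"
    using continuous_on_compact_bounded[OF compact_cball c] by metis
  show ?thesis
  proof (rule that[OF less_imp_le[OF K(1)]])
    fix x y :: "real^'n" assume xy: "x \<in> cball 0 R" "y \<in> cball 0 R"
    have "norm (f x - f y) \<le> K * norm (x - y)"
    proof (rule differentiable_bound[OF convex_cball _ _ xy])
      fix z :: "real^'n" assume z: "z \<in> cball 0 R"
      have "f differentiable (at z)" using f by simp
      then show "(f has_derivative (\<lambda>v. \<Sum>j\<in>UNIV. v $ j * partial j f z)) (at z within cball 0 R)"
        by (rule has_derivative_at_withinI[OF has_derivative_partial])
      show "onorm (\<lambda>v. \<Sum>j\<in>UNIV. v $ j * partial j f z) \<le> K"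
      proof (rule onorm_le)
        fix v :: "real^'n"
        have "norm (\<Sum>j\<in>UNIV. v $ j * partial j f z) \<le> (\<Sum>j\<in>UNIV. norm v * \<bar>partial j f z\<bar>)"
          unfolding real_norm_def
          by (intro order_trans[OF sum_abs] sum_mono) (simp add: abs_mult component_le_norm_cart mult_right_mono)
        also have "\<dots> = (\<Sum>j\<in>UNIV. \<bar>partial j f z\<bar>) * norm v" by (simp add: sum_distrib_left sum_distrib_right mult.commute)
        also have "\<dots> \<le> K * norm v" using K(2)[OF z] by (intro mult_right_mono) (auto simp: sum_nonneg)
        finally show "norm (\<Sum>j\<in>UNIV. v $ j * partial j f z) \<le> K * norm v" .
      qed
    qed
    then show "\<bar>f x - f y\<bar> \<le> K * norm (x - y)" by simp
  qed
qed

lemma has_real_derivative_line: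
  fixes f :: "real^'n::finite \<Rightarrow> real"
  assumes "f differentiable (at (x + s *\<^sub>R axis p 1))"
  shows "((\<lambda>s. f (x + s *\<^sub>R axis p 1)) has_real_derivative partial p f (x + s *\<^sub>R axis p 1)) (at s)"
proof -
  have "((\<lambda>s. x + s *\<^sub>R axis p 1) has_vector_derivative (axis p 1 :: real^'n)) (at s)"
    by (auto intro!: derivative_eq_intros)
  from has_real_derivative_along[of f "\<lambda>s. x + s *\<^sub>R axis p 1", OF assms this]
  show ?thesis by (simp add: axis_def if_distrib[of "\<lambda>z. z * _"] cong: if_cong)
qed

section \<open>Symmetry of second partial derivatives\<close>

lemma mixed_difference:
  fixes f :: "real^'n::finite \<Rightarrow> real"
  assumes f: "Ck_on 2 (ball x r) f" and h: "0 < h" "2 * h < r"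
  obtains \<xi> \<eta> where "0 < \<xi>" "\<xi> < h" "0 < \<eta>" "\<eta> < h"
    "f (x + h *\<^sub>R axis p 1 + h *\<^sub>R axis l 1) - f (x + h *\<^sub>R axis p 1) - f (x + h *\<^sub>R axis l 1) + f x
      = h * h * partial l (partial p f) (x + \<xi> *\<^sub>R axis p 1 + \<eta> *\<^sub>R axis l 1)"
proof -
  have S: "Ck_on (Suc (Suc 0)) (ball x r) f" using f by (simp add: numeral_2_eq_2)
  have inb: "x + a *\<^sub>R axis p 1 + b *\<^sub>R axis l 1 \<in> ball x r" if "0 \<le> a" "a \<le> h" "0 \<le> b" "b \<le> h" for a b
  proof -
    have "norm (a *\<^sub>R axis p 1 + b *\<^sub>R axis l (1::real)) \<le> a + b"
      using that by (intro order_trans[OF norm_triangle_ineq]) simp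
    moreover have "dist x (x + a *\<^sub>R axis p 1 + b *\<^sub>R axis l 1) = norm (a *\<^sub>R axis p 1 + b *\<^sub>R axis l (1::real))"
      by (metis add.assoc add_diff_cancel_left' dist_commute dist_norm)
    ultimately show ?thesis using that h by simp
  qed
  have df: "f differentiable (at z)" if "z \<in> ball x r" for z using S that by simp
  have dpf: "partial p f differentiable (at z)" if "z \<in> ball x r" for z using S that by simp
  let ?k = "\<lambda>s. f (x + s *\<^sub>R axis p 1 + h *\<^sub>R axis l 1) - f (x + s *\<^sub>R axis p 1)"
  have "\<exists>\<xi>. 0 < \<xi> \<and> \<xi> < h \<and> ?k h - ?k 0 = (h - 0) * (partial p f (x + \<xi> *\<^sub>R axis p 1 + h *\<^sub>R axis l 1) - partial p f (x + \<xi> *\<^sub>R axis p 1))"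
  proof (rule MVT2[OF h(1)])
    fix s assume s: "0 \<le> s" "s \<le> h"
    have "((\<lambda>s. f ((x + h *\<^sub>R axis l 1) + s *\<^sub>R axis p 1)) has_real_derivative partial p f ((x + h *\<^sub>R axis l 1) + s *\<^sub>R axis p 1)) (at s)"
      using inb[of s h] s h by (intro has_real_derivative_line df) (auto simp: algebra_simps)
    moreover have "((\<lambda>s. f (x + s *\<^sub>R axis p 1)) has_real_derivative partial p f (x + s *\<^sub>R axis p 1)) (at s)"
      using inb[of s 0] s h by (intro has_real_derivative_line df) auto
    ultimately show "(?k has_real_derivative partial p f (x + s *\<^sub>R axis p 1 + h *\<^sub>R axis l 1) - partial p f (x + s *\<^sub>R axis p 1)) (at s)"
      using DERIV_diff by (fastforce simp: algebra_simps)
  qed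
  then obtain \<xi> where \<xi>: "0 < \<xi>" "\<xi> < h" "?k h - ?k 0 = h * (partial p f (x + \<xi> *\<^sub>R axis p 1 + h *\<^sub>R axis l 1) - partial p f (x + \<xi> *\<^sub>R axis p 1))"
    by auto
  let ?m = "\<lambda>s. partial p f (x + \<xi> *\<^sub>R axis p 1 + s *\<^sub>R axis l 1)"
  have "\<exists>\<eta>. 0 < \<eta> \<and> \<eta> < h \<and> ?m h - ?m 0 = (h - 0) * partial l (partial p f) (x + \<xi> *\<^sub>R axis p 1 + \<eta> *\<^sub>R axis l 1)"
    using inb[of \<xi>] \<xi> by (intro MVT2[OF h(1)] has_real_derivative_line dpf) auto
  then obtain \<eta> where \<eta>: "0 < \<eta>" "\<eta> < h" "?m h - ?m 0 = h * partial l (partial p f) (x + \<xi> *\<^sub>R axis p 1 + \<eta> *\<^sub>R axis l 1)"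
    by auto
  show ?thesis
    using \<xi> \<eta> by (intro that[OF \<xi>(1,2) \<eta>(1,2)]) simp
qed

text \<open>The mixed second difference is symmetric in the two directions, and the mean value
  theorem taken in either order gives either iterated derivative in the limit. Needed for the
  Jacobian of the exponential map.\<close>

lemma partial_commute:
  fixes f :: "real^'n::finite \<Rightarrow> real"
  assumes f: "Ck_on 2 S f" and S: "open S" "x \<in> S"
  shows "partial p (partial l f) x = partial l (partial p f) x"
proof -
  obtain r where r: "r > 0" "ball x r \<subseteq> S" using S open_contains_ball by blast
  have fr: "Ck_on 2 (ball x r) f" using Ck_on_subset[OF f r(2)] .
  have "Ck_on (Suc (Suc 0)) S f" using f by (simp add: numeral_2_eq_2)
  then have "continuous_on S (partial a (partial b f))" for a b by simp
  then have cont: "isCont (partial a (partial b f)) x" for a b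
    using S continuous_on_eq_continuous_at by blast
  define h where "h n = r / (3 * real (Suc n))" for n
  have h: "0 < h n" "2 * h n < r" for n
  proof -
    show "0 < h n" using r by (simp add: h_def)
    have "h n \<le> r / 3" unfolding h_def using r by (intro divide_left_mono) auto
    then show "2 * h n < r" using r by linarith
  qed
  have h0: "h \<longlonglongrightarrow> 0"
    using tendsto_mult_right_zero[OF LIMSEQ_inverse_real_of_nat, of "r / 3"] by (simp add: h_def[abs_def] field_simps)
  have lim: "(\<lambda>n. (f (x + h n *\<^sub>R axis a 1 + h n *\<^sub>R axis b 1) - f (x + h n *\<^sub>R axis a 1) - f (x + h n *\<^sub>R axis b 1) + f x) / (h n * h n))
      \<longlonglongrightarrow> partial b (partial a f) x" for a b
  proof -
    have "\<exists>\<xi> \<eta>. 0 < \<xi> \<and> \<xi> < h n \<and> 0 < \<eta> \<and> \<eta> < h n \<and>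
        f (x + h n *\<^sub>R axis a 1 + h n *\<^sub>R axis b 1) - f (x + h n *\<^sub>R axis a 1) - f (x + h n *\<^sub>R axis b 1) + f x
        = h n * h n * partial b (partial a f) (x + \<xi> *\<^sub>R axis a 1 + \<eta> *\<^sub>R axis b 1)" for n
      by (rule mixed_difference[OF fr h, of n a b]) blast
    then obtain \<xi> \<eta> where *: "\<And>n. 0 < \<xi> n \<and> \<xi> n < h n \<and> 0 < \<eta> n \<and> \<eta> n < h n \<and>
        f (x + h n *\<^sub>R axis a 1 + h n *\<^sub>R axis b 1) - f (x + h n *\<^sub>R axis a 1) - f (x + h n *\<^sub>R axis b 1) + f x
        = h n * h n * partial b (partial a f) (x + \<xi> n *\<^sub>R axis a 1 + \<eta> n *\<^sub>R axis b 1)" by metis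
    have \<xi>: "\<xi> \<longlonglongrightarrow> 0" by (rule Lim_null_comparison[OF _ h0]) (use * in \<open>auto simp: less_imp_le\<close>)
    have \<eta>: "\<eta> \<longlonglongrightarrow> 0" by (rule Lim_null_comparison[OF _ h0]) (use * in \<open>auto simp: less_imp_le\<close>)
    have "(\<lambda>n. x + \<xi> n *\<^sub>R axis a 1 + \<eta> n *\<^sub>R axis b 1) \<longlonglongrightarrow> x + 0 *\<^sub>R axis a 1 + 0 *\<^sub>R axis b 1"
      by (intro tendsto_intros \<xi> \<eta>)
    then have "(\<lambda>n. x + \<xi> n *\<^sub>R axis a 1 + \<eta> n *\<^sub>R axis b 1) \<longlonglongrightarrow> x" by simp
    from isCont_tendsto_compose[OF cont this]
    have "(\<lambda>n. partial b (partial a f) (x + \<xi> n *\<^sub>R axis a 1 + \<eta> n *\<^sub>R axis b 1)) \<longlonglongrightarrow> partial b (partial a f) x" .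
    moreover have "partial b (partial a f) (x + \<xi> n *\<^sub>R axis a 1 + \<eta> n *\<^sub>R axis b 1)
        = (f (x + h n *\<^sub>R axis a 1 + h n *\<^sub>R axis b 1) - f (x + h n *\<^sub>R axis a 1) - f (x + h n *\<^sub>R axis b 1) + f x) / (h n * h n)" for n
      using *[of n] h(1)[of n] by (auto simp: nonzero_eq_divide_eq mult.commute)
    ultimately show ?thesis by simp
  qed
  have comm: "f (x + h n *\<^sub>R axis p 1 + h n *\<^sub>R axis l 1) - f (x + h n *\<^sub>R axis p 1) - f (x + h n *\<^sub>R axis l 1) + f x
    = f (x + h n *\<^sub>R axis l 1 + h n *\<^sub>R axis p 1) - f (x + h n *\<^sub>R axis l 1) - f (x + h n *\<^sub>R axis p 1) + f x" for n
    by (simp add: add_ac)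
  show ?thesis by (rule LIMSEQ_unique[OF lim[of l p] lim[of p l, unfolded comm]])
qed

context framed_space
begin

section \<open>The geodesic equation: uniqueness and homogeneity\<close>

definition accel :: "real^'n \<Rightarrow> real^'n \<Rightarrow> real^'n"
  where "accel x v = (\<chi> k. - (\<Sum>i\<in>UNIV. \<Sum>j\<in>UNIV. christoffel g k i j x * v $ i * v $ j))"

definition geodesic :: "(real \<Rightarrow> real^'n) \<Rightarrow> (real \<Rightarrow> real^'n) \<Rightarrow> bool"
  where "geodesic c c' \<longleftrightarrow> (\<forall>t\<in>{0..1}. (c has_vector_derivative c' t) (at t within {0..1}) \<and>
    (c' has_vector_derivative accel (c t) (c' t)) (at t within {0..1}))"

lemma exp_graph_eq: "exp_graph g x v y \<longleftrightarrow> (\<exists>c c'. geodesic c c' \<and> c 0 = x \<and> c' 0 = v \<and> c 1 = y)"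
  by (auto simp: exp_graph_def geodesic_def accel_def)

lemma geodesicD:
  assumes "geodesic c c'" "t \<in> {0..1}"
  shows "(c has_vector_derivative c' t) (at t within {0..1})"
    "(c' has_vector_derivative accel (c t) (c' t)) (at t within {0..1})"
  using assms by (auto simp: geodesic_def)

lemma geodesic_continuous:
  assumes "geodesic c c'" shows "continuous_on {0..1} c" "continuous_on {0..1} c'"
  using has_vector_derivative_continuous[OF geodesicD(1)[OF assms]]
    has_vector_derivative_continuous[OF geodesicD(2)[OF assms]]
  by (auto simp: continuous_on_eq_continuous_within)

lemma det_metric: "det (g x) \<noteq> 0"
proof -
  have "det (coframe x) \<noteq> 0"
    using matrix_inv_left_right(1)[OF det_tA[of x]] det_mul[of "transpose (A x)" "coframe x"]
    by (auto simp: coframe_def)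
  then show ?thesis by (simp add: metric_eq det_mul)
qed

lemma Ck_christoffel: "Ck_on m UNIV (christoffel g k i j)"
proof -
  have p: "Ck_on m UNIV (partial i (\<lambda>y. g y $ j $ l))" for i j l
    using Ck_metric[of "Suc m" j l] by simp
  have "christoffel g k i j = (\<lambda>x. (1/2) * (\<Sum>l\<in>UNIV. matrix_inv (g x) $ k $ l *
      (partial i (\<lambda>y. g y $ j $ l) x + partial j (\<lambda>y. g y $ i $ l) x - partial l (\<lambda>y. g y $ i $ j) x)))"
    by (simp add: christoffel_def fun_eq_iff)
  then show ?thesis
    by (simp only:) (intro Ck_on_mult Ck_on_const Ck_on_sum Ck_on_add Ck_on_diff Ck_on_matrix_inv Ck_metric det_metric p)
qed

lemma accel_lipschitz:
  obtains K where "K \<ge> 0" "\<And>x y v w. x \<in> cball 0 R \<Longrightarrow> y \<in> cball 0 R \<Longrightarrow> v \<in> cball 0 R \<Longrightarrow> w \<in> cball 0 R \<Longrightarrow>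
    norm (accel x v - accel y w) \<le> K * (norm (x - y) + norm (v - w))"
proof -
  let ?G = "\<lambda>k i j. christoffel g k i j"
  have "\<exists>K\<ge>0. \<forall>x\<in>cball 0 R. \<forall>y\<in>cball 0 R. \<bar>?G k i j x - ?G k i j y\<bar> \<le> K * norm (x - y)" for k i j
    using Ck_on_1_lipschitz[OF Ck_christoffel[of 1 k i j], of R] by metis
  then obtain K1 where K1: "\<And>k i j. K1 k i j \<ge> 0" "\<And>k i j x y. x \<in> cball 0 R \<Longrightarrow> y \<in> cball 0 R \<Longrightarrow> \<bar>?G k i j x - ?G k i j y\<bar> \<le> K1 k i j * norm (x - y)"
    by metis
  have "continuous_on (cball 0 R) (?G k i j)" for k i j
    using Ck_on_imp_continuous[OF Ck_christoffel[of 0 k i j]] continuous_on_subset by blast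
  then have "\<exists>M>0. \<forall>x\<in>cball 0 R. \<bar>?G k i j x\<bar> \<le> M" for k i j
    using continuous_on_compact_bounded[OF compact_cball, of 0 R "?G k i j"] by (metis real_norm_def)
  then obtain M where M: "\<And>k i j. M k i j > 0" "\<And>k i j x. x \<in> cball 0 R \<Longrightarrow> \<bar>?G k i j x\<bar> \<le> M k i j"
    by metis
  define K where "K = (\<Sum>k\<in>UNIV. \<Sum>i\<in>UNIV. \<Sum>j\<in>UNIV. K1 k i j * R\<^sup>2 + 2 * M k i j * \<bar>R\<bar>)"
  show ?thesis
  proof (rule that)
    show "K \<ge> 0" unfolding K_def using K1 M by (intro sum_nonneg add_nonneg_nonneg mult_nonneg_nonneg) (auto simp: less_imp_le)
    fix x y v w :: "real^'n" assume R: "x \<in> cball 0 R" "y \<in> cball 0 R" "v \<in> cball 0 R" "w \<in> cball 0 R"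
    then have R0: "0 \<le> R" using norm_ge_zero[of x] by (simp del: norm_ge_zero)
    have tm: "\<bar>?G k i j x * v $ i * v $ j - ?G k i j y * w $ i * w $ j\<bar>
      \<le> (K1 k i j * R\<^sup>2 + 2 * M k i j * \<bar>R\<bar>) * (norm (x - y) + norm (v - w))" for k i j
    proof -
      have comp: "\<bar>v $ a\<bar> \<le> R" "\<bar>w $ a\<bar> \<le> R" for a
        using component_le_norm_cart[of v a] component_le_norm_cart[of w a] R by auto
      have diff: "\<bar>v $ a - w $ a\<bar> \<le> norm (v - w)" for a
        using component_le_norm_cart[of "v - w" a] by simp
      have "?G k i j x * v $ i * v $ j - ?G k i j y * w $ i * w $ j
        = (?G k i j x - ?G k i j y) * (v $ i * v $ j) + ?G k i j y * ((v $ i - w $ i) * v $ j + w $ i * (v $ j - w $ j))"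
        by (simp add: algebra_simps)
      moreover have "\<bar>(?G k i j x - ?G k i j y) * (v $ i * v $ j)\<bar> \<le> (K1 k i j * norm (x - y)) * (R * R)"
        unfolding abs_mult using K1 R R0 comp by (intro mult_mono mult_nonneg_nonneg) auto
      moreover have "\<bar>?G k i j y * ((v $ i - w $ i) * v $ j + w $ i * (v $ j - w $ j))\<bar>
          \<le> M k i j * (norm (v - w) * R + R * norm (v - w))"
      proof -
        have "\<bar>(v $ i - w $ i) * v $ j + w $ i * (v $ j - w $ j)\<bar> \<le> norm (v - w) * R + R * norm (v - w)"
          by (intro order_trans[OF abs_triangle_ineq] add_mono; unfold abs_mult; intro mult_mono diff comp) (use R0 in auto)
        then show ?thesis unfolding abs_mult[of "?G k i j y"] using M R by (intro mult_mono) (auto simp: less_imp_le)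
      qed
      ultimately have "\<bar>?G k i j x * v $ i * v $ j - ?G k i j y * w $ i * w $ j\<bar>
        \<le> (K1 k i j * R\<^sup>2) * norm (x - y) + (2 * M k i j * \<bar>R\<bar>) * norm (v - w)"
        using R0 by (simp add: power2_eq_square algebra_simps)
      also have "\<dots> \<le> (K1 k i j * R\<^sup>2 + 2 * M k i j * \<bar>R\<bar>) * norm (x - y) + (K1 k i j * R\<^sup>2 + 2 * M k i j * \<bar>R\<bar>) * norm (v - w)"
        using K1(1)[of k i j] M(1)[of k i j] by (intro add_mono mult_right_mono) auto
      finally show ?thesis by (simp add: distrib_left)
    qed
    have "norm (accel x v - accel y w) \<le> (\<Sum>k\<in>UNIV. \<bar>(accel x v - accel y w) $ k\<bar>)" by (rule norm_le_l1_cart)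
    also have "\<dots> \<le> (\<Sum>k\<in>UNIV. \<Sum>i\<in>UNIV. \<Sum>j\<in>UNIV. (K1 k i j * R\<^sup>2 + 2 * M k i j * \<bar>R\<bar>) * (norm (x - y) + norm (v - w)))"
    proof (rule sum_mono)
      fix k
      have "\<bar>(accel x v - accel y w) $ k\<bar> = \<bar>\<Sum>i\<in>UNIV. \<Sum>j\<in>UNIV. ?G k i j x * v $ i * v $ j - ?G k i j y * w $ i * w $ j\<bar>"
        by (simp add: accel_def sum_subtractf abs_minus_commute)
      also have "\<dots> \<le> (\<Sum>i\<in>UNIV. \<Sum>j\<in>UNIV. (K1 k i j * R\<^sup>2 + 2 * M k i j * \<bar>R\<bar>) * (norm (x - y) + norm (v - w)))"
        by (intro order_trans[OF sum_abs] sum_mono tm)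
      finally show "\<bar>(accel x v - accel y w) $ k\<bar> \<le> (\<Sum>i\<in>UNIV. \<Sum>j\<in>UNIV. (K1 k i j * R\<^sup>2 + 2 * M k i j * \<bar>R\<bar>) * (norm (x - y) + norm (v - w)))" .
    qed
    also have "\<dots> = K * (norm (x - y) + norm (v - w))" by (simp add: K_def sum_distrib_right)
    finally show "norm (accel x v - accel y w) \<le> K * (norm (x - y) + norm (v - w))" .
  qed
qed

text \<open>Gronwall's argument in phase space: \<open>N\<close> is the squared distance of
  positions and velocities, \<open>N' \<le> k * N\<close>, and \<open>exp (- k * t) * N t\<close>
  starts at 0 and does not increase.\<close>

lemma geodesic_unique:
  assumes c: "geodesic c c'" and b: "geodesic b b'" and init: "c 0 = b 0" "c' 0 = b' 0" and t: "t \<in> {0..1}"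
  shows "c t = b t"
proof -
  have "bounded (c ` {0..1} \<union> b ` {0..1} \<union> c' ` {0..1} \<union> b' ` {0..1})"
    using geodesic_continuous[OF c] geodesic_continuous[OF b]
    by (auto intro!: compact_imp_bounded compact_continuous_image)
  then obtain R where "\<forall>z\<in>c ` {0..1} \<union> b ` {0..1} \<union> c' ` {0..1} \<union> b' ` {0..1}. norm z \<le> R"
    unfolding bounded_iff ..
  then have R: "c t \<in> cball 0 R" "b t \<in> cball 0 R" "c' t \<in> cball 0 R" "b' t \<in> cball 0 R" if "t \<in> {0..1}" for t
    using that by auto
  obtain K where K: "K \<ge> 0" "\<And>x y v w. x \<in> cball 0 R \<Longrightarrow> y \<in> cball 0 R \<Longrightarrow> v \<in> cball 0 R \<Longrightarrow> w \<in> cball 0 R \<Longrightarrow>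
    norm (accel x v - accel y w) \<le> K * (norm (x - y) + norm (v - w))"
    using accel_lipschitz[of R] by metis
  define N where "N t = (c t - b t) \<bullet> (c t - b t) + (c' t - b' t) \<bullet> (c' t - b' t)" for t
  define N' where "N' t = 2 * ((c t - b t) \<bullet> (c' t - b' t)) + 2 * ((c' t - b' t) \<bullet> (accel (c t) (c' t) - accel (b t) (b' t)))" for t
  \<comment> \<open>The 1 comes from \<open>2 * (p * q) \<le> p\<^sup>2 + q\<^sup>2\<close>, the 3
    from twice the bound 3/2 for the acceleration term.\<close>
  define k where "k = 1 + 3 * K"
  have dN: "(N has_vector_derivative N' t) (at t within {0..1})" if t: "t \<in> {0..1}" for t
  proof -
    note d1 = has_vector_derivative_diff[OF geodesicD(1)[OF c t] geodesicD(1)[OF b t]]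
    note d2 = has_vector_derivative_diff[OF geodesicD(2)[OF c t] geodesicD(2)[OF b t]]
    from has_vector_derivative_add[OF bounded_bilinear.has_vector_derivative[OF bounded_bilinear_inner d1 d1]
        bounded_bilinear.has_vector_derivative[OF bounded_bilinear_inner d2 d2]]
    show ?thesis unfolding N_def[abs_def] N'_def by (simp add: inner_commute)
  qed
  have le: "N' t \<le> k * N t" if t: "t \<in> {0..1}" for t
  proof -
    define p where "p = norm (c t - b t)"
    define q where "q = norm (c' t - b' t)"
    define S where "S = (c' t - b' t) \<bullet> (accel (c t) (c' t) - accel (b t) (b' t))"
    define W where "W = (c t - b t) \<bullet> (c' t - b' t)"
    have N: "N t = p\<^sup>2 + q\<^sup>2" by (simp add: N_def power2_norm_eq_inner p_def q_def)
    have pq: "2 * (p * q) \<le> p\<^sup>2 + q\<^sup>2" using sum_squares_bound[of p q] by simp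
    have W: "W \<le> p * q" unfolding W_def p_def q_def by (rule norm_cauchy_schwarz)
    have "S \<le> q * (K * (p + q))" unfolding S_def p_def q_def
      by (rule order_trans[OF norm_cauchy_schwarz mult_left_mono[OF K(2)[OF R(1,2)[OF t] R(3,4)[OF t]]]]) simp
    also have "\<dots> = K * (p * q + q\<^sup>2)" by (simp add: power2_eq_square algebra_simps)
    also have "\<dots> \<le> K * ((3/2) * (p\<^sup>2 + q\<^sup>2))"
    proof (rule mult_left_mono[OF _ K(1)])
      have "0 \<le> p\<^sup>2" by simp
      with pq show "p * q + q\<^sup>2 \<le> (3/2) * (p\<^sup>2 + q\<^sup>2)" unfolding distrib_left by linarith
    qed
    finally have "2 * W + 2 * S \<le> (p\<^sup>2 + q\<^sup>2) + 2 * (K * ((3/2) * (p\<^sup>2 + q\<^sup>2)))"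
      using W pq by linarith
    also have "\<dots> = k * N t" unfolding N k_def by (simp add: distrib_right)
    finally have "2 * W + 2 * S \<le> k * N t" .
    then show ?thesis unfolding N'_def S_def W_def .
  qed
  define E where "E t = exp (- k * t) * N t" for t
  have N0: "0 \<le> N t" for t by (simp add: N_def)
  have "E t \<le> E 0"
  proof (rule DERIV_nonpos_imp_decreasing_open[of 0 t E])
    show "0 \<le> t" using t by simp
    have "continuous_on {0..1} N"
      using has_vector_derivative_continuous[OF dN] by (simp add: continuous_on_eq_continuous_within)
    then have cN: "continuous_on {0..t} N" by (rule continuous_on_subset) (use t in auto)
    have "continuous_on {0..t} (\<lambda>t. exp (- k * t))" by (intro continuous_intros)
    from continuous_on_mult[OF this cN] show "continuous_on {0..t} E" unfolding E_def .
    fix s assume s: "0 < s" "s < t"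
    then have "at s within {0..1} = at s" using t by (intro at_within_interior) auto
    then have dNs: "(N has_real_derivative N' s) (at s)"
      using dN[of s] s t by (simp add: has_real_derivative_iff_has_vector_derivative)
    have dex: "((\<lambda>t. exp (- k * t)) has_real_derivative exp (- k * s) * (- k)) (at s)"
      by (auto intro!: derivative_eq_intros)
    have "(E has_real_derivative exp (- k * s) * (N' s - k * N s)) (at s)"
      unfolding E_def[abs_def] by (rule DERIV_cong[OF DERIV_mult'[OF dex dNs]]) (simp add: algebra_simps)
    moreover have "exp (- k * s) * (N' s - k * N s) \<le> 0"
      using le[of s] s t by (auto simp: mult_le_0_iff)
    ultimately show "\<exists>y. (E has_real_derivative y) (at s) \<and> y \<le> 0" by blast
  qed
  moreover have "E 0 = 0" by (simp add: E_def N_def init)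
  ultimately have "N t \<le> 0" by (auto simp: E_def mult_le_0_iff)
  then have "(c t - b t) \<bullet> (c t - b t) \<le> 0"
    unfolding N_def using inner_ge_zero[of "c' t - b' t"] by linarith
  then show ?thesis by (metis inner_ge_zero antisym inner_eq_zero_iff right_minus_eq)
qed

lemma geodesic_scale:
  assumes c: "geodesic c c'" and s: "s \<in> {0..1}"
  shows "geodesic (\<lambda>t. c (s * t)) (\<lambda>t. s *\<^sub>R c' (s * t))"
  unfolding geodesic_def
proof (intro ballI conjI)
  fix t :: real assume t: "t \<in> {0..1}"
  have st: "s * t \<in> {0..1}" if "t \<in> {0..1}" for t using s that by (auto simp: mult_le_one)
  have im: "(\<lambda>t. s * t) ` {0..1} \<subseteq> {0..1}" using st by blast
  have l: "((\<lambda>t. s * t) has_vector_derivative s) (at t within {0..1})"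
    by (auto intro!: derivative_eq_intros)
  have 1: "((c \<circ> (\<lambda>t. s * t)) has_vector_derivative s *\<^sub>R c' (s * t)) (at t within {0..1})"
    by (rule vector_diff_chain_within[OF l has_vector_derivative_within_subset[OF geodesicD(1)[OF c st[OF t]] im]])
  have 2: "((c' \<circ> (\<lambda>t. s * t)) has_vector_derivative s *\<^sub>R accel (c (s * t)) (c' (s * t))) (at t within {0..1})"
    by (rule vector_diff_chain_within[OF l has_vector_derivative_within_subset[OF geodesicD(2)[OF c st[OF t]] im]])
  show "((\<lambda>t. c (s * t)) has_vector_derivative s *\<^sub>R c' (s * t)) (at t within {0..1})"
    using 1 by (simp add: o_def)
  have "accel (c (s * t)) (s *\<^sub>R c' (s * t)) = s *\<^sub>R (s *\<^sub>R accel (c (s * t)) (c' (s * t)))"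
    by (simp add: accel_def vec_eq_iff sum_distrib_left mult_ac)
  then show "((\<lambda>t. s *\<^sub>R c' (s * t)) has_vector_derivative accel (c (s * t)) (s *\<^sub>R c' (s * t))) (at t within {0..1})"
    using bounded_linear.has_vector_derivative[OF bounded_linear_scaleR_right 2, of s] by (simp add: o_def)
qed

text \<open>Uniqueness makes the definite description in \<open>riem_exp\<close> meaningful, and
  homogeneity turns rays into geodesics.\<close>

lemma riem_exp_eq:
  assumes c: "geodesic c c'" "c 0 = x" "c' 0 = v" and s: "s \<in> {0..1}"
  shows "riem_exp g x (s *\<^sub>R v) = c s"
  unfolding riem_exp_def
proof (rule the_equality)
  show "exp_graph g x (s *\<^sub>R v) (c s)"
    unfolding exp_graph_eq using geodesic_scale[OF c(1) s] c(2,3)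
    by (intro exI[of _ "\<lambda>t. c (s * t)"] exI[of _ "\<lambda>t. s *\<^sub>R c' (s * t)"]) auto
  fix y assume "exp_graph g x (s *\<^sub>R v) y"
  then obtain b b' where b: "geodesic b b'" "b 0 = x" "b' 0 = s *\<^sub>R v" "b 1 = y"
    unfolding exp_graph_eq by blast
  then show "y = c s"
    using geodesic_unique[OF b(1) geodesic_scale[OF c(1) s], of 1] c by simp
qed

end

lemma sum_rotate3:
  fixes f :: "'a::finite \<Rightarrow> 'a \<Rightarrow> 'a \<Rightarrow> 'b::comm_monoid_add"
  shows "(\<Sum>j\<in>UNIV. \<Sum>i\<in>UNIV. \<Sum>k\<in>UNIV. f i k j) = (\<Sum>j\<in>UNIV. \<Sum>i\<in>UNIV. \<Sum>k\<in>UNIV. f j i k)"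
proof -
  have "(\<Sum>j\<in>UNIV. \<Sum>i\<in>UNIV. \<Sum>k\<in>UNIV. f i k j) = (\<Sum>i\<in>UNIV. \<Sum>j\<in>UNIV. \<Sum>k\<in>UNIV. f i k j)"
    by (rule sum.swap)
  also have "\<dots> = (\<Sum>i\<in>UNIV. \<Sum>k\<in>UNIV. \<Sum>j\<in>UNIV. f i k j)"
    by (rule sum.cong[OF refl sum.swap])
  finally show ?thesis .
qed

context framed_space
begin

section \<open>Conservation of energy along geodesics\<close>

abbreviation "dg l i j \<equiv> partial l (\<lambda>y. g y $ i $ j)"

lemma dg_sym: "dg l i j = dg l j i"
  by (simp add: metric_symmetric)

lemma metric_differentiable: "(\<lambda>y. g y $ i $ j) differentiable (at x)"
  using Ck_on_imp_differentiable[OF Ck_metric[of 1]] by simp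

lemma metric_inner_sum: "metric_inner g x v w = (\<Sum>i\<in>UNIV. \<Sum>j\<in>UNIV. g x $ i $ j * v $ i * w $ j)"
  by (simp add: metric_inner_def inner_vec_def matrix_vector_mult_def sum_distrib_left mult_ac)

lemma metric_accel:
  "(\<Sum>k\<in>UNIV. g x $ m $ k * accel x v $ k)
    = - (1/2) * (\<Sum>i\<in>UNIV. \<Sum>j\<in>UNIV. (dg i j m x + dg j i m x - dg m i j x) * v $ i * v $ j)"
proof -
  have chr: "(\<Sum>k\<in>UNIV. g x $ m $ k * christoffel g k i j x) = (1/2) * (dg i j m x + dg j i m x - dg m i j x)" for i j
  proof -
    let ?B = "\<lambda>l. dg i j l x + dg j i l x - dg l i j x"
    have "(\<Sum>k\<in>UNIV. g x $ m $ k * christoffel g k i j x)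
        = (1/2) * (\<Sum>k\<in>UNIV. \<Sum>l\<in>UNIV. g x $ m $ k * matrix_inv (g x) $ k $ l * ?B l)"
      by (simp add: christoffel_def sum_distrib_left sum_divide_distrib mult_ac)
    also have "(\<Sum>k\<in>UNIV. \<Sum>l\<in>UNIV. g x $ m $ k * matrix_inv (g x) $ k $ l * ?B l)
        = (\<Sum>l\<in>UNIV. \<Sum>k\<in>UNIV. g x $ m $ k * matrix_inv (g x) $ k $ l * ?B l)" by (rule sum.swap)
    also have "\<dots> = (\<Sum>l\<in>UNIV. (g x ** matrix_inv (g x)) $ m $ l * ?B l)"
      by (simp add: matrix_matrix_mult_def sum_distrib_right)
    also have "\<dots> = ?B m"
      unfolding matrix_inv_left_right(1)[OF det_metric] by (simp add: mat_def if_distrib[of "\<lambda>z. z * _"] cong: if_cong)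
    finally show ?thesis .
  qed
  have "(\<Sum>k\<in>UNIV. g x $ m $ k * accel x v $ k)
      = - (\<Sum>k\<in>UNIV. \<Sum>i\<in>UNIV. \<Sum>j\<in>UNIV. g x $ m $ k * christoffel g k i j x * v $ i * v $ j)"
    by (simp add: accel_def sum_distrib_left sum_negf mult_ac)
  also have "(\<Sum>k\<in>UNIV. \<Sum>i\<in>UNIV. \<Sum>j\<in>UNIV. g x $ m $ k * christoffel g k i j x * v $ i * v $ j)
      = (\<Sum>i\<in>UNIV. \<Sum>j\<in>UNIV. \<Sum>k\<in>UNIV. g x $ m $ k * christoffel g k i j x * v $ i * v $ j)"
    by (rule sum_rotate3)
  also have "\<dots> = (\<Sum>i\<in>UNIV. \<Sum>j\<in>UNIV. (1/2) * (dg i j m x + dg j i m x - dg m i j x) * v $ i * v $ j)"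
    by (simp only: sum_distrib_right[symmetric] chr)
  finally show ?thesis by (simp only: sum_distrib_left mult.assoc mult_minus_left sum_negf)
qed

text \<open>The covector dual to the velocity. Lowering the index cancels the inverse metric, so its
  derivative along a geodesic contains no Christoffel symbols.\<close>

definition momentum :: "(real \<Rightarrow> real^'n) \<Rightarrow> (real \<Rightarrow> real^'n) \<Rightarrow> 'n \<Rightarrow> real \<Rightarrow> real"
  where "momentum c c' m t = (\<Sum>j\<in>UNIV. g (c t) $ m $ j * c' t $ j)"

text \<open>The geodesic equation in Euler--Lagrange form.\<close>

lemma momentum_deriv:
  assumes c: "geodesic c c'" and t: "t \<in> {0..1}"
  shows "(momentum c c' m has_real_derivative (1/2) * (\<Sum>i\<in>UNIV. \<Sum>j\<in>UNIV. dg m i j (c t) * c' t $ i * c' t $ j)) (at t within {0..1})"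
proof -
  let ?v = "c' t" and ?x = "c t"
  let ?S = "\<Sum>i\<in>UNIV. \<Sum>j\<in>UNIV. dg i j m ?x * ?v $ i * ?v $ j"
  have "(momentum c c' m has_real_derivative
    (\<Sum>j\<in>UNIV. (\<Sum>l\<in>UNIV. ?v $ l * dg l m j ?x) * ?v $ j + accel ?x ?v $ j * g ?x $ m $ j)) (at t within {0..1})"
    unfolding momentum_def[abs_def]
    by (intro DERIV_sum DERIV_mult has_real_derivative_along metric_differentiable
        has_real_derivative_nth geodesicD[OF c t])
  moreover have "(\<Sum>j\<in>UNIV. (\<Sum>l\<in>UNIV. ?v $ l * dg l m j ?x) * ?v $ j + accel ?x ?v $ j * g ?x $ m $ j)
      = (1/2) * (\<Sum>i\<in>UNIV. \<Sum>j\<in>UNIV. dg m i j ?x * ?v $ i * ?v $ j)"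
  proof -
    have "(\<Sum>j\<in>UNIV. (\<Sum>l\<in>UNIV. ?v $ l * dg l m j ?x) * ?v $ j) = (\<Sum>j\<in>UNIV. \<Sum>l\<in>UNIV. dg l j m ?x * ?v $ l * ?v $ j)"
      unfolding sum_distrib_right by (simp only: dg_sym[of _ m] mult_ac)
    also have "\<dots> = ?S" by (rule sum.swap)
    finally have 1: "(\<Sum>j\<in>UNIV. (\<Sum>l\<in>UNIV. ?v $ l * dg l m j ?x) * ?v $ j) = ?S" .
    have "(\<Sum>j\<in>UNIV. accel ?x ?v $ j * g ?x $ m $ j)
        = - (1/2) * (\<Sum>i\<in>UNIV. \<Sum>j\<in>UNIV. (dg i j m ?x + dg j i m ?x - dg m i j ?x) * ?v $ i * ?v $ j)"
      using metric_accel[of ?x m ?v] by (simp only: mult.commute)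
    also have "(\<Sum>i\<in>UNIV. \<Sum>j\<in>UNIV. (dg i j m ?x + dg j i m ?x - dg m i j ?x) * ?v $ i * ?v $ j)
        = ?S + (\<Sum>i\<in>UNIV. \<Sum>j\<in>UNIV. dg j i m ?x * ?v $ i * ?v $ j) - (\<Sum>i\<in>UNIV. \<Sum>j\<in>UNIV. dg m i j ?x * ?v $ i * ?v $ j)"
      by (simp only: distrib_right left_diff_distrib sum.distrib sum_subtractf)
    also have "(\<Sum>i\<in>UNIV. \<Sum>j\<in>UNIV. dg j i m ?x * ?v $ i * ?v $ j) = ?S"
      by (subst sum.swap) (simp only: mult_ac)
    finally have 2: "(\<Sum>j\<in>UNIV. accel ?x ?v $ j * g ?x $ m $ j) = - (1/2) * (?S + ?S - (\<Sum>i\<in>UNIV. \<Sum>j\<in>UNIV. dg m i j ?x * ?v $ i * ?v $ j))" .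
    have arith: "a + - (1/2) * (a + a - b) = (1/2) * b" for a b :: real by (simp add: field_simps)
    show ?thesis unfolding sum.distrib 1 2 by (rule arith)
  qed
  ultimately show ?thesis by simp
qed

text \<open>The energy is the momentum paired with the velocity. After relabelling, every term of
  its derivative is a multiple of the same triple sum, with factors 1/2 and - 1/2.\<close>

lemma geodesic_energy:
  assumes c: "geodesic c c'" and t: "t \<in> {0..1}"
  shows "metric_inner g (c t) (c' t) (c' t) = metric_inner g (c 0) (c' 0) (c' 0)"
proof -
  define e where "e t = (\<Sum>m\<in>UNIV. momentum c c' m t * c' t $ m)" for t
  have e: "e t = metric_inner g (c t) (c' t) (c' t)" for t
    by (simp add: e_def momentum_def metric_inner_sum sum_distrib_left sum_distrib_right mult_ac)
  have "(e has_field_derivative 0) (at t within {0..1})" if t: "t \<in> {0..1}" for t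
  proof -
    let ?v = "c' t" and ?x = "c t"
    let ?T = "\<Sum>j\<in>UNIV. \<Sum>i\<in>UNIV. \<Sum>k\<in>UNIV. dg j i k ?x * ?v $ j * ?v $ i * ?v $ k"
    have d: "(e has_real_derivative (\<Sum>m\<in>UNIV. ((1/2) * (\<Sum>i\<in>UNIV. \<Sum>j\<in>UNIV. dg m i j ?x * ?v $ i * ?v $ j)) * ?v $ m
        + accel ?x ?v $ m * momentum c c' m t)) (at t within {0..1})"
      unfolding e_def[abs_def]
      by (intro DERIV_sum DERIV_mult momentum_deriv[OF c t] has_real_derivative_nth geodesicD[OF c t])
    have 1: "(\<Sum>m\<in>UNIV. ((1/2) * (\<Sum>i\<in>UNIV. \<Sum>j\<in>UNIV. dg m i j ?x * ?v $ i * ?v $ j)) * ?v $ m) = (1/2) * ?T"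
      by (simp add: sum_distrib_left sum_distrib_right mult_ac)
    have "(\<Sum>m\<in>UNIV. accel ?x ?v $ m * momentum c c' m t) = (\<Sum>m\<in>UNIV. \<Sum>j\<in>UNIV. ?v $ j * (g ?x $ j $ m * accel ?x ?v $ m))"
      by (simp add: momentum_def sum_distrib_left metric_symmetric[of ?x] mult_ac)
    also have "\<dots> = (\<Sum>j\<in>UNIV. ?v $ j * (\<Sum>m\<in>UNIV. g ?x $ j $ m * accel ?x ?v $ m))"
      by (subst sum.swap) (simp only: sum_distrib_left)
    also have "\<dots> = - (1/2) * (\<Sum>j\<in>UNIV. \<Sum>i\<in>UNIV. \<Sum>k\<in>UNIV. (dg i k j ?x + dg k i j ?x - dg j i k ?x) * ?v $ i * ?v $ k * ?v $ j)"
      unfolding metric_accel by (simp add: sum_distrib_left mult_ac)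
    also have "(\<Sum>j\<in>UNIV. \<Sum>i\<in>UNIV. \<Sum>k\<in>UNIV. (dg i k j ?x + dg k i j ?x - dg j i k ?x) * ?v $ i * ?v $ k * ?v $ j)
      = (\<Sum>j\<in>UNIV. \<Sum>i\<in>UNIV. \<Sum>k\<in>UNIV. dg i k j ?x * ?v $ i * ?v $ k * ?v $ j)
      + (\<Sum>j\<in>UNIV. \<Sum>i\<in>UNIV. \<Sum>k\<in>UNIV. dg k i j ?x * ?v $ i * ?v $ k * ?v $ j)
      - (\<Sum>j\<in>UNIV. \<Sum>i\<in>UNIV. \<Sum>k\<in>UNIV. dg j i k ?x * ?v $ i * ?v $ k * ?v $ j)"
      by (simp only: distrib_right left_diff_distrib sum.distrib sum_subtractf)
    also have "(\<Sum>j\<in>UNIV. \<Sum>i\<in>UNIV. \<Sum>k\<in>UNIV. dg i k j ?x * ?v $ i * ?v $ k * ?v $ j) = ?T"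
      by (rule sum_rotate3)
    also have "(\<Sum>j\<in>UNIV. \<Sum>i\<in>UNIV. \<Sum>k\<in>UNIV. dg k i j ?x * ?v $ i * ?v $ k * ?v $ j) = ?T"
    proof -
      have "(\<Sum>j\<in>UNIV. \<Sum>i\<in>UNIV. \<Sum>k\<in>UNIV. dg k i j ?x * ?v $ i * ?v $ k * ?v $ j)
        = (\<Sum>j\<in>UNIV. \<Sum>k\<in>UNIV. \<Sum>i\<in>UNIV. dg k i j ?x * ?v $ k * ?v $ i * ?v $ j)"
        by (rule sum.cong[OF refl], subst sum.swap) (simp only: mult_ac)
      also have "\<dots> = ?T" by (rule sum_rotate3)
      finally show ?thesis .
    qed
    also have "(\<Sum>j\<in>UNIV. \<Sum>i\<in>UNIV. \<Sum>k\<in>UNIV. dg j i k ?x * ?v $ i * ?v $ k * ?v $ j) = ?T"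
      by (intro sum.cong refl) simp
    finally have 2: "(\<Sum>m\<in>UNIV. accel ?x ?v $ m * momentum c c' m t) = - (1/2) * ?T" by simp
    have "(\<Sum>m\<in>UNIV. ((1/2) * (\<Sum>i\<in>UNIV. \<Sum>j\<in>UNIV. dg m i j ?x * ?v $ i * ?v $ j)) * ?v $ m
        + accel ?x ?v $ m * momentum c c' m t) = 0"
      unfolding sum.distrib 1 2 by simp
    then show ?thesis using d by simp
  qed
  then obtain k where "\<forall>t\<in>{0..1}. e t = k"
    using has_field_derivative_zero_constant[of "{0..1}" e] by blast
  then show ?thesis using t by (auto simp: e)
qed

end

section \<open>The exponential map on a ball within the injectivity radius\<close>

locale exp_ball = framed_space A for A :: "real^'n::finite \<Rightarrow> real^'n^'n" +
  fixes x0 :: "real^'n" and r :: real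
  assumes exp_exists: "\<And>v. metric_norm g x0 v < r \<Longrightarrow> \<exists>y. exp_graph g x0 v y"
    and diffeo: "diffeo_onto_image {v. metric_norm g x0 v < r} (riem_exp g x0)"
begin

abbreviation "B \<equiv> {v. metric_norm g x0 v < r}"
abbreviation "F \<equiv> riem_exp g x0"

definition J :: "real^'n \<Rightarrow> real^'n^'n" where "J b = (\<chi> k l. partial l (\<lambda>b. F b $ k) b)"

lemma open_B: "open B"
proof -
  have "continuous_on UNIV (metric_norm g x0)"
    using continuous_on_metric_norm[of UNIV "\<lambda>_. x0" "\<lambda>v. v"] by (simp add: continuous_on_const continuous_on_id)
  then show ?thesis by (intro open_Collect_less continuous_on_const)
qed

lemma scale_B: "v \<in> B \<Longrightarrow> t \<in> {0..1} \<Longrightarrow> t *\<^sub>R v \<in> B"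
  using mult_left_le_one_le[of "metric_norm g x0 v" t] by (auto simp: metric_norm_scale)

lemma Ck_F: "Ck_on m B (\<lambda>b. F b $ k)"
  using diffeo by (simp add: diffeo_onto_image_def smooth_map_on_def smooth_on_def)

lemma F_differentiable: "b \<in> B \<Longrightarrow> (\<lambda>b. F b $ k) differentiable (at b)"
  using Ck_on_imp_differentiable[OF Ck_F[of 1 k]] by simp

lemma Ck_J: "Ck_on m B (\<lambda>b. J b $ k $ l)"
  using Ck_F[of "Suc m" k] by (simp add: J_def)

lemma J_differentiable: "b \<in> B \<Longrightarrow> (\<lambda>b. J b $ k $ l) differentiable (at b)"
  using Ck_on_imp_differentiable[OF Ck_J[of 1 k l]] by simp

lemma J_mult: "(J b *v w) $ k = (\<Sum>l\<in>UNIV. w $ l * partial l (\<lambda>b. F b $ k) b)"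
  by (simp add: J_def matrix_vector_mult_def mult.commute)

lemma partial_J_commute:
  assumes "b \<in> B" shows "partial p (\<lambda>b. J b $ k $ l) b = partial l (\<lambda>b. J b $ k $ p) b"
  using partial_commute[OF Ck_F[of 2 k] open_B assms, of p l] by (simp add: J_def)

lemma has_derivative_F:
  assumes "b \<in> B" shows "(F has_derivative (\<lambda>v. J b *v v)) (at b)"
proof -
  have "((\<lambda>b. F b $ k) has_derivative (\<lambda>v. (J b *v v) $ k)) (at b)" for k
    using has_derivative_partial[OF F_differentiable[OF assms]] by (simp add: J_mult)
  then show ?thesis
    unfolding has_derivative_componentwise_within[of F] by (auto simp: Basis_vec_def inner_axis)
qed

lemma exp_ray:
  assumes v: "v \<in> B"
  obtains c c' where "geodesic c c'" "c 0 = x0" "c' 0 = v"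
    "\<And>t. t \<in> {0..1} \<Longrightarrow> c t = F (t *\<^sub>R v)" "\<And>t. t \<in> {0..1} \<Longrightarrow> c' t = J (t *\<^sub>R v) *v v"
proof -
  obtain c c' where c: "geodesic c c'" "c 0 = x0" "c' 0 = v"
    using exp_exists[of v] v unfolding exp_graph_eq by auto
  have F: "c t = F (t *\<^sub>R v)" if "t \<in> {0..1}" for t
    using riem_exp_eq[OF c that] by simp
  have "c' t = J (t *\<^sub>R v) *v v" if t: "t \<in> {0..1}" for t
  proof -
    have l: "((\<lambda>t. t *\<^sub>R v) has_vector_derivative v) (at t within {0..1})"
      by (auto intro!: derivative_eq_intros)
    have "((F \<circ> (\<lambda>t. t *\<^sub>R v)) has_vector_derivative J (t *\<^sub>R v) *v v) (at t within {0..1})"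
      by (rule vector_derivative_diff_chain_within[OF l has_derivative_at_withinI[OF has_derivative_F[OF scale_B[OF v t]]]])
    then have "(c has_vector_derivative J (t *\<^sub>R v) *v v) (at t within {0..1})"
      by (rule has_vector_derivative_transform[OF t, rotated]) (simp add: F)
    then show ?thesis
      using vector_derivative_unique_within_closed_interval[of 0 1 t c] geodesicD(1)[OF c(1) t] t by auto
  qed
  with c F show ?thesis by (rule that)
qed

lemma exp_energy:
  assumes b: "b \<in> B"
  shows "metric_inner g (F b) (J b *v b) (J b *v b) = metric_inner g x0 b b"
proof -
  obtain c c' where c: "geodesic c c'" "c 0 = x0" "c' 0 = b"
    "\<And>t. t \<in> {0..1} \<Longrightarrow> c t = F (t *\<^sub>R b)" "\<And>t. t \<in> {0..1} \<Longrightarrow> c' t = J (t *\<^sub>R b) *v b"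
    using exp_ray[OF b] by metis
  show ?thesis using geodesic_energy[OF c(1), of 1] c(2,3) c(4,5)[of 1] by simp
qed

text \<open>
  Gauss lemma. The derivative of the energy identity \<open>exp_energy\<close> at \<open>t v\<close> in the direction \<open>w\<close>
  turns the time derivative of \<open>\<langle>momentum, t J(t v) w\<rangle>\<close> into the constant \<open>\<langle>v, w\<rangle>\<close>.
\<close>

lemma gauss_lemma:
  assumes v: "v \<in> B"
  shows "metric_inner g (F v) (J v *v v) (J v *v w) = metric_inner g x0 v w"
proof -
  obtain c c' where c: "geodesic c c'" "c 0 = x0" "c' 0 = v"
    "\<And>t. t \<in> {0..1} \<Longrightarrow> c t = F (t *\<^sub>R v)" "\<And>t. t \<in> {0..1} \<Longrightarrow> c' t = J (t *\<^sub>R v) *v v"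
    using exp_ray[OF v] by metis
  let ?P = "momentum c c'"
  let ?\<kappa> = "metric_inner g x0 v w"
  define W where "W m t = (J (t *\<^sub>R v) *v w) $ m" for m t
  \<comment> \<open>This is the derivative of \<open>W\<close> in \<open>t\<close>. By symmetry of
    second derivatives, \<open>t * Q\<close> is also the part of the derivative of
    \<open>J b *v b\<close> in direction \<open>w\<close> that comes from \<open>J\<close>.\<close>
  define Q where "Q m t = (\<Sum>l\<in>UNIV. w $ l * (\<Sum>p\<in>UNIV. v $ p * partial p (\<lambda>b. J b $ m $ l) (t *\<^sub>R v)))" for m t
  have dW: "(W m has_real_derivative Q m t) (at t within {0..1})" if t: "t \<in> {0..1}" for m t
  proof -
    have l: "((\<lambda>t. t *\<^sub>R v) has_vector_derivative v) (at t within {0..1})"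
      by (auto intro!: derivative_eq_intros)
    have "((\<lambda>t. w $ l * J (t *\<^sub>R v) $ m $ l) has_real_derivative w $ l * (\<Sum>p\<in>UNIV. v $ p * partial p (\<lambda>b. J b $ m $ l) (t *\<^sub>R v))) (at t within {0..1})" for l
      by (rule DERIV_cmult[OF has_real_derivative_along[where c="\<lambda>t. t *\<^sub>R v", OF J_differentiable[OF scale_B[OF v t]] l]])
    from DERIV_sum[of UNIV, OF this] show ?thesis
      by (simp add: W_def[abs_def] Q_def matrix_vector_mult_def mult.commute)
  qed
  \<comment> \<open>\<open>t * W m t\<close> is the Jacobi field of the variation through the rays
    of \<open>v + s w\<close>, so \<open>h\<close> is its inner product with the velocity.\<close>
  define h where "h t = (\<Sum>m\<in>UNIV. ?P m t * (t * W m t))" for t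
  define h' where "h' t = (\<Sum>m\<in>UNIV. ((1/2) * (\<Sum>i\<in>UNIV. \<Sum>j\<in>UNIV. dg m i j (c t) * c' t $ i * c' t $ j)) * (t * W m t)
      + (1 * W m t + Q m t * t) * ?P m t)" for t
  have dh: "(h has_real_derivative h' t) (at t within {0..1})" if t: "t \<in> {0..1}" for t
    unfolding h_def[abs_def] h'_def
    by (intro DERIV_sum DERIV_mult momentum_deriv[OF c(1) t] dW[OF t] DERIV_ident)
  \<comment> \<open>The differentiated energy identity carries a factor \<open>2 * t\<close> on both
    sides, hence the open interval. The ends are reached by continuity of \<open>h\<close>, and
    \<open>h 0 = 0\<close>, so integration over the unit interval yields the claim.\<close>
  have h': "h' t = ?\<kappa>" if t: "0 < t" "t < 1" for t
  proof -
    have t01: "t \<in> {0..1}" using t by simp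
    have tB: "t *\<^sub>R v \<in> B" using scale_B[OF v t01] .
    define b where "b s = t *\<^sub>R v + s *\<^sub>R w" for s :: real
    have b0: "b 0 = t *\<^sub>R v" by (simp add: b_def)
    have db: "(b has_vector_derivative w) (at 0)"
      unfolding b_def[abs_def] by (auto intro!: derivative_eq_intros)
    define z where "z i s = (J (b s) *v b s) $ i" for i s
    have dz: "(z i has_real_derivative t * Q i t + W i t) (at 0)" for i
    proof -
      have "((\<lambda>s. J (b s) $ i $ l * b s $ l) has_real_derivative
          (\<Sum>p\<in>UNIV. w $ p * partial p (\<lambda>b. J b $ i $ l) (b 0)) * b 0 $ l + w $ l * J (b 0) $ i $ l) (at 0)" for l
        by (intro DERIV_mult has_real_derivative_along[where c=b] has_real_derivative_nth db J_differentiable)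
          (use tB in \<open>simp add: b0\<close>)
      from DERIV_sum[of UNIV, OF this]
      have "(z i has_real_derivative (\<Sum>l\<in>UNIV. (\<Sum>p\<in>UNIV. w $ p * partial p (\<lambda>b. J b $ i $ l) (b 0)) * b 0 $ l + w $ l * J (b 0) $ i $ l)) (at 0)"
        by (simp add: z_def[abs_def] matrix_vector_mult_def)
      moreover have "(\<Sum>l\<in>UNIV. (\<Sum>p\<in>UNIV. w $ p * partial p (\<lambda>b. J b $ i $ l) (b 0)) * b 0 $ l + w $ l * J (b 0) $ i $ l)
          = t * Q i t + W i t"
      proof -
        have "(\<Sum>l\<in>UNIV. (\<Sum>p\<in>UNIV. w $ p * partial p (\<lambda>b. J b $ i $ l) (b 0)) * b 0 $ l)
            = (\<Sum>l\<in>UNIV. \<Sum>p\<in>UNIV. t * (w $ p * (v $ l * partial l (\<lambda>b. J b $ i $ p) (t *\<^sub>R v))))"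
          unfolding b0 partial_J_commute[OF tB, of _ i] sum_distrib_right
          by (intro sum.cong refl) simp
        also have "\<dots> = (\<Sum>p\<in>UNIV. \<Sum>l\<in>UNIV. t * (w $ p * (v $ l * partial l (\<lambda>b. J b $ i $ p) (t *\<^sub>R v))))"
          by (rule sum.swap)
        also have "\<dots> = t * Q i t" by (simp add: Q_def sum_distrib_left)
        finally show ?thesis
          by (simp add: sum.distrib W_def b0 matrix_vector_mult_def mult.commute)
      qed
      ultimately show ?thesis by simp
    qed
    have z0: "z i 0 = t * c' t $ i" for i
      using c(5)[OF t01] by (simp add: z_def b0 matrix_vector_mult_scaleR)
    have dF: "((\<lambda>s. F (b s)) has_vector_derivative J (t *\<^sub>R v) *v w) (at 0)"
      using vector_derivative_diff_chain_within[OF db has_derivative_at_withinI[OF has_derivative_F]] tB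
      by (simp add: o_def b0)
    define En where "En s = (\<Sum>i\<in>UNIV. \<Sum>j\<in>UNIV. g (F (b s)) $ i $ j * z i s * z j s)" for s
    let ?G = "\<lambda>i j. g (c t) $ i $ j"
    let ?z' = "\<lambda>i. t * Q i t + W i t"
    have ct: "F (b 0) = c t" using c(4)[OF t01] by (simp add: b0)
    have dEn: "(En has_real_derivative (\<Sum>i\<in>UNIV. \<Sum>j\<in>UNIV.
        ((\<Sum>k\<in>UNIV. W k t * dg k i j (c t)) * z i 0 + ?z' i * ?G i j) * z j 0 + ?z' j * (?G i j * z i 0))) (at 0)"
    proof -
      have "((\<lambda>s. g (F (b s)) $ i $ j) has_real_derivative (\<Sum>k\<in>UNIV. W k t * dg k i j (c t))) (at 0)" for i j
        using has_real_derivative_along[where c="\<lambda>s. F (b s)", OF metric_differentiable dF, of i j] by (simp add: ct W_def)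
      from DERIV_mult[OF DERIV_mult[OF this dz] dz] show ?thesis
        unfolding En_def[abs_def] ct by (intro DERIV_sum) 
    qed
    have "(\<lambda>s. metric_inner g x0 (b s) (b s)) = (\<lambda>s. t\<^sup>2 * metric_inner g x0 v v + 2 * s * t * ?\<kappa> + s\<^sup>2 * metric_inner g x0 w w)"
    proof
      fix s
      have "metric_inner g x0 w v = ?\<kappa>" by (simp add: metric_inner_eq inner_commute)
      then show "metric_inner g x0 (b s) (b s) = t\<^sup>2 * metric_inner g x0 v v + 2 * s * t * ?\<kappa> + s\<^sup>2 * metric_inner g x0 w w"
        by (simp add: b_def metric_inner_eq matrix_vector_right_distrib matrix_vector_mult_scaleR inner_add_left inner_add_right power2_eq_square algebra_simps)
    qed
    then have dM: "((\<lambda>s. metric_inner g x0 (b s) (b s)) has_real_derivative 2 * t * ?\<kappa>) (at 0)"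
      by (auto intro!: derivative_eq_intros)
    have "\<forall>\<^sub>F s in nhds 0. b s \<in> B"
    proof -
      have "isCont b 0" using db by (rule has_vector_derivative_continuous)
      then have "(b \<longlongrightarrow> b 0) (nhds 0)" by (rule isCont_tendsto_nhds)
      then show ?thesis by (rule topological_tendstoD[OF _ open_B]) (use tB in \<open>simp add: b0\<close>)
    qed
    then have "\<forall>\<^sub>F s in nhds 0. En s = metric_inner g x0 (b s) (b s)"
      by (rule eventually_mono) (use exp_energy in \<open>simp add: En_def z_def metric_inner_sum\<close>)
    from DERIV_cong_ev[OF refl this refl, THEN iffD2, OF dM]
    have "(En has_real_derivative 2 * t * ?\<kappa>) (at 0)" .
    from DERIV_unique[OF dEn this]
    have eq: "(\<Sum>i\<in>UNIV. \<Sum>j\<in>UNIV. ((\<Sum>k\<in>UNIV. W k t * dg k i j (c t)) * z i 0 + ?z' i * ?G i j) * z j 0 + ?z' j * (?G i j * z i 0)) = 2 * t * ?\<kappa>" .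
    have 1: "(\<Sum>i\<in>UNIV. \<Sum>j\<in>UNIV. (\<Sum>k\<in>UNIV. W k t * dg k i j (c t)) * z i 0 * z j 0)
        = 2 * t * (\<Sum>m\<in>UNIV. ((1/2) * (\<Sum>i\<in>UNIV. \<Sum>j\<in>UNIV. dg m i j (c t) * c' t $ i * c' t $ j)) * (t * W m t))"
    proof -
      have "(\<Sum>i\<in>UNIV. \<Sum>j\<in>UNIV. (\<Sum>k\<in>UNIV. W k t * dg k i j (c t)) * z i 0 * z j 0)
          = (\<Sum>i\<in>UNIV. \<Sum>j\<in>UNIV. \<Sum>k\<in>UNIV. t * t * W k t * (dg k i j (c t) * c' t $ i * c' t $ j))"
        by (simp add: z0 sum_distrib_left sum_distrib_right mult_ac)
      also have "\<dots> = (\<Sum>k\<in>UNIV. \<Sum>i\<in>UNIV. \<Sum>j\<in>UNIV. t * t * W k t * (dg k i j (c t) * c' t $ i * c' t $ j))"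
        by (rule sum_rotate3[symmetric])
      finally show ?thesis by (simp add: sum_distrib_left sum_distrib_right mult_ac)
    qed
    have 2: "(\<Sum>i\<in>UNIV. \<Sum>j\<in>UNIV. ?z' i * ?G i j * z j 0) = t * (\<Sum>m\<in>UNIV. (1 * W m t + Q m t * t) * ?P m t)"
      by (simp add: z0 momentum_def sum_distrib_left algebra_simps)
    have 3: "(\<Sum>i\<in>UNIV. \<Sum>j\<in>UNIV. ?z' j * (?G i j * z i 0)) = t * (\<Sum>m\<in>UNIV. (1 * W m t + Q m t * t) * ?P m t)"
      unfolding 2[symmetric] by (subst sum.swap) (simp add: metric_symmetric[of "c t"] mult_ac)
    have "(\<Sum>i\<in>UNIV. \<Sum>j\<in>UNIV. ((\<Sum>k\<in>UNIV. W k t * dg k i j (c t)) * z i 0 + ?z' i * ?G i j) * z j 0 + ?z' j * (?G i j * z i 0))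
        = (\<Sum>i\<in>UNIV. \<Sum>j\<in>UNIV. (\<Sum>k\<in>UNIV. W k t * dg k i j (c t)) * z i 0 * z j 0)
        + (\<Sum>i\<in>UNIV. \<Sum>j\<in>UNIV. ?z' i * ?G i j * z j 0) + (\<Sum>i\<in>UNIV. \<Sum>j\<in>UNIV. ?z' j * (?G i j * z i 0))"
      unfolding sum.distrib[symmetric]
      by (rule sum.cong[OF refl], rule sum.cong[OF refl], simp only: distrib_right[of "_ * _" "_ * _" "z _ _"])
    from trans[OF eq[symmetric] this, unfolded 1 2 3] have "2 * t * h' t = 2 * t * ?\<kappa>"
      unfolding h'_def sum.distrib distrib_left by linarith
    then show ?thesis using t by simp
  qed
  have "h 1 - ?\<kappa> * 1 = h 0 - ?\<kappa> * 0"
  proof (rule DERIV_isconst_end[of 0 1 "\<lambda>t. h t - ?\<kappa> * t"])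
    have "continuous_on {0..1} h"
      using DERIV_continuous[OF dh] by (simp add: continuous_on_eq_continuous_within)
    then show "continuous_on {0..1} (\<lambda>t. h t - ?\<kappa> * t)" by (intro continuous_on_diff continuous_intros)
    fix t :: real assume t: "0 < t" "t < 1"
    then have "at t within {0..1} = at t" by (intro at_within_interior) auto
    then have "(h has_real_derivative ?\<kappa>) (at t)" using dh[of t] h'[OF t] t by simp
    from DERIV_diff[OF this DERIV_cmult_Id[of ?\<kappa>]] show "((\<lambda>t. h t - ?\<kappa> * t) has_real_derivative 0) (at t)" by simp
  qed simp
  then have "h 1 = ?\<kappa>" by (simp add: h_def)
  moreover have "h 1 = metric_inner g (F v) (J v *v w) (J v *v v)"
    using c(4,5)[of 1]
    by (simp add: h_def W_def momentum_def metric_inner_sum sum_distrib_left sum_distrib_right mult_ac)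
  then have "h 1 = metric_inner g (F v) (J v *v v) (J v *v w)"
    by (simp add: metric_inner_eq inner_commute)
  ultimately show ?thesis by simp
qed

text \<open>By the Gauss lemma the length of the inverse exponential is 1-Lipschitz, so the closed
  metric ball is contained in the image of a closed ball of tangent vectors, which is
  compact.\<close>

lemma compact_riem_cball:
  assumes s: "0 \<le> s" "s < r"
  shows "compact {y. d x0 y \<le> s}"
proof -
  define H where "H = the_inv_into B F"
  have inj: "inj_on F B" and oU: "open (F ` B)" and sm: "smooth_map_on (F ` B) H"
    using diffeo by (auto simp: diffeo_onto_image_def H_def)
  have HF: "H (F b) = b" if "b \<in> B" for b
    using inj that by (simp add: H_def the_inv_into_f_f)
  have zB: "0 \<in> B" using s by (simp add: metric_norm_eq)
  obtain c c' where "geodesic c c'" "c 0 = x0" "\<And>t. t \<in> {0..1} \<Longrightarrow> c t = F (t *\<^sub>R 0)"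
    using exp_ray[OF zB] by metis
  from this(2) this(3)[of 0] have F0: "F 0 = x0" by simp
  have cF: "continuous_on S F" if "S \<subseteq> B" for S
    using has_derivative_F that
    by (intro continuous_at_imp_continuous_on ballI) (blast intro: has_derivative_continuous)
  \<comment> \<open>Confinement needs a level strictly above \<open>s\<close> whose sublevel set is
    still the image of a compact subset of \<open>B\<close>.\<close>
  define s' where "s' = (s + r) / 2"
  have s': "s < s'" "s' < r" "0 \<le> s'" using s by (auto simp: s'_def)
  have K: "compact (F ` {v. metric_norm g x0 v \<le> \<rho>})" if \<rho>: "\<rho> < r" for \<rho>
  proof (rule compact_continuous_image[OF cF])
    have "closed {v. metric_norm g x0 v \<le> \<rho>}"
      using continuous_on_metric_norm[of UNIV "\<lambda>_. x0" "\<lambda>v. v"]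
      by (intro closed_Collect_le) (auto intro: continuous_on_const continuous_on_id)
    moreover have "bounded {v. metric_norm g x0 v \<le> \<rho>}"
    proof -
      obtain C where C: "C > 0" "\<And>v. norm v \<le> C * metric_norm g x0 v"
        using metric_norm_compact_ge[of "{x0}"] by (metis compact_sing singletonI)
      show ?thesis
        unfolding bounded_iff
      proof (intro exI ballI)
        fix v assume "v \<in> {v. metric_norm g x0 v \<le> \<rho>}"
        then show "norm v \<le> C * \<rho>"
          using C(1) by (intro order_trans[OF C(2) mult_left_mono]) auto
      qed
    qed
    ultimately show "compact {v. metric_norm g x0 v \<le> \<rho>}" by (simp add: compact_eq_bounded_closed)
    show "{v. metric_norm g x0 v \<le> \<rho>} \<subseteq> B" using \<rho> by auto
  qed
  define H' where "H' x = (\<lambda>v. \<chi> k. \<Sum>l\<in>UNIV. v $ l * partial l (\<lambda>x. H x $ k) x)" for x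
  have dH: "(H has_derivative H' x) (at x)" if x: "x \<in> F ` B" for x
  proof -
    have "Ck_on 1 (F ` B) (\<lambda>x. H x $ k)" for k
      using sm by (simp add: smooth_map_on_def smooth_on_def del: Ck_on.simps)
    then have "(\<lambda>x. H x $ k) differentiable (at x)" for k
      using Ck_on_imp_differentiable[of 1 "F ` B" "\<lambda>x. H x $ k" x] x by simp
    then have "((\<lambda>x. H x $ k) has_derivative (\<lambda>v. H' x v $ k)) (at x)" for k
      unfolding H'_def vec_lambda_beta by (rule has_derivative_partial)
    then show ?thesis
      unfolding has_derivative_componentwise_within[of H] by (auto simp: Basis_vec_def inner_axis)
  qed
  have JH: "J b *v H' (F b) u = u" if b: "b \<in> B" for b u
  proof -
    have x: "F b \<in> F ` B" using b by blast
    have "(F has_derivative (\<lambda>v. J b *v v)) (at (H (F b)))" using has_derivative_F[OF b] by (simp add: HF[OF b])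
    from has_derivative_compose[OF dH[OF x] this]
    have "((\<lambda>x. F (H x)) has_derivative (\<lambda>u. J b *v H' (F b) u)) (at (F b))" .
    moreover have "F (H y) = y" if "y \<in> F ` B" for y using that HF by auto
    then have "((\<lambda>x. F (H x)) has_derivative (\<lambda>u. u)) (at (F b))"
      using has_derivative_transform_within_open[OF has_derivative_ident oU x, of "\<lambda>x. F (H x)"] by simp
    ultimately show ?thesis using has_derivative_unique by metis
  qed
  \<comment> \<open>Frame coordinates at \<open>x0\<close> turn the g-length of the tangent vector
    into a Euclidean norm.\<close>
  define \<Phi> where "\<Phi> x = coframe x0 *v H x" for x
  define \<Phi>' where "\<Phi>' x v = coframe x0 *v H' x v" for x v
  have d\<Phi>: "(\<Phi> has_derivative \<Phi>' x) (at x)" if "x \<in> F ` B" for x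
    unfolding \<Phi>_def[abs_def] \<Phi>'_def[abs_def]
    by (rule bounded_linear.has_derivative[OF matrix_vector_mul_bounded_linear dH[OF that]])
  have n\<Phi>: "norm (\<Phi> (F b)) = metric_norm g x0 b" if "b \<in> B" for b
    using HF[OF that] by (simp add: \<Phi>_def metric_norm_eq)
  have le: "\<Phi> x \<bullet> \<Phi>' x v \<le> 1 * norm (\<Phi> x) * metric_norm g x v" if x: "x \<in> F ` B" for x v
  proof -
    obtain b where b: "b \<in> B" "x = F b" using x by blast
    have "\<Phi> x \<bullet> \<Phi>' x v = metric_inner g x0 b (H' x v)"
      using b HF by (simp add: \<Phi>_def \<Phi>'_def metric_inner_eq)
    also have "\<dots> = metric_inner g x (J b *v b) v"
      using gauss_lemma[OF b(1), of "H' x v"] JH[OF b(1), of v] b(2) by simp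
    also have "\<dots> \<le> metric_norm g x (J b *v b) * metric_norm g x v" by (rule metric_inner_le)
    also have "metric_norm g x (J b *v b) = norm (\<Phi> x)"
      using exp_energy[OF b(1)] b(2) n\<Phi>[OF b(1)] by (simp add: metric_norm_def)
    finally show ?thesis by simp
  qed
  have eq: "{x \<in> F ` B. norm (\<Phi> x) \<le> \<rho>} = F ` {v. metric_norm g x0 v \<le> \<rho>}" if "\<rho> < r" for \<rho>
    using that n\<Phi> by fastforce
  have cl: "closed {x \<in> F ` B. norm (\<Phi> x) \<le> s'}"
    unfolding eq[OF s'(2)] by (rule compact_imp_closed[OF K[OF s'(2)]])
  have x0U: "x0 \<in> F ` B" using F0 zB by (metis imageI)
  have \<Phi>0: "\<Phi> x0 = 0" using HF[OF zB] F0 by (simp add: \<Phi>_def)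
  have "{y. d x0 y \<le> s} \<subseteq> F ` {v. metric_norm g x0 v \<le> s}"
  proof
    fix y assume "y \<in> {y. d x0 y \<le> s}"
    then have y: "d x0 y \<le> s" and lt: "1 * d x0 y < s'" using s' by auto
    note res = riem_dist_ge_norm[of "F ` B" x0 \<Phi> \<Phi>' 1 s' y, OF oU x0U d\<Phi> le _ cl lt \<Phi>0]
    have "y \<in> {x \<in> F ` B. norm (\<Phi> x) \<le> s}" using res y by auto
    then show "y \<in> F ` {v. metric_norm g x0 v \<le> s}" unfolding eq[OF s(2)] .
  qed
  moreover have "closed {y. d x0 y \<le> s}"
    by (intro closed_Collect_le continuous_on_riem_dist continuous_on_const)
  ultimately show ?thesis
    using K[OF s(2)] by (metis compact_Int_closed inf.absorb_iff2)
qed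

end

context framed_space
begin

text \<open>The injectivity radius is a supremum, so some admissible radius exceeds
  \<open>s\<close>, also when it is infinite.\<close>

lemma compact_riem_cball_inj_radius:
  assumes "ereal s < inj_radius g x0"
  shows "compact {y. d x0 y \<le> s}"
proof (cases "0 \<le> s")
  case True
  obtain r where "ereal s < ereal r" "\<forall>v. metric_norm g x0 v < r \<longrightarrow> (\<exists>y. exp_graph g x0 v y)"
    "diffeo_onto_image {v. metric_norm g x0 v < r} (riem_exp g x0)"
    using assms unfolding inj_radius_def less_Sup_iff by blast
  then interpret exp_ball A x0 r
    by unfold_locales auto
  show ?thesis using compact_riem_cball[OF True] \<open>ereal s < ereal r\<close> by simp
next
  case False
  then have "{y. d x0 y \<le> s} = {}"
    using riem_dist_nonneg by (auto simp: not_le intro: less_le_trans)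
  then show ?thesis by simp
qed

end

section \<open>Hoelder estimates for viscosity solutions\<close>

lemma usc_lsc_imp_continuous_on:
  assumes "usc_on S u" "lsc_on S u"
  shows "continuous_on S u"
  unfolding continuous_on_def
proof (intro ballI order_tendstoI)
  fix x c assume "x \<in> S" "c < u x"
  then show "\<forall>\<^sub>F y in at x within S. c < u y" using assms(2) by (auto simp: lsc_on_def)
next
  fix x c assume "x \<in> S" "u x < c"
  then show "\<forall>\<^sub>F y in at x within S. u y < c" using assms(1) by (auto simp: usc_on_def)
qed

text \<open>For continuous \<open>u\<close> the set where the essential supremum is exceeded is open
  and null, hence empty. Finiteness matters because \<open>real_of_ereal\<close> sends infinity to
  0.\<close>

lemma abs_le_Linf_norm:
  assumes S: "open S" "continuous_on S u" and fin: "Linf_norm S u < \<infinity>" and x: "x \<in> S"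
  shows "\<bar>u x\<bar> \<le> real_of_ereal (Linf_norm S u)"
proof -
  let ?L = "Linf_norm S u"
  define O' where "O' = {y \<in> S. ?L < ereal \<bar>u y\<bar>}"
  have "continuous_on S (\<lambda>y. ereal \<bar>u y\<bar>)" by (intro continuous_intros S(2))
  then have "open (S \<inter> (\<lambda>y. ereal \<bar>u y\<bar>) -` {?L<..})"
    by (rule continuous_open_preimage) (use S(1) in auto)
  then have oO: "open O'" by (simp add: O'_def Int_def vimage_def)
  have "AE y in restrict_space lebesgue S. ereal \<bar>u y\<bar> \<le> ?L"
    unfolding Linf_norm_def by (rule esssup_AE)
  then have "AE y in lebesgue. y \<in> S \<longrightarrow> ereal \<bar>u y\<bar> \<le> ?L"
    using S(1) by (subst (asm) AE_restrict_space_iff) auto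
  then have ae: "AE y in lebesgue. y \<notin> O'" by (rule AE_mp) (auto simp: O'_def)
  have "O' \<in> sets lebesgue" using oO by simp
  then have "negligible O'"
    using ae by (simp add: negligible_iff_null_sets AE_iff_null_sets)
  then have "O' = {}" using open_not_negligible[OF oO] by blast
  then have "ereal \<bar>u x\<bar> \<le> ?L" using x by (auto simp: O'_def not_less)
  then show ?thesis using fin by (cases ?L) auto
qed

context framed_space
begin

lemma frame_grad_uminus:
  assumes "Ck_on 2 UNIV \<psi>"
  shows "frame_grad A (\<lambda>x. - \<psi> x) x = - frame_grad A \<psi> x"
    and "inf_laplacian A (\<lambda>x. - \<psi> x) x = - inf_laplacian A \<psi> x"
proof -
  have neg: "X i (\<lambda>x. - \<phi> x) = (\<lambda>x. - X i \<phi> x)" if "Ck_on 1 UNIV \<phi>" for i \<phi>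
  proof
    fix x
    have "\<phi> differentiable (at x)" using Ck_on_imp_differentiable[OF that] by simp
    then show "X i (\<lambda>x. - \<phi> x) x = - X i \<phi> x" using X_cmult[of \<phi> x i "- 1"] by simp
  qed
  have 1: "Ck_on 1 UNIV \<psi>" using Ck_on_le[OF assms] by (simp del: Ck_on.simps)
  have 2: "Ck_on 1 UNIV (X j \<psi>)" for j
    using Ck_X[of 1 \<psi>] assms by (simp only: numeral_2_eq_2 One_nat_def)
  show "frame_grad A (\<lambda>x. - \<psi> x) x = - frame_grad A \<psi> x"
    by (simp add: frame_grad_def neg[OF 1] vec_eq_iff)
  show "inf_laplacian A (\<lambda>x. - \<psi> x) x = - inf_laplacian A \<psi> x"
    unfolding inf_laplacian_eq_sum neg[OF 1] neg[OF 2] by (simp add: sum_negf)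
qed

text \<open>Within distance \<open>t0\<close> of \<open>y\<close> the comparison is applied to
  \<open>u\<close> and to \<open>- u\<close>: the growth bound is even, so both satisfy the same
  inequality. Farther away the bound is trivial, since \<open>L * t0 powr \<alpha>\<close> already
  exceeds the oscillation \<open>2 * M\<close>.\<close>

lemma viscosity_holder:
  assumes \<Omega>: "open \<Omega>" and growth: "growth_bound \<Omega> f \<beta> C2 C3" and sol: "viscosity_solution A \<Omega> f u"
    and \<alpha>: "0 < \<alpha>" "\<alpha> < 1" and barrier: "holder_barrier \<alpha> \<beta> C2 C3 L t0"
    and Q: "compact {x. d y x \<le> t0}" "{x. d y x \<le> t0} \<subseteq> \<Omega>"
    and bd: "\<And>x. d y x \<le> t0 \<Longrightarrow> \<bar>u x\<bar> \<le> M" and LM: "2 * M \<le> L * t0 powr \<alpha>"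
    and x: "\<bar>u x\<bar> \<le> M"
  shows "\<bar>u x - u y\<bar> \<le> L * d x y powr \<alpha>"
proof (cases "d y x \<le> t0")
  case True
  have t0: "0 < t0" using barrier by (simp add: holder_barrier_def)
  have sub: "viscosity_subsolution A \<Omega> f u" and super: "viscosity_supersolution A \<Omega> f u"
    using sol by (auto simp: viscosity_solution_def)
  have u: "continuous_on \<Omega> u"
    using sub super by (auto simp: viscosity_subsolution_def viscosity_supersolution_def intro: usc_lsc_imp_continuous_on)
  have yM: "\<bar>u y\<bar> \<le> M" using bd[of y] t0 by simp
  have gr: "\<bar>f x0 q \<xi>\<bar> \<le> C2 * rpow (norm \<xi>) \<beta> + C3" if "x0 \<in> \<Omega>" for x0 q \<xi>
    using growth that by (simp add: growth_bound_def)
  have "u x - u y \<le> L * d y x powr \<alpha>"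
  proof (rule holder_comparison[OF \<Omega> u _ \<alpha> barrier Q _ True])
    show "- (C2 * rpow (norm (frame_grad A \<psi> x0)) \<beta> + C3) \<le> inf_laplacian A \<psi> x0"
      if *: "x0 \<in> \<Omega>" "Ck_on 2 UNIV \<psi>" "\<psi> x0 = u x0" "\<forall>\<^sub>F y in nhds x0. u y \<le> \<psi> y" for x0 \<psi>
    proof -
      have "Ck_on 2 \<Omega> \<psi>" using Ck_on_subset[OF *(2)] by simp
      then have "f x0 (\<psi> x0) (frame_grad A \<psi> x0) \<le> inf_laplacian A \<psi> x0"
        using sub * unfolding viscosity_subsolution_def by blast
      then show ?thesis using gr[OF *(1), of "\<psi> x0" "frame_grad A \<psi> x0"] by linarith
    qed
    show "u x - u y \<le> L * t0 powr \<alpha>" if "d y x = t0" for x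
      using bd[of x] that yM LM by linarith
  qed
  moreover have "- u x - - u y \<le> L * d y x powr \<alpha>"
  proof (rule holder_comparison[where u="\<lambda>x. - u x", OF \<Omega> _ _ \<alpha> barrier Q _ True])
    show "continuous_on \<Omega> (\<lambda>x. - u x)" by (intro continuous_intros u)
    show "- (C2 * rpow (norm (frame_grad A \<psi> x0)) \<beta> + C3) \<le> inf_laplacian A \<psi> x0"
      if *: "x0 \<in> \<Omega>" "Ck_on 2 UNIV \<psi>" "\<psi> x0 = - u x0" "\<forall>\<^sub>F y in nhds x0. - u y \<le> \<psi> y" for x0 \<psi>
    proof -
      have "Ck_on 2 \<Omega> (\<lambda>x. - \<psi> x)" using Ck_on_subset[OF Ck_on_uminus[OF *(2)]] by simp
      moreover have "\<forall>\<^sub>F y in nhds x0. - \<psi> y \<le> u y"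
        using *(4) by (rule eventually_mono) linarith
      ultimately have "inf_laplacian A (\<lambda>x. - \<psi> x) x0 \<le> f x0 (- \<psi> x0) (frame_grad A (\<lambda>x. - \<psi> x) x0)"
        using super *(1,3) unfolding viscosity_supersolution_def by simp
      then show ?thesis
        using gr[OF *(1), of "- \<psi> x0" "- frame_grad A \<psi> x0"] by (simp add: frame_grad_uminus[OF *(2)])
    qed
    show "- u x - - u y \<le> L * t0 powr \<alpha>" if "d y x = t0" for x
      using bd[of x] that yM LM by linarith
  qed
  ultimately show ?thesis by (simp add: riem_dist_sym[of x y] abs_le_iff)
next
  case False
  have L: "0 < L" and t0: "0 < t0" using barrier by (auto simp: holder_barrier_def)
  have "\<bar>u x - u y\<bar> \<le> L * t0 powr \<alpha>" using bd[of y] t0 x LM by (simp add: abs_le_iff)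
  also have "\<dots> \<le> L * d x y powr \<alpha>"
    using False t0 \<alpha> L by (intro mult_left_mono powr_mono2) (auto simp: riem_dist_sym[of x y])
  finally show ?thesis .
qed

lemma open_riem_ball: "open (riem_ball g r x)"
proof (cases r)
  case (real s)
  then have "riem_ball g r x = {y. d x y < s}" by (simp add: riem_ball_def)
  then show ?thesis by (simp add: open_Collect_less continuous_on_riem_dist)
qed (auto simp: riem_ball_def)

lemma compact_riem_cball_subset:
  assumes "compact {x. d z x \<le> s}" "d z y + t \<le> s"
  shows "compact {x. d y x \<le> t}" "{x. d y x \<le> t} \<subseteq> {x. d z x \<le> s}"
proof -
  show sub: "{x. d y x \<le> t} \<subseteq> {x. d z x \<le> s}"
  proof
    fix x assume "x \<in> {x. d y x \<le> t}"
    then show "x \<in> {x. d z x \<le> s}" using riem_dist_triangle[of z x y] assms(2) by simp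
  qed
  have "closed {x. d y x \<le> t}"
    by (intro closed_Collect_le continuous_on_riem_dist continuous_on_const)
  then show "compact {x. d y x \<le> t}"
    using compact_Int_closed[OF assms(1)] sub by (metis inf.absorb_iff2)
qed

lemma viscosity_locally_holder:
  assumes \<Omega>: "open \<Omega>" and growth: "growth_bound \<Omega> f \<beta> C2 C3" and sol: "viscosity_solution A \<Omega> f u"
    and \<beta>: "0 \<le> \<beta>" "\<beta> < 4" and C: "0 \<le> C2" "0 \<le> C3" and \<alpha>: "0 < \<alpha>" "\<alpha> < 1"
  shows "locally_holder_on g \<Omega> \<alpha> u"
  unfolding locally_holder_on_def
proof
  fix z assume z: "z \<in> \<Omega>"
  then obtain \<delta> where \<delta>: "\<delta> > 0" "cball z \<delta> \<subseteq> \<Omega>" using \<Omega> open_contains_cball by blast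
  obtain C where C0: "C > 0" "\<And>y. C * d z y < \<delta> \<Longrightarrow> norm (y - z) \<le> C * d z y"
    using norm_diff_le_riem_dist by metis
  \<comment> \<open>The closed metric ball of radius \<open>2 * R\<close> lies in the Euclidean ball
    of radius \<open>\<delta>\<close>, hence is compact. It contains every comparison ball of radius
    \<open>t0 \<le> R\<close> centred within \<open>R\<close> of \<open>z\<close>.\<close>
  define R where "R = \<delta> / (4 * C)"
  have R: "0 < R" using \<delta> C0 by (simp add: R_def)
  have sub: "{x. d z x \<le> 2 * R} \<subseteq> cball z \<delta>"
  proof
    fix x assume "x \<in> {x. d z x \<le> 2 * R}"
    then have "C * d z x \<le> C * (2 * R)" using C0 by (intro mult_left_mono) auto
    also have "\<dots> = \<delta> / 2" using C0 by (simp add: R_def)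
    finally have lt: "C * d z x \<le> \<delta> / 2" .
    then have "norm (x - z) \<le> C * d z x" using \<delta> by (intro C0(2)) simp
    with lt show "x \<in> cball z \<delta>" using \<delta> by (simp add: dist_norm norm_minus_commute)
  qed
  have "closed {x. d z x \<le> 2 * R}"
    by (intro closed_Collect_le continuous_on_riem_dist continuous_on_const)
  then have cpt: "compact {x. d z x \<le> 2 * R}"
    using compact_Int_closed[OF compact_cball[of z \<delta>]] sub by (metis inf.absorb_iff2)
  have "continuous_on \<Omega> u"
    using sol by (auto simp: viscosity_solution_def viscosity_subsolution_def viscosity_supersolution_def intro: usc_lsc_imp_continuous_on)
  then have "continuous_on {x. d z x \<le> 2 * R} u" using sub \<delta> by (meson continuous_on_subset)
  then obtain M where M: "\<And>x. x \<in> {x. d z x \<le> 2 * R} \<Longrightarrow> norm (u x) \<le> M"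
    using continuous_on_compact_bounded[OF cpt] by metis
  obtain L t0 where Lt: "holder_barrier \<alpha> \<beta> C2 C3 L t0" "t0 \<le> R" "2 * M \<le> L * t0 powr \<alpha>"
    using holder_barrier_exists[OF \<alpha> \<beta> C R, of M] by blast
  show "\<exists>U K. open U \<and> z \<in> U \<and> U \<subseteq> \<Omega> \<and> (\<forall>x\<in>U. \<forall>y\<in>U. \<bar>u x - u y\<bar> \<le> K * d x y powr \<alpha>)"
  proof (intro exI[of _ "{x. d z x < R}"] exI[of _ L] conjI ballI)
    show "open {x. d z x < R}" by (simp add: open_Collect_less continuous_on_riem_dist)
    show "z \<in> {x. d z x < R}" using R by simp
    have "{x. d z x < R} \<subseteq> {x. d z x \<le> 2 * R}" using R by auto
    then show "{x. d z x < R} \<subseteq> \<Omega>" using sub \<delta>(2) by blast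
    fix x y assume x: "x \<in> {x. d z x < R}" and y: "y \<in> {x. d z x < R}"
    have s: "d z y + t0 \<le> 2 * R" using y Lt by simp
    note Q = compact_riem_cball_subset[OF cpt s]
    show "\<bar>u x - u y\<bar> \<le> L * d x y powr \<alpha>"
    proof (rule viscosity_holder[OF \<Omega> growth sol \<alpha> Lt(1) Q(1) _ _ Lt(3)])
      show "{x. d y x \<le> t0} \<subseteq> \<Omega>" using Q(2) sub \<delta>(2) by blast
      show "\<bar>u x\<bar> \<le> M" if "d y x \<le> t0" for x using M[of x] Q(2) that by auto
      show "\<bar>u x\<bar> \<le> M" using M[of x] x R by auto
    qed
  qed
qed

lemma viscosity_holder_inj_radius:
  fixes x0 :: "real^'n" and u :: "real^'n \<Rightarrow> real"
  defines "i \<equiv> inj_radius g x0"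
  defines "R \<equiv> (if i = \<infinity> then 1 else real_of_ereal i / 2)" and "M \<equiv> real_of_ereal (Linf_norm (riem_ball g i x0) u)"
  assumes \<Omega>: "open \<Omega>" and growth: "growth_bound \<Omega> f \<beta> C2 C3" and sol: "viscosity_solution A \<Omega> f u"
    and \<alpha>: "0 < \<alpha>" "\<alpha> < 1" and barrier: "holder_barrier \<alpha> \<beta> C2 C3 L t0"
    and t0: "t0 \<le> R" and LM: "2 * M \<le> L * t0 powr \<alpha>"
    and sub: "riem_ball g (2 * i) x0 \<subseteq> \<Omega>" and fin: "Linf_norm (riem_ball g i x0) u < \<infinity>"
    and x: "x \<in> riem_ball g (i / 4) x0" and y: "y \<in> riem_ball g (i / 4) x0"
  shows "\<bar>u x - u y\<bar> \<le> L * d x y powr \<alpha>"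
proof -
  have i0: "0 < i"
  proof -
    have "ereal 0 \<le> ereal (d x0 x)" by simp
    also have "\<dots> < i / 4" using x by (simp add: riem_ball_def)
    finally show ?thesis by (cases i) auto
  qed
  \<comment> \<open>The centre \<open>y\<close> is within i/4 of \<open>x0\<close> and
    \<open>t0\<close> is at most i/2; their sum stays below 3i/4, which leaves room for a compact
    ball. An infinite radius imposes no restriction.\<close>
  obtain s where s: "ereal s < i" "d x0 y + t0 \<le> s"
  proof (cases i)
    case (real \<rho>)
    have "d x0 y < \<rho> / 4" using y real by (simp add: riem_ball_def)
    moreover have "t0 \<le> \<rho> / 2" using t0 real by (simp add: R_def)
    ultimately show ?thesis using that[of "3 * \<rho> / 4"] real i0 by simp
  next
    case PInf
    then show ?thesis using that[of "d x0 y + t0"] by simp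
  qed (use i0 in auto)
  note Q = compact_riem_cball_subset[OF compact_riem_cball_inj_radius[OF s(1)[unfolded i_def]] s(2)]
  have sball: "{x. d x0 x \<le> s} \<subseteq> riem_ball g i x0"
  proof
    fix x assume "x \<in> {x. d x0 x \<le> s}"
    then have "ereal (d x0 x) \<le> ereal s" by simp
    also note s(1)
    finally show "x \<in> riem_ball g i x0" by (simp add: riem_ball_def)
  qed
  have ball2: "riem_ball g i x0 \<subseteq> riem_ball g (2 * i) x0"
    using i0 by (cases i) (auto simp: riem_ball_def)
  have ball4: "riem_ball g (i / 4) x0 \<subseteq> riem_ball g i x0"
    using i0 by (cases i) (auto simp: riem_ball_def)
  have "continuous_on \<Omega> u"
    using sol by (auto simp: viscosity_solution_def viscosity_subsolution_def viscosity_supersolution_def intro: usc_lsc_imp_continuous_on)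
  then have "continuous_on (riem_ball g i x0) u"
    using ball2 sub by (meson continuous_on_subset)
  then have M: "\<bar>u x\<bar> \<le> M" if "x \<in> riem_ball g i x0" for x
    unfolding M_def using abs_le_Linf_norm[OF open_riem_ball _ fin that] by blast
  show ?thesis
  proof (rule viscosity_holder[OF \<Omega> growth sol \<alpha> barrier Q(1) _ _ LM])
    show "{x. d y x \<le> t0} \<subseteq> \<Omega>" using Q(2) sball ball2 sub by blast
    show "\<bar>u x\<bar> \<le> M" if "d y x \<le> t0" for x using M[of x] Q(2) sball that by blast
    show "\<bar>u x\<bar> \<le> M" using M[of x] x ball4 by blast
  qed
qed

end

section \<open>Uniform choice of the constants\<close>

theorem theorem1p3:
  shows "\<exists>(C :: (real^'n::finite) set \<Rightarrow> (real^'n \<Rightarrow> real^'n^'n) \<Rightarrow> real)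
    (L1 :: real \<Rightarrow> ereal \<Rightarrow> real \<Rightarrow> real \<Rightarrow> real \<Rightarrow> ereal \<Rightarrow> real \<Rightarrow> real).
    \<forall>(A :: real^'n \<Rightarrow> real^'n^'n) (\<Omega> :: (real^'n) set)
      (f :: real^'n \<Rightarrow> real \<Rightarrow> real^'n \<Rightarrow> real) (\<beta> :: real) (C2 :: real) (C3 :: real)
      (u :: real^'n \<Rightarrow> real) (\<alpha> :: real).
      smooth_frame A \<and>
      open \<Omega> \<and> connected \<Omega> \<and> \<Omega> \<noteq> {} \<and>
      continuous_on (\<Omega> \<times> UNIV \<times> UNIV) (\<lambda>(x, p, \<xi>). f x p \<xi>) \<and>
      0 \<le> \<beta> \<and> \<beta> < 4 \<and> 0 \<le> C2 \<and> 0 \<le> C3 \<and>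
      growth_bound \<Omega> f \<beta> C2 C3 \<and>
      viscosity_solution A \<Omega> f u \<and>
      0 < \<alpha> \<and> \<alpha> < min 1 ((4 - \<beta>) / 3) \<longrightarrow>
      (let g = frame_metric A; i = inj_radius g in
        locally_holder_on g \<Omega> \<alpha> u \<and>
        (\<forall>x0\<in>\<Omega>.
          riem_ball g (2 * i x0) x0 \<subseteq> \<Omega> \<and>
          Linf_norm (riem_ball g (i x0) x0) u < \<infinity> \<longrightarrow>
          (\<forall>x \<in> riem_ball g (i x0 / 4) x0. \<forall>y \<in> riem_ball g (i x0 / 4) x0.
            \<bar>u x - u y\<bar> \<le>
              L1 \<alpha> (Linf_norm (riem_ball g (i x0) x0) u) C2 C3 \<beta> (i x0)
                (C (closure (riem_ball g (2 * i x0) x0)) g)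
              * riem_dist g x y powr \<alpha>)))"
proof -
  define good where "good \<alpha> M C2 C3 \<beta> R q \<longleftrightarrow> (case q of (L, t0) \<Rightarrow>
    holder_barrier \<alpha> \<beta> C2 C3 L t0 \<and> t0 \<le> R \<and> 2 * M \<le> L * t0 powr \<alpha>)"
    for \<alpha> M C2 C3 \<beta> R :: real and q :: "real \<times> real"
  \<comment> \<open>The case distinction is needed because \<open>real_of_ereal\<close> is 0 at
    infinity, where any positive radius serves.\<close>
  define R :: "ereal \<Rightarrow> real" where "R i = (if i = \<infinity> then 1 else real_of_ereal i / 2)" for i
  \<comment> \<open>The selection sees only the listed quantities, so a single \<open>L1\<close>
    serves every frame, domain, right-hand side and solution.\<close>
  define L1 :: "real \<Rightarrow> ereal \<Rightarrow> real \<Rightarrow> real \<Rightarrow> real \<Rightarrow> ereal \<Rightarrow> real \<Rightarrow> real"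
    where "L1 \<alpha> M C2 C3 \<beta> i c = fst (SOME q. good \<alpha> (real_of_ereal M) C2 C3 \<beta> (R i) q)" for \<alpha> M C2 C3 \<beta> i c
  show ?thesis
  proof (rule exI[of _ "\<lambda>_ _. 0"], rule exI[of _ L1], intro allI impI, elim conjE)
    fix A :: "real^'n \<Rightarrow> real^'n^'n" and \<Omega> :: "(real^'n) set"
      and f :: "real^'n \<Rightarrow> real \<Rightarrow> real^'n \<Rightarrow> real" and \<beta> C2 C3 :: real and u :: "real^'n \<Rightarrow> real" and \<alpha> :: real
    assume A: "smooth_frame A" and \<Omega>: "open \<Omega>"
      and \<beta>: "0 \<le> \<beta>" "\<beta> < 4" and C: "0 \<le> C2" "0 \<le> C3" and growth: "growth_bound \<Omega> f \<beta> C2 C3"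
      and sol: "viscosity_solution A \<Omega> f u" and \<alpha>: "0 < \<alpha>" "\<alpha> < min 1 ((4 - \<beta>) / 3)"
    interpret framed_space A by unfold_locales (rule A)
    have \<alpha>1: "\<alpha> < 1" using \<alpha>(2) by simp
    have "locally_holder_on (frame_metric A) \<Omega> \<alpha> u"
      by (rule viscosity_locally_holder[OF \<Omega> growth sol \<beta> C \<alpha>(1) \<alpha>1])
    moreover have "\<bar>u x - u y\<bar> \<le>
        L1 \<alpha> (Linf_norm (riem_ball g (inj_radius g x0) x0) u) C2 C3 \<beta> (inj_radius g x0) 0 * riem_dist g x y powr \<alpha>"
      if sub: "riem_ball g (2 * inj_radius g x0) x0 \<subseteq> \<Omega>"
        and fin: "Linf_norm (riem_ball g (inj_radius g x0) x0) u < \<infinity>"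
        and x: "x \<in> riem_ball g (inj_radius g x0 / 4) x0" and y: "y \<in> riem_ball g (inj_radius g x0 / 4) x0"
      for x0 x y
    proof -
      let ?i = "inj_radius g x0"
      let ?M = "real_of_ereal (Linf_norm (riem_ball g ?i x0) u)"
      \<comment> \<open>A point in the ball of radius i/4 forces i, and hence \<open>R\<close>, to
        be positive, as a barrier requires.\<close>
      have "ereal 0 \<le> ereal (d x0 x)" by simp
      also have "\<dots> < ?i / 4" using x by (simp add: riem_ball_def)
      finally have "0 < R ?i" by (cases ?i) (auto simp: R_def)
      then have "\<exists>q. good \<alpha> ?M C2 C3 \<beta> (R ?i) q"
        using holder_barrier_exists[OF \<alpha>(1) \<alpha>1 \<beta> C, of "R ?i" ?M] unfolding good_def by auto
      then have "good \<alpha> ?M C2 C3 \<beta> (R ?i) (SOME q. good \<alpha> ?M C2 C3 \<beta> (R ?i) q)"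
        by (rule someI_ex)
      then obtain L t0 where L: "L1 \<alpha> (Linf_norm (riem_ball g ?i x0) u) C2 C3 \<beta> ?i 0 = L"
        and b: "good \<alpha> ?M C2 C3 \<beta> (R ?i) (L, t0)"
        unfolding L1_def by (metis prod.collapse)
      show ?thesis
        unfolding L
        by (rule viscosity_holder_inj_radius[where ?t0.0=t0, OF \<Omega> growth sol \<alpha>(1) \<alpha>1 _ _ _ sub fin x y])
           (use b in \<open>auto simp: good_def R_def\<close>)
    qed
    ultimately show "let g = frame_metric A; i = inj_radius g in
        locally_holder_on g \<Omega> \<alpha> u \<and>
        (\<forall>x0\<in>\<Omega>.
          riem_ball g (2 * i x0) x0 \<subseteq> \<Omega> \<and>
          Linf_norm (riem_ball g (i x0) x0) u < \<infinity> \<longrightarrow>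
          (\<forall>x \<in> riem_ball g (i x0 / 4) x0. \<forall>y \<in> riem_ball g (i x0 / 4) x0.
            \<bar>u x - u y\<bar> \<le> L1 \<alpha> (Linf_norm (riem_ball g (i x0) x0) u) C2 C3 \<beta> (i x0) 0
              * riem_dist g x y powr \<alpha>))"
      by (simp add: Let_def)
  qed
qed

end
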